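(* In $\mathbb{Z}[t][[u]]$, \[ \sum_{n=2}^\infty Z_{W_n}(t) u^{n}=-\frac{2 u (1-(t+1) u) (t (u+1)+1)}{1-(t+1) u-2 t u^2+\sqrt{(1-(t+1) u)^2-4 t u^2}}+\frac{1}{\sqrt{(1-(t+1) u)^2-4 t u^2}}-1, \] where the square root is the power series in $u$ with constant term $1$.
   Context: For a matroid $M$ let $L(M)$ be its lattice of flats, $\mathrm{rk}\, M$ its rank, $\chi_M(t)$ its characteristic polynomial; for a flat $F$, $M_F$ is the localization (restriction to $F$) and $M^F$ the contraction at $F$. The Kazhdan–Lusztig polynomial is the unique assignment of $P_M(t)\in\mathbb{Z}[t]$ to each loopless matroid $M$ with: $P_M=1$ if $\mathrm{rk}\, M=0$; $\deg P_M<\frac12\mathrm{rk}\, M$ if $\mathrm{rk}\, M>0$; $t^{\mathrm{rk}\, M}P_M(t^{-1})=\sum_{F\in L(M)}\chi_{M_F}(t)P_{M^F}(t)$. The $Z$-polynomial is $Z_M(t)=\sum_{F\in L(M)}t^{\mathrm{rk}\, M_F}P_{M^F}(t)$; for a graph $G$, $Z_G=Z_{M(G)}$. For $n\ge3$ the wheel $W_n$ has vertices $0,\dots,n$, the edges of the cycle $1,2,\dots,n,1$ and edges $\{0,i\}$ ($1\le i\le n$); $W_2$ denotes the simple cycle (triangle) on three vertices. *)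

theory Defs
  imports "HOL-Computational_Algebra.Computational_Algebra"
begin

section \<open>Matroids\<close>

record 'a set_system =
  ground :: "'a set"
  indeps :: "'a set set"

definition is_matroid :: "'a set_system \<Rightarrow> bool" where
  "is_matroid M \<longleftrightarrow>
     finite (ground M) \<and>
     indeps M \<subseteq> Pow (ground M) \<and>
     {} \<in> indeps M \<and>
     (\<forall>I \<in> indeps M. \<forall>J. J \<subseteq> I \<longrightarrow> J \<in> indeps M) \<and>
     (\<forall>I \<in> indeps M. \<forall>J \<in> indeps M. card I < card J \<longrightarrow>
        (\<exists>x \<in> J - I. insert x I \<in> indeps M))"

definition loopless :: "'a set_system \<Rightarrow> bool" where
  "loopless M \<longleftrightarrow> (\<forall>e \<in> ground M. {e} \<in> indeps M)"

definition rank_of :: "'a set_system \<Rightarrow> 'a set \<Rightarrow> nat" where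
  "rank_of M A = Max (card ` {I \<in> indeps M. I \<subseteq> A})"

definition rk :: "'a set_system \<Rightarrow> nat" where
  "rk M = rank_of M (ground M)"

text \<open>The lattice of flats, ordered by inclusion.\<close>

definition flats :: "'a set_system \<Rightarrow> 'a set set" where
  "flats M = {F. F \<subseteq> ground M \<and>
     (\<forall>x \<in> ground M - F. rank_of M F < rank_of M (insert x F))}"

definition localization :: "'a set_system \<Rightarrow> 'a set \<Rightarrow> 'a set_system" where
  "localization M F = \<lparr>ground = F, indeps = {I \<in> indeps M. I \<subseteq> F}\<rparr>"

definition contraction :: "'a set_system \<Rightarrow> 'a set \<Rightarrow> 'a set_system" where
  "contraction M F = \<lparr>ground = ground M - F,
     indeps = {I. I \<subseteq> ground M - F \<and> rank_of M (I \<union> F) = card I + rank_of M F}\<rparr>"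


section \<open>Characteristic, Kazhdan--Lusztig and Z-polynomials\<close>

text \<open>The Moebius function of a family \<open>L\<close> of finite sets ordered by inclusion.
  It is meaningful for \<open>F, G \<in> L\<close>; finiteness of \<open>G\<close> is only tested to ensure termination.\<close>

function moebius :: "'a set set \<Rightarrow> 'a set \<Rightarrow> 'a set \<Rightarrow> int" where
  "moebius L F G =
     (if F = G then 1
      else if F \<subset> G \<and> finite G then - (\<Sum>H \<in> {H \<in> L. F \<subseteq> H \<and> H \<subset> G}. moebius L F H)
      else 0)"
  by auto
termination
  by (relation "measure (\<lambda>(L, F, G). card G)") (auto intro: psubset_card_mono)

declare moebius.simps [simp del]

text \<open>The empty set is the least flat precisely when \<open>M\<close> is loopless, which is the only case
  in which the characteristic polynomial is used.\<close>

definition char_poly :: "'a set_system \<Rightarrow> int poly" where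
  "char_poly M = (\<Sum>F \<in> flats M. monom (moebius (flats M) {} F) (rk M - rank_of M F))"

text \<open>For \<open>degree p \<le> d\<close> this is \<open>t\<^sup>d p(t\<^sup>-\<^sup>1)\<close>.\<close>

definition flip_poly :: "nat \<Rightarrow> int poly \<Rightarrow> int poly" where
  "flip_poly d p = monom 1 (d - degree p) * reflect_poly p"

definition KL_assignment :: "('a set_system \<Rightarrow> int poly) \<Rightarrow> bool" where
  "KL_assignment P \<longleftrightarrow> (\<forall>M. is_matroid M \<and> loopless M \<longrightarrow>
     (rk M = 0 \<longrightarrow> P M = 1) \<and>
     (rk M > 0 \<longrightarrow> 2 * degree (P M) < rk M) \<and>
     flip_poly (rk M) (P M) =
       (\<Sum>F \<in> flats M. char_poly (localization M F) * P (contraction M F)))"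

text \<open>The value \<open>0\<close> outside loopless matroids is a dummy that makes the assignment unique
  as a total function.\<close>

definition KL_poly :: "'a set_system \<Rightarrow> int poly" where
  "KL_poly = (THE P. KL_assignment P \<and> (\<forall>M. \<not> (is_matroid M \<and> loopless M) \<longrightarrow> P M = 0))"

definition Z_poly :: "'a set_system \<Rightarrow> int poly" where
  "Z_poly M = (\<Sum>F \<in> flats M. monom 1 (rk (localization M F)) * KL_poly (contraction M F))"


section \<open>Graphs and wheels\<close>

text \<open>Simple graphs as pairs of a vertex set and a set of two-element edges.\<close>

type_synonym 'v graph = "'v set \<times> 'v set set"

definition cycle_edges :: "'v list \<Rightarrow> 'v set set" where
  "cycle_edges vs = {{vs ! i, vs ! (Suc i mod length vs)} | i. i < length vs}"

definition forest :: "'v set set \<Rightarrow> bool" where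
  "forest A \<longleftrightarrow> \<not> (\<exists>vs. length vs \<ge> 3 \<and> distinct vs \<and> cycle_edges vs \<subseteq> A)"

definition graphic_matroid :: "'v graph \<Rightarrow> 'v set set_system" where
  "graphic_matroid G = \<lparr>ground = snd G, indeps = {A. A \<subseteq> snd G \<and> forest A}\<rparr>"

definition Z_graph :: "'v graph \<Rightarrow> int poly" where
  "Z_graph G = Z_poly (graphic_matroid G)"

text \<open>Since edges form a set, the formula also covers \<open>n = 2\<close>, where the two rim edges
  coincide and the graph is a triangle.\<close>

definition wheel :: "nat \<Rightarrow> nat graph" where
  "wheel n = ({0..n},
     {{i, Suc i} | i. 1 \<le> i \<and> i < n} \<union> {{n, 1}} \<union> {{0, i} | i. 1 \<le> i \<and> i \<le> n})"

lemma wheel_2: "wheel 2 = ({0, 1, 2}, {{0, 1}, {0, 2}, {1, 2}})"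
proof -
  have "{{i, Suc i} | i. 1 \<le> i \<and> i < 2} = {{1, 2}}"
    by (auto simp: less_Suc_eq numeral_2_eq_2 intro!: exI[of _ 1])
  moreover have "{{0, i} | i. 1 \<le> i \<and> i \<le> 2} = {{0, 1}, {0, 2::nat}}"
    by (auto simp: le_Suc_eq numeral_2_eq_2)
  moreover have "{0..2::nat} = {0, 1, 2}"
    by auto
  ultimately show ?thesis
    unfolding wheel_def by (simp add: insert_commute)
qed


section \<open>Power series\<close>

text \<open>Identities in \<open>\<int>[t][[u]]\<close> that involve quotients are stated in the larger ring
  \<open>\<rat>(t)[[u]]\<close>, rendered as \<^typ>\<open>int poly fract fps\<close>, into which \<open>\<int>[t][[u]]\<close> embeds
  coefficientwise by \<^const>\<open>to_fract\<close>.\<close>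

instance fract :: ("{idom,ring_char_0}") field_char_0
proof
  have "of_nat n = to_fract (of_nat n :: 'a)" for n
    by (induction n) auto
  then show "inj (of_nat :: nat \<Rightarrow> 'a fract)"
    by (auto intro: injI)
qed

definition fps_sqrt :: "'a::field_char_0 fps \<Rightarrow> 'a fps" where
  "fps_sqrt f = fps_radical (\<lambda>_ _. 1) 2 f"

lemma fps_sqrt_iff:
  assumes "fps_nth f 0 = 1"
  shows "s = fps_sqrt f \<longleftrightarrow> s ^ 2 = f \<and> fps_nth s 0 = 1"
  using radical_unique[of "\<lambda>_ _. 1" 1 f s] assms
  by (auto simp: fps_sqrt_def numeral_2_eq_2)

end

theory Submission
  imports Defs
begin

text \<open>
  Write \<open>p F\<close> for the Kazhdan--Lusztig polynomial of the contraction at a flat \<open>F\<close>. The Moebius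
  inversion formula shows that the characteristic polynomials form a kernel, so that the defining
  recursion has a unique solution and the sums \<open>\<Sum>\<^bsub>G \<ge> F\<^esub> t\<^bsup>rk G - rk F\<^esup> p G\<close> are palindromic of degree
  \<open>rk M - rk F\<close>. Conversely, palindromicity and the bound \<open>2 deg (p F) < rk M - rk F\<close>
  determine \<open>p\<close>, by downward induction on \<open>F\<close>: the difference of two solutions at a maximal
  flat of disagreement would be palindromic of too small a degree. So it suffices to guess \<open>p\<close>
  on the flats of the wheel.

  A flat of the wheel is a partition of the vertices, encoded by a cyclic word on the rim. If the block of
  the hub contains rim vertices, then it cuts the rim into gaps, and \<open>p\<close> is the product of the polynomials of
  fans, one for each gap; otherwise \<open>p\<close> is the polynomial of a smaller wheel. With \<open>v = u / (1 - t u)\<close>,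
  the generating functions of the fan and wheel polynomials are the series \<open>H(v)\<close> and \<open>W(v)\<close> given by
  \<open>H = v + v H + t v H\<^sup>2\<close> and \<open>W = v (1 / (1 - v - 2 t v H) - 1 - t H\<^sup>2) / (1 - t v H)\<close>, from which
  the degree bounds can be read off. Summing over the flats turns them into the Narayana series
  \<open>Z = 1 + (1 + t) u Z + t u\<^sup>2 Z\<^sup>2\<close> for fans and into \<open>1/R - 1 - (1 + t) u - t u\<^sup>2 Z\<^sup>2\<close> for wheels, where
  \<open>R = 1 - (1 + t) u - 2 t u\<^sup>2 Z\<close> is the square root in the theorem. Both are power series in
  \<open>(1 + t) u\<close> and \<open>t u\<^sup>2\<close>, hence palindromic.
\<close>

section \<open>Rank functions and matroids\<close>

text \<open>Palindromicity is needed at every flat, and contractions of a wheel acquire parallel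
  edges, so they need not be wheels again. The guess is therefore attached to the flats of one fixed
  matroid, and only ranks and inclusions enter. An upper interval depends only on the numbers of
  blocks: above a word each letter \<open>Start\<close> may stay, merge with its predecessor or turn
  into \<open>Hub\<close>, and each loss of a \<open>Start\<close> raises the rank by one,
  contributing a factor t. The one exception is the rim as a single block without the hub, whose
  rank is one lower than this count. A block is a \<open>Start\<close> with a run of merged letters
  behind it, with series u + t u^2 + t^2 u^3 + ..., which is the origin of v = u / (1 - t u). Cyclic
  words are cut at the first hub letter. Summing over the position of the cut differentiates the fan
  series, and since u times the derivative of H in u equals H / R, this is how the inverse square
  root appears in the sum.\<close>

locale rank_function =
  fixes E :: "'a set" and r :: "'a set \<Rightarrow> nat"
  assumes fin: "finite E"
    and r_empty: "r {} = 0"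
    and r_insert_ge: "\<lbrakk>A \<subseteq> E; x \<in> E\<rbrakk> \<Longrightarrow> r A \<le> r (insert x A)"
    and r_insert_le: "\<lbrakk>A \<subseteq> E; x \<in> E\<rbrakk> \<Longrightarrow> r (insert x A) \<le> r A + 1"
    and r_local: "\<lbrakk>A \<subseteq> E; x \<in> E; y \<in> E; r (insert x A) = r A; r (insert y A) = r A\<rbrakk>
      \<Longrightarrow> r (insert x (insert y A)) = r A"
begin

lemma r_mono:
  assumes "A \<subseteq> B" "B \<subseteq> E"
  shows "r A \<le> r B"
proof -
  have "r A \<le> r (A \<union> X)" if "finite X" "X \<subseteq> E" for X
    using that
  proof (induction X rule: finite_induct)
    case (insert x X)
    have "r (A \<union> X) \<le> r (insert x (A \<union> X))"
      using insert assms by (intro r_insert_ge) auto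
    then show ?case using insert by simp
  qed simp
  from this[of B] show ?thesis
    using assms fin finite_subset by (metis sup.absorb2)
qed

lemma r_Un_le:
  assumes "A \<subseteq> E" "X \<subseteq> E"
  shows "r (A \<union> X) \<le> r A + card X"
proof -
  have "finite X" using assms fin finite_subset by blast
  then show ?thesis using assms
  proof (induction X rule: finite_induct)
    case (insert x X)
    have "r (insert x (A \<union> X)) \<le> r (A \<union> X) + 1"
      using insert by (intro r_insert_le) auto
    then show ?case using insert by simp
  qed simp
qed

lemma r_le_card: "A \<subseteq> E \<Longrightarrow> r A \<le> card A"
  using r_Un_le[of "{}" A] r_empty by simp

text \<open>Elements of \<open>B\<close> are added to \<open>A\<close> one at a time. If y leaves
  the rank unchanged, \<open>r_local\<close> applies; if y raises it, then x cannot raise it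
  further, since x and y together add at most one. This is monotonicity of closure, derived from the
  local axiom.\<close>

lemma r_insert_eq_mono:
  assumes "r (insert x A) = r A" "A \<subseteq> B" "B \<subseteq> E" "x \<in> E"
  shows "r (insert x B) = r B"
proof -
  have "r (insert x (A \<union> X)) = r (A \<union> X)" if "finite X" "X \<subseteq> E" for X
    using that
  proof (induction X rule: finite_induct)
    case empty
    then show ?case using assms by simp
  next
    case (insert y X)
    let ?A = "A \<union> X"
    have sub: "?A \<subseteq> E" "y \<in> E" using insert assms by auto
    have IH: "r (insert x ?A) = r ?A" using insert by simp
    have "r (insert x (insert y ?A)) = r (insert y ?A)"
    proof (cases "r (insert y ?A) = r ?A")
      case True
      then show ?thesis using r_local[of ?A x y] sub assms(4) IH by simp
    next
      case False
      then have "r (insert y ?A) = r ?A + 1"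
        using r_insert_ge[of ?A y] r_insert_le[of ?A y] sub by simp
      moreover have "r (insert y (insert x ?A)) \<le> r (insert x ?A) + 1"
        using sub assms(4) by (intro r_insert_le) auto
      moreover have "r (insert y ?A) \<le> r (insert x (insert y ?A))"
        using sub assms(4) by (intro r_insert_ge) auto
      ultimately show ?thesis using IH by (simp add: insert_commute)
    qed
    then show ?case by simp
  qed
  from this[of B] show ?thesis
    using assms fin finite_subset by (metis sup.absorb2)
qed

lemma r_Un_eq:
  assumes "A \<subseteq> E" "X \<subseteq> E" "\<And>x. x \<in> X \<Longrightarrow> r (insert x A) = r A"
  shows "r (A \<union> X) = r A"
proof -
  have "finite X" using assms fin finite_subset by blast
  then show ?thesis using assms(2,3)
  proof (induction X rule: finite_induct)
    case (insert x X)
    have "r (insert x (A \<union> X)) = r (A \<union> X)"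
      by (rule r_insert_eq_mono[of x A]) (use insert.prems assms(1) in auto)
    moreover have "r (A \<union> X) = r A"
      using insert.IH insert.prems by blast
    ultimately show ?case by simp
  qed simp
qed

text \<open>No single element of \<open>A\<close> raises the rank of \<open>I\<close>, so
  \<open>I\<close> already spans \<open>A\<close>. This serves both the exchange axiom and the
  computation of \<open>rank_of\<close>.\<close>

lemma maximal_indep_card:
  assumes "I \<subseteq> A" "A \<subseteq> E" "r I = card I"
    and "\<And>x. x \<in> A - I \<Longrightarrow> r (insert x I) \<noteq> card (insert x I)"
  shows "r A = card I"
proof -
  have "r (insert x I) = r I" if "x \<in> A" for x
  proof (cases "x \<in> I")
    case False
    have "finite I" using assms fin finite_subset by (metis subset_trans)
    then have "card (insert x I) = r I + 1" using False assms(3) by simp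
    moreover have "r (insert x I) \<noteq> card (insert x I)" using assms(4) that False by blast
    moreover have "I \<subseteq> E" "x \<in> E" using assms that by auto
    then have "r I \<le> r (insert x I)" "r (insert x I) \<le> r I + 1"
      using r_insert_ge r_insert_le by blast+
    ultimately show ?thesis by simp
  qed (simp add: insert_absorb)
  then have "r (I \<union> A) = r I" using assms by (intro r_Un_eq) auto
  then show ?thesis using assms by (simp add: sup.absorb2)
qed

lemma indep_subset:
  assumes "r I = card I" "J \<subseteq> I" "I \<subseteq> E"
  shows "r J = card J"
proof -
  have "finite I" using assms fin finite_subset by blast
  have "r (J \<union> (I - J)) \<le> r J + card (I - J)" using assms by (intro r_Un_le) auto
  moreover have "J \<union> (I - J) = I" using assms by auto
  moreover have "card (I - J) = card I - card J" "card J \<le> card I"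
    using assms \<open>finite I\<close> by (auto intro: card_Diff_subset finite_subset card_mono)
  moreover have "r J \<le> card J" using assms r_le_card by blast
  ultimately show ?thesis using assms(1) by simp
qed

lemma is_matroid_of_rank: "is_matroid \<lparr>ground = E, indeps = {I. I \<subseteq> E \<and> r I = card I}\<rparr>"
  unfolding is_matroid_def
proof (simp, intro conjI allI impI ballI)
  show "finite E" by (rule fin)
  show "r {} = 0" by (rule r_empty)
next
  fix I J assume "I \<subseteq> E \<and> r I = card I" "J \<subseteq> I"
  then show "J \<subseteq> E" by auto
next
  fix I J assume "I \<subseteq> E \<and> r I = card I" "J \<subseteq> I"
  then show "r J = card J" using indep_subset by blast
next
  fix I J assume I: "I \<subseteq> E \<and> r I = card I" and J: "J \<subseteq> E \<and> r J = card J" and less: "card I < card J"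
  show "\<exists>x\<in>J - I. x \<in> E \<and> r (insert x I) = card (insert x I)"
  proof (rule ccontr)
    assume neg: "\<not> ?thesis"
    have "r (I \<union> J) = card I"
      by (rule maximal_indep_card) (use I J neg in auto)
    moreover have "r J \<le> r (I \<union> J)" using I J by (intro r_mono) auto
    ultimately show False using J less by simp
  qed
qed auto

lemma rank_of_rank:
  assumes "A \<subseteq> E"
  shows "rank_of \<lparr>ground = E, indeps = {I. I \<subseteq> E \<and> r I = card I}\<rparr> A = r A"
proof -
  let ?S = "{I \<in> {I. I \<subseteq> E \<and> r I = card I}. I \<subseteq> A}"
  have "finite ?S" using fin by auto
  moreover have ne: "{} \<in> ?S" using r_empty by simp
  ultimately have "finite (card ` ?S)" "card ` ?S \<noteq> {}" by blast+
  then obtain I where I: "I \<in> ?S" "card I = Max (card ` ?S)"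
    using Max_in by (metis (no_types, lifting) imageE)
  have "r A = card I"
  proof (rule maximal_indep_card)
    fix x assume x: "x \<in> A - I"
    show "r (insert x I) \<noteq> card (insert x I)"
    proof
      assume "r (insert x I) = card (insert x I)"
      then have "insert x I \<in> ?S" using I x assms by auto
      then have "card (insert x I) \<le> card I" using I(2) \<open>finite (card ` ?S)\<close> by auto
      moreover have "finite I" using I fin finite_subset by blast
      ultimately show False using x by simp
    qed
  qed (use I assms in auto)
  then show ?thesis unfolding rank_of_def using I by simp
qed

end

section \<open>Rank, independence and flats of a given matroid\<close>

locale matroid =
  fixes M :: "'a set_system"
  assumes is_matroid: "is_matroid M"
begin

abbreviation "E \<equiv> ground M"
abbreviation "r \<equiv> rank_of M"

lemma finite_ground: "finite E"
  and indep_subset_ground: "I \<in> indeps M \<Longrightarrow> I \<subseteq> E"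
  and empty_indep: "{} \<in> indeps M"
  and indep_mono: "I \<in> indeps M \<Longrightarrow> J \<subseteq> I \<Longrightarrow> J \<in> indeps M"
  using is_matroid by (auto simp: is_matroid_def)

lemma exchange:
  "I \<in> indeps M \<Longrightarrow> J \<in> indeps M \<Longrightarrow> card I < card J \<Longrightarrow> \<exists>x\<in>J - I. insert x I \<in> indeps M"
  using is_matroid by (simp add: is_matroid_def)

lemma finite_indep: "I \<in> indeps M \<Longrightarrow> finite I"
  using indep_subset_ground finite_ground finite_subset by metis

lemma finite_indeps: "finite (indeps M)"
  using finite_ground indep_subset_ground by (intro finite_subset[of "indeps M" "Pow E"]) auto

lemma card_le_rank: "I \<in> indeps M \<Longrightarrow> I \<subseteq> A \<Longrightarrow> card I \<le> r A"
  unfolding rank_of_def using finite_indeps by (intro Max_ge) auto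

lemma rank_basis: "\<exists>I. I \<in> indeps M \<and> I \<subseteq> A \<and> card I = r A"
proof -
  have "r A \<in> card ` {I \<in> indeps M. I \<subseteq> A}"
    unfolding rank_of_def using finite_indeps empty_indep by (intro Max_in) auto
  then show ?thesis by auto
qed

lemma rank_le_iff: "r A \<le> k \<longleftrightarrow> (\<forall>I\<in>indeps M. I \<subseteq> A \<longrightarrow> card I \<le> k)"
  by (metis rank_basis card_le_rank order.trans)

lemma rank_mono: "A \<subseteq> B \<Longrightarrow> r A \<le> r B"
  by (metis rank_le_iff card_le_rank order.trans)

sublocale rank_function E r
proof
  show "finite E" by (rule finite_ground)
  have "r {} \<le> 0" unfolding rank_le_iff by auto
  then show "r {} = 0" by simp
next
  fix A x
  show "r A \<le> r (insert x A)" by (intro rank_mono) auto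
  show "r (insert x A) \<le> r A + 1"
    unfolding rank_le_iff
  proof (intro ballI impI)
    fix I assume I: "I \<in> indeps M" "I \<subseteq> insert x A"
    then have "card (I - {x}) \<le> r A"
      using indep_mono[of I "I - {x}"] by (intro card_le_rank) auto
    then show "card I \<le> r A + 1" using finite_indep[OF I(1)] card_Diff1_le[of I x]
      by (metis Suc_eq_plus1 card_Diff_singleton_if card_Suc_Diff1 le_SucI not_less_eq_eq)
  qed
next
  fix A x y
  assume eq: "r (insert x A) = r A" "r (insert y A) = r A"
  show "r (insert x (insert y A)) = r A"
  proof (rule antisym)
    obtain I where I: "I \<in> indeps M" "I \<subseteq> A" "card I = r A" using rank_basis by blast
    show "r (insert x (insert y A)) \<le> r A"
      unfolding rank_le_iff
    proof (intro ballI impI, rule ccontr)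
      fix J assume J: "J \<in> indeps M" "J \<subseteq> insert x (insert y A)" "\<not> card J \<le> r A"
      \<comment> \<open>One exchange step adds a single element, so the enlarged set already fits
        into \<open>insert x A\<close> or \<open>insert y A\<close>, where the rank has not
        grown.\<close>
      then obtain z where z: "z \<in> J - I" "insert z I \<in> indeps M"
        using exchange[of I J] I by auto
      then have "card (insert z I) = r A + 1" using I finite_indep by simp
      moreover have "insert z I \<subseteq> insert x A \<or> insert z I \<subseteq> insert y A" using z J I by auto
      ultimately show False
        using card_le_rank[OF z(2), of "insert x A"] card_le_rank[OF z(2), of "insert y A"] eq
        by linarith
    qed
  qed (auto intro: rank_mono)
qed

lemma indep_iff_rank: "I \<in> indeps M \<longleftrightarrow> I \<subseteq> E \<and> r I = card I"
proof
  assume I: "I \<in> indeps M"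
  then have "card I \<le> r I" "r I \<le> card I"
    using card_le_rank[of I I] r_le_card[of I] indep_subset_ground by auto
  then show "I \<subseteq> E \<and> r I = card I" using indep_subset_ground[OF I] by simp
next
  assume I: "I \<subseteq> E \<and> r I = card I"
  obtain J where "J \<in> indeps M" "J \<subseteq> I" "card J = r I" using rank_basis by blast
  then show "I \<in> indeps M" using I finite_ground finite_subset card_subset_eq by metis
qed

lemma flat_iff: "F \<in> flats M \<longleftrightarrow> F \<subseteq> E \<and> (\<forall>x\<in>E - F. r F < r (insert x F))"
  by (simp add: flats_def)

lemma flat_subset: "F \<in> flats M \<Longrightarrow> F \<subseteq> E"
  by (simp add: flat_iff)

lemma finite_flats: "finite (flats M)"
  using finite_ground flat_subset by (intro finite_subset[of "flats M" "Pow E"]) auto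

lemma ground_flat: "E \<in> flats M"
  by (simp add: flat_iff)

lemma rank_flat_less:
  assumes "F \<in> flats M" "F \<subset> A" "A \<subseteq> E"
  shows "r F < r A"
proof -
  obtain x where x: "x \<in> A" "x \<notin> F" using assms by auto
  then have "r F < r (insert x F)" using assms by (auto simp: flat_iff)
  also have "\<dots> \<le> r A" using x assms by (intro rank_mono) auto
  finally show ?thesis .
qed

section \<open>Contractions and localizations\<close>

lemma rank_contraction_function:
  assumes F: "F \<subseteq> E"
  shows "rank_function (E - F) (\<lambda>A. r (A \<union> F) - r F)"
proof
  show "finite (E - F)" using finite_ground by simp
  show "r ({} \<union> F) - r F = 0" by simp
next
  fix A x assume A: "A \<subseteq> E - F" "x \<in> E - F"
  show "r (A \<union> F) - r F \<le> r (insert x A \<union> F) - r F"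
    by (intro diff_le_mono rank_mono) auto
  have "r (insert x (A \<union> F)) \<le> r (A \<union> F) + 1" using A F by (intro r_insert_le) auto
  then show "r (insert x A \<union> F) - r F \<le> r (A \<union> F) - r F + 1" by simp
next
  fix A x y assume A: "A \<subseteq> E - F" "x \<in> E - F" "y \<in> E - F"
    and "r (insert x A \<union> F) - r F = r (A \<union> F) - r F" "r (insert y A \<union> F) - r F = r (A \<union> F) - r F"
  moreover have "r F \<le> r (A \<union> F)" "r F \<le> r (insert x (A \<union> F))" "r F \<le> r (insert y (A \<union> F))"
    by (auto intro: rank_mono)
  ultimately have "r (insert x (A \<union> F)) = r (A \<union> F)" "r (insert y (A \<union> F)) = r (A \<union> F)"
    by auto
  then have "r (insert x (insert y (A \<union> F))) = r (A \<union> F)"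
    using A F by (intro r_local) auto
  then show "r (insert x (insert y A) \<union> F) - r F = r (A \<union> F) - r F" by simp
qed

lemma contraction_eq:
  assumes "F \<subseteq> E"
  shows "contraction M F =
    \<lparr>ground = E - F, indeps = {I. I \<subseteq> E - F \<and> r (I \<union> F) - r F = card I}\<rparr>"
proof -
  have "r F \<le> r (I \<union> F)" for I by (intro rank_mono) auto
  then have "r (I \<union> F) = card I + r F \<longleftrightarrow> r (I \<union> F) - r F = card I" for I
    by (metis add_diff_cancel_right' le_add_diff_inverse2)
  then show ?thesis unfolding contraction_def by auto
qed

lemma contraction_matroid:
  assumes "F \<subseteq> E"
  shows "matroid (contraction M F)"
  unfolding contraction_eq[OF assms]
  by (intro matroid.intro rank_function.is_matroid_of_rank rank_contraction_function assms)

lemma rank_contraction: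
  assumes "F \<subseteq> E" "A \<subseteq> E - F"
  shows "rank_of (contraction M F) A = r (A \<union> F) - r F"
  unfolding contraction_eq[OF assms(1)]
  by (intro rank_function.rank_of_rank rank_contraction_function assms)

lemma ground_contraction [simp]: "ground (contraction M F) = E - F"
  by (simp add: contraction_def)

lemma rk_contraction: "F \<subseteq> E \<Longrightarrow> rk (contraction M F) = r E - r F"
  by (simp add: rk_def rank_contraction Un_absorb2)

lemma contraction_loopless:
  assumes "F \<in> flats M"
  shows "loopless (contraction M F)"
  unfolding loopless_def
proof
  fix e assume "e \<in> ground (contraction M F)"
  then have e: "e \<in> E" "e \<notin> F" by auto
  have F: "F \<subseteq> E" using assms flat_subset by auto
  have "r F < r (insert e F)" "r (insert e F) \<le> r F + 1"
    using assms e F r_insert_le[of F e] by (auto simp: flat_iff)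
  then have "r ({e} \<union> F) - r F = 1" by simp
  then show "{e} \<in> indeps (contraction M F)"
    unfolding contraction_eq[OF F] using e by simp
qed

lemma flats_contraction:
  assumes F: "F \<in> flats M"
  shows "flats (contraction M F) = (\<lambda>G. G - F) ` {G \<in> flats M. F \<subseteq> G}"
proof (rule set_eqI)
  fix A
  have FE: "F \<subseteq> E" using F flat_subset by auto
  interpret N: matroid "contraction M F" by (rule contraction_matroid[OF FE])
  have iff: "A \<in> flats (contraction M F) \<longleftrightarrow> A \<union> F \<in> flats M" if A: "A \<subseteq> E - F"
  proof -
    have "rank_of (contraction M F) A < rank_of (contraction M F) (insert x A) \<longleftrightarrow>
       r (A \<union> F) < r (insert x (A \<union> F))" if "x \<in> E - F - A" for x
    proof -
      have "r F \<le> r (A \<union> F)" by (intro rank_mono) auto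
      then show ?thesis using A that FE by (auto simp: rank_contraction)
    qed
    then show ?thesis unfolding N.flat_iff flat_iff using A FE by auto
  qed
  show "A \<in> flats (contraction M F) \<longleftrightarrow> A \<in> (\<lambda>G. G - F) ` {G \<in> flats M. F \<subseteq> G}"
  proof
    assume "A \<in> flats (contraction M F)"
    moreover from this have "A \<subseteq> E - F" using N.flat_subset by auto
    ultimately have "A \<union> F \<in> flats M" "A = A \<union> F - F" using iff by auto
    then show "A \<in> (\<lambda>G. G - F) ` {G \<in> flats M. F \<subseteq> G}" by blast
  next
    assume "A \<in> (\<lambda>G. G - F) ` {G \<in> flats M. F \<subseteq> G}"
    then obtain G where G: "G \<in> flats M" "F \<subseteq> G" "A = G - F" by auto
    then have "A \<subseteq> E - F" "A \<union> F = G" using flat_subset by auto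
    then show "A \<in> flats (contraction M F)" using iff G by simp
  qed
qed

text \<open>Relative ranks telescope. Iterated contractions in the recursion can thus be indexed by
  flats of \<open>M\<close> alone.\<close>

lemma contraction_contraction:
  assumes "F \<subseteq> G" "G \<subseteq> E"
  shows "contraction (contraction M F) (G - F) = contraction M G"
proof -
  have FE: "F \<subseteq> E" using assms by auto
  interpret N: matroid "contraction M F" by (rule contraction_matroid[OF FE])
  have "rank_of (contraction M F) (I \<union> (G - F)) - rank_of (contraction M F) (G - F) = r (I \<union> G) - r G"
    if "I \<subseteq> E - G" for I
  proof -
    have "I \<union> (G - F) \<union> F = I \<union> G" "G - F \<union> F = G" using assms by auto
    moreover have "r F \<le> r G" "r G \<le> r (I \<union> G)" using assms by (auto intro: rank_mono)
    ultimately show ?thesis using that assms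
      by (subst (1 2) rank_contraction[OF FE]) auto
  qed
  moreover have "E - F - (G - F) = E - G" using assms by auto
  ultimately show ?thesis
    using assms by (subst N.contraction_eq) (auto simp: contraction_eq Diff_mono)
qed

text \<open>An equality of records, so that \<open>M\<close> itself counts as the contraction at its
  least flat.\<close>

lemma contraction_empty: "contraction M {} = M"
proof -
  have "{I. I \<subseteq> E \<and> r I = card I} = indeps M" using indep_iff_rank by auto
  then show ?thesis by (simp add: contraction_eq r_empty)
qed

lemma ground_localization [simp]: "ground (localization M F) = F"
  by (simp add: localization_def)

lemma rank_localization: "A \<subseteq> F \<Longrightarrow> rank_of (localization M F) A = r A"
proof -
  assume "A \<subseteq> F"
  then have "{I \<in> indeps (localization M F). I \<subseteq> A} = {I \<in> indeps M. I \<subseteq> A}"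
    by (auto simp: localization_def)
  then show ?thesis by (simp add: rank_of_def)
qed

lemma rk_localization: "rk (localization M F) = r F"
  using rank_localization[of F F] by (simp add: rk_def)

text \<open>A point outside \<open>F\<close> that left the rank of some \<open>G\<close> inside
  \<open>F\<close> unchanged would also leave the rank of \<open>F\<close> unchanged, by
  monotonicity of closure.\<close>

lemma flats_localization:
  assumes F: "F \<in> flats M"
  shows "flats (localization M F) = {G \<in> flats M. G \<subseteq> F}"
proof -
  have "G \<in> flats (localization M F) \<longleftrightarrow> G \<in> flats M" if G: "G \<subseteq> F" for G
  proof -
    have out: "r G < r (insert x G)" if x: "x \<in> E - F" for x
    proof (rule ccontr)
      assume "\<not> ?thesis"
      moreover have "r G \<le> r (insert x G)" by (intro rank_mono) auto
      ultimately have "r (insert x G) = r G" by simp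
      then have "r (insert x F) = r F" 
        by (rule r_insert_eq_mono[of x G]) (use F G x flat_subset in auto)
      then show False using F x unfolding flat_iff by (metis less_irrefl)
    qed
    have "G \<in> flats (localization M F) \<longleftrightarrow> (\<forall>x\<in>F - G. r G < r (insert x G))"
      using G rank_localization[of _ F] by (auto simp: flats_def)
    also have "\<dots> \<longleftrightarrow> G \<in> flats M"
      using out G flat_subset[OF F] unfolding flat_iff by blast
    finally show ?thesis .
  qed
  moreover have "G \<subseteq> F" if "G \<in> flats (localization M F)" for G
    using that by (auto simp: flats_def)
  ultimately show ?thesis by auto
qed

end

locale loopless_matroid = matroid +
  assumes loopless: "loopless M"
begin

lemma empty_flat: "{} \<in> flats M"
  using loopless r_empty by (auto simp: flat_iff loopless_def indep_iff_rank)

end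

lemma (in matroid) contraction_loopless_matroid:
  "F \<in> flats M \<Longrightarrow> loopless_matroid (contraction M F)"
  using contraction_matroid contraction_loopless flat_subset
  by (intro loopless_matroid.intro loopless_matroid_axioms.intro) auto

section \<open>Reversal of polynomials\<close>

lemma coeff_flip_poly:
  assumes "degree p \<le> d"
  shows "coeff (flip_poly d p) n = (if n \<le> d then coeff p (d - n) else 0)"
proof -
  have "coeff p k = 0" if "degree p < k" for k
    using that by (rule coeff_eq_0)
  then show ?thesis
    using assms by (auto simp: flip_poly_def coeff_monom_mult coeff_reflect_poly)
qed

lemma flip_poly_0 [simp]: "flip_poly d 0 = 0"
  by (simp add: flip_poly_def)

lemma flip_poly_add:
  assumes "degree p \<le> d" "degree q \<le> d"
  shows "flip_poly d (p + q) = flip_poly d p + flip_poly d q"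
  using assms degree_add_le[OF assms] by (intro poly_eqI) (simp add: coeff_flip_poly)

lemma flip_poly_diff:
  assumes "degree p \<le> d" "degree q \<le> d"
  shows "flip_poly d (p - q) = flip_poly d p - flip_poly d q"
  using assms degree_diff_le[OF assms] by (intro poly_eqI) (simp add: coeff_flip_poly)

lemma flip_poly_sum:
  assumes "\<And>i. i \<in> S \<Longrightarrow> degree (f i) \<le> d"
  shows "flip_poly d (\<Sum>i\<in>S. f i) = (\<Sum>i\<in>S. flip_poly d (f i))"
  using assms
proof (induction S rule: infinite_finite_induct)
  case (insert x S)
  then show ?case by (simp add: flip_poly_add degree_sum_le)
qed auto

lemma flip_poly_mult:
  assumes "degree p \<le> d" "degree q \<le> e"
  shows "flip_poly (d + e) (p * q) = flip_poly d p * flip_poly e q"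
proof (cases "p = 0 \<or> q = 0")
  case False
  then have "d + e - degree (p * q) = (d - degree p) + (e - degree q)"
    using assms by (simp add: degree_mult_eq)
  then show ?thesis
    using mult_monom[of "1::int" "d - degree p" 1 "e - degree q"]
    by (simp add: flip_poly_def reflect_poly_mult ac_simps flip: mult_monom)
qed auto

lemma flip_poly_monom:
  assumes "k \<le> d"
  shows "flip_poly d (monom c k) = monom c (d - k)"
  using assms degree_monom_le[of c k] by (intro poly_eqI) (auto simp: coeff_flip_poly)

section \<open>Palindromic polynomials and lower halves\<close>

definition palindromic :: "nat \<Rightarrow> int poly \<Rightarrow> bool" where
  "palindromic d p \<longleftrightarrow> degree p \<le> d \<and> flip_poly d p = p"

lemma palindromic_0 [simp]: "palindromic d 0"
  by (simp add: palindromic_def)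

lemma palindromic_add: "palindromic d p \<Longrightarrow> palindromic d q \<Longrightarrow> palindromic d (p + q)"
  by (simp add: palindromic_def flip_poly_add degree_add_le)

lemma palindromic_diff: "palindromic d p \<Longrightarrow> palindromic d q \<Longrightarrow> palindromic d (p - q)"
  by (simp add: palindromic_def flip_poly_diff degree_diff_le)

lemma palindromic_sum: "(\<And>i. i \<in> S \<Longrightarrow> palindromic d (f i)) \<Longrightarrow> palindromic d (\<Sum>i\<in>S. f i)"
  by (induction S rule: infinite_finite_induct) (auto intro: palindromic_add)

lemma palindromic_mult: "palindromic d p \<Longrightarrow> palindromic e q \<Longrightarrow> palindromic (d + e) (p * q)"
  unfolding palindromic_def using flip_poly_mult degree_mult_le
  by (metis add_mono order.trans)

text \<open>The leading coefficient reappears at position \<open>d - degree p\<close>, which lies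
  beyond the degree.\<close>

lemma palindromic_eq_0:
  assumes "palindromic d p" "2 * degree p < d"
  shows "p = 0"
proof (rule ccontr)
  assume "p \<noteq> 0"
  have "coeff p (degree p) = coeff p (d - degree p)"
    using coeff_flip_poly[of p d "d - degree p"] assms by (simp add: palindromic_def)
  also have "\<dots> = 0" using assms by (intro coeff_eq_0) auto
  finally show False using \<open>p \<noteq> 0\<close> by simp
qed

text \<open>The strict inequality leaves out the middle coefficient for even \<open>d\<close>, as
  the degree bound for Kazhdan--Lusztig polynomials demands.\<close>

definition lower_half :: "nat \<Rightarrow> int poly \<Rightarrow> int poly" where
  "lower_half d q = (\<Sum>i\<in>{i. 2 * i < d}. monom (coeff q i) i)"

lemma coeff_lower_half: "coeff (lower_half d q) n = (if 2 * n < d then coeff q n else 0)"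
proof -
  have "finite {i. 2 * i < d}" by (rule finite_subset[of _ "{..d}"]) auto
  then show ?thesis by (auto simp: lower_half_def coeff_sum if_distrib)
qed

lemma degree_lower_half:
  assumes "d > 0"
  shows "2 * degree (lower_half d q) < d"
proof (cases "lower_half d q = 0")
  case False
  then have "coeff (lower_half d q) (degree (lower_half d q)) \<noteq> 0" by simp
  then show ?thesis unfolding coeff_lower_half by (simp split: if_splits)
qed (use assms in auto)

text \<open>Antisymmetry makes the middle coefficient vanish, so reversing the negated lower half
  yields the upper half. With p the negated lower half this says flip p - p = q, which is the
  equation that \<open>KL_rec\<close> has to solve.\<close>

lemma flip_lower_half:
  assumes "degree q \<le> d" "flip_poly d q = - q" "d > 0"
  shows "flip_poly d (- lower_half d q) = q - lower_half d q"
proof (rule poly_eqI)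
  fix n
  have deg: "degree (- lower_half d q) \<le> d" using degree_lower_half[OF assms(3), of q] by simp
  have anti: "n \<le> d \<Longrightarrow> coeff q (d - n) = - coeff q n"
    using coeff_flip_poly[OF assms(1), of n] assms(2) by simp
  have "n > d \<Longrightarrow> coeff q n = 0" using assms(1) by (intro coeff_eq_0) auto
  moreover have "coeff q n = 0" if "2 * n = d"
  proof -
    have "d - n = n" "n \<le> d" using that by auto
    then show ?thesis using anti by simp
  qed
  ultimately show "coeff (flip_poly d (- lower_half d q)) n = coeff (q - lower_half d q) n"
    using anti by (auto simp: coeff_flip_poly[OF deg] coeff_lower_half)
qed


section \<open>Moebius functions and characteristic polynomials of intervals\<close>

definition interval :: "'a set set \<Rightarrow> 'a set \<Rightarrow> 'a set \<Rightarrow> 'a set set" where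
  "interval L F G = {H \<in> L. F \<subseteq> H \<and> H \<subseteq> G}"

lemma moebius_self [simp]: "moebius L F F = 1"
  by (simp add: moebius.simps)

lemma finite_interval:
  assumes "finite G"
  shows "finite (interval L F G)"
  by (rule finite_subset[of _ "Pow G"]) (use assms in \<open>auto simp: interval_def\<close>)

text \<open>The recursion for \<open>moebius\<close> sees only the order, and subtracting
  \<open>F\<close> is an order isomorphism on the sets containing \<open>F\<close>. The flats of a
  contraction are such differences.\<close>

lemma moebius_shift:
  assumes "H \<in> interval L F G" "finite H"
  shows "moebius ((\<lambda>H. H - F) ` interval L F G) {} (H - F) = moebius L F H"
  using assms(2,1)
proof (induction H rule: finite_psubset_induct)
  case (psubset H)
  let ?L = "(\<lambda>H. H - F) ` interval L F G"
  have H: "H \<in> L" "F \<subseteq> H" "H \<subseteq> G" using psubset by (auto simp: interval_def)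
  show ?case
  proof (cases "H = F")
    case False
    let ?S = "{K \<in> L. F \<subseteq> K \<and> K \<subset> H}"
    have S: "{A \<in> ?L. {} \<subseteq> A \<and> A \<subset> H - F} = (\<lambda>K. K - F) ` ?S"
    proof -
      have iff: "K - F \<subset> H - F \<longleftrightarrow> K \<subset> H" if "F \<subseteq> K" for K
        using H(2) that by blast
      have "{K \<in> interval L F G. K - F \<subset> H - F} = ?S"
        unfolding interval_def using iff H(3) by blast
      then show ?thesis by blast
    qed
    have inj: "inj_on (\<lambda>K. K - F) ?S" by (rule inj_onI) blast
    have "moebius ?L {} (H - F) = - (\<Sum>A \<in> (\<lambda>K. K - F) ` ?S. moebius ?L {} A)"
      unfolding S[symmetric] using False H psubset(1) by (subst moebius.simps) auto
    also have "\<dots> = - (\<Sum>K \<in> ?S. moebius ?L {} (K - F))"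
      by (simp add: sum.reindex[OF inj])
    also have "(\<Sum>K \<in> ?S. moebius ?L {} (K - F)) = (\<Sum>K \<in> ?S. moebius L F K)"
    proof (intro sum.cong refl)
      fix K assume K: "K \<in> ?S"
      then have "K \<in> interval L F G" using H(3) by (auto simp: interval_def)
      then show "moebius ?L {} (K - F) = moebius L F K" using K by (intro psubset.IH) auto
    qed
    also have "- \<dots> = moebius L F H"
      using False H psubset(1) by (subst (2) moebius.simps) auto
    finally show ?thesis .
  qed simp
qed

lemma sum_moebius_lower:
  assumes "F \<in> L" "G \<in> L" "F \<subseteq> G" "finite G"
  shows "(\<Sum>K\<in>interval L F G. moebius L F K) = (if F = G then 1 else 0)"
proof (cases "F = G")
  case True
  then have "interval L F G = {F}" using assms by (auto simp: interval_def)
  then show ?thesis using True by simp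
next
  case False
  have "interval L F G = insert G {K \<in> L. F \<subseteq> K \<and> K \<subset> G}"
    using assms by (auto simp: interval_def)
  moreover have "finite {K \<in> L. F \<subseteq> K \<and> K \<subset> G}"
    by (rule finite_subset[of _ "Pow G"]) (use assms in auto)
  ultimately have "(\<Sum>K\<in>interval L F G. moebius L F K) =
      moebius L F G + (\<Sum>K\<in>{K \<in> L. F \<subseteq> K \<and> K \<subset> G}. moebius L F K)"
    by simp
  also have "moebius L F G = - (\<Sum>K\<in>{K \<in> L. F \<subseteq> K \<and> K \<subset> G}. moebius L F K)"
    using False assms by (subst moebius.simps) auto
  finally show ?thesis using False by simp
qed

lemma sum_interval_swap:
  assumes "finite B"
  shows "(\<Sum>F\<in>interval L A B. \<Sum>G\<in>interval L F B. g F G) =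
    (\<Sum>G\<in>interval L A B. \<Sum>F\<in>interval L A G. g F G)"
proof -
  have "(\<Sum>F\<in>interval L A B. \<Sum>G\<in>interval L F B. g F G) =
      (\<Sum>F\<in>interval L A B. \<Sum>G\<in>{G \<in> interval L A B. F \<subseteq> G}. g F G)"
    by (intro sum.cong) (auto simp: interval_def)
  also have "\<dots> = (\<Sum>G\<in>interval L A B. \<Sum>F\<in>{F \<in> interval L A B. F \<subseteq> G}. g F G)"
    by (rule sum.swap_restrict) (use assms finite_interval in auto)
  also have "\<dots> = (\<Sum>G\<in>interval L A B. \<Sum>F\<in>interval L A G. g F G)"
    by (intro sum.cong) (auto simp: interval_def)
  finally show ?thesis .
qed

text \<open>A right inverse of the zeta function in the incidence algebra is also a left inverse.\<close>

lemma sum_moebius_upper: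
  assumes "F \<in> L" "G \<in> L" "F \<subseteq> G" "finite G"
  shows "(\<Sum>K\<in>interval L F G. moebius L K G) = (if F = G then 1 else 0)"
  using assms
proof (induction "card G - card F" arbitrary: F rule: less_induct)
  case less
  \<comment> \<open>The sum of \<open>moebius L F K * S K\<close> is evaluated in two ways:
    exchanging the sums gives \<open>moebius L F G\<close>, while for \<open>F \<noteq> G\<close>
    the induction hypothesis leaves \<open>S F + moebius L F G\<close>. Hence
    \<open>S F = 0\<close>.\<close>
  define S where "S K = (\<Sum>J\<in>interval L K G. moebius L J G)" for K
  let ?I = "interval L F G"
  have fin: "finite ?I" using less by (simp add: finite_interval)
  have "(\<Sum>K\<in>?I. moebius L F K * S K) = (\<Sum>K\<in>?I. \<Sum>J\<in>interval L K G. moebius L F K * moebius L J G)"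
    by (simp add: S_def sum_distrib_left)
  also have "\<dots> = (\<Sum>J\<in>?I. (\<Sum>K\<in>interval L F J. moebius L F K) * moebius L J G)"
    using less by (simp add: sum_interval_swap sum_distrib_right)
  also have "\<dots> = (\<Sum>J\<in>?I. (if F = J then 1 else 0) * moebius L J G)"
    using less by (intro sum.cong arg_cong2[of _ _ _ _ "(*)"] sum_moebius_lower)
      (auto simp: interval_def intro: finite_subset)
  also have "\<dots> = moebius L F G"
  proof -
    have "F \<in> ?I" using less by (auto simp: interval_def)
    have "(\<Sum>J\<in>?I. (if F = J then 1 else 0) * moebius L J G) =
        (\<Sum>J\<in>?I. if F = J then moebius L J G else 0)"
      by (intro sum.cong) auto
    then show ?thesis using fin \<open>F \<in> ?I\<close> by (simp add: sum.delta')
  qed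
  finally have eq: "(\<Sum>K\<in>?I. moebius L F K * S K) = moebius L F G" .
  have above: "S K = (if K = G then 1 else 0)" if "K \<in> ?I" "K \<noteq> F" for K
  proof -
    have "F \<subset> K" "K \<subseteq> G" using that by (auto simp: interval_def)
    then have "card F < card K" "card K \<le> card G"
      using less(5) by (auto intro: psubset_card_mono card_mono finite_subset)
    then show ?thesis unfolding S_def using that less by (intro less(1)) (auto simp: interval_def)
  qed
  show ?case
  proof (cases "F = G")
    case True
    then have "interval L F G = {F}" using less by (auto simp: interval_def)
    then show ?thesis using True by simp
  next
    case False
    have F: "F \<in> ?I" using less by (auto simp: interval_def)
    have "(\<Sum>K\<in>?I. moebius L F K * S K) = S F + (\<Sum>K\<in>?I - {F}. moebius L F K * S K)"
      using F fin by (simp add: sum.remove)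
    also have "(\<Sum>K\<in>?I - {F}. moebius L F K * S K) = (\<Sum>K\<in>?I - {F}. if K = G then moebius L F K else 0)"
      by (rule sum.cong) (auto simp: above)
    also have "\<dots> = moebius L F G"
      using False less fin by (simp add: sum.delta interval_def)
    finally show ?thesis using eq False by (simp add: S_def)
  qed
qed

section \<open>Characteristic polynomials of intervals of flats\<close>

context matroid
begin

abbreviation "iv \<equiv> interval (flats M)"

text \<open>The characteristic polynomial of the minor of \<open>M\<close> between \<open>F\<close>
  and \<open>G\<close> (see \<open>char_poly_minor\<close>). Indexing by pairs of flats makes these
  polynomials one element of the incidence algebra.\<close>

definition chi :: "'a set \<Rightarrow> 'a set \<Rightarrow> int poly" where
  "chi F G = (\<Sum>H\<in>iv F G. monom (moebius (flats M) F H) (r G - r H))"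

lemma iv_flat: "H \<in> iv F G \<Longrightarrow> H \<in> flats M"
  by (simp add: interval_def)

lemma iv_rank: "H \<in> iv F G \<Longrightarrow> r F \<le> r H \<and> r H \<le> r G"
  by (auto simp: interval_def intro: rank_mono)

lemma finite_flat: "F \<in> flats M \<Longrightarrow> finite F"
  using flat_subset finite_ground finite_subset by metis

lemma finite_iv: "finite (iv F G)"
  using finite_flats by (simp add: interval_def)

lemma degree_chi: "degree (chi F G) \<le> r G - r F"
  unfolding chi_def
proof (rule degree_sum_le[OF finite_iv])
  fix H assume "H \<in> iv F G"
  then have "r G - r H \<le> r G - r F" using iv_rank[of H F G] by auto
  then show "degree (monom (moebius (flats M) F H) (r G - r H)) \<le> r G - r F"
    using degree_monom_le order.trans by blast
qed

lemma flip_chi: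
  "flip_poly (r G - r F) (chi F G) = (\<Sum>H\<in>iv F G. monom (moebius (flats M) F H) (r H - r F))"
  unfolding chi_def
proof (subst flip_poly_sum)
  fix H assume "H \<in> iv F G"
  then have "r G - r H \<le> r G - r F" using iv_rank[of H F G] by auto
  then show "degree (monom (moebius (flats M) F H) (r G - r H)) \<le> r G - r F"
    using degree_monom_le order.trans by blast
next
  show "(\<Sum>i\<in>iv F G. flip_poly (r G - r F) (monom (moebius (flats M) F i) (r G - r i))) =
    (\<Sum>H\<in>iv F G. monom (moebius (flats M) F H) (r H - r F))"
    using iv_rank by (intro sum.cong refl) (fastforce simp: flip_poly_monom)
qed

lemma chi_self:
  assumes "F \<in> flats M"
  shows "chi F F = 1"
proof -
  have "iv F F = {F}" using assms by (auto simp: interval_def)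
  then show ?thesis by (simp add: chi_def monom_0)
qed

text \<open>Here the lower argument of the Moebius function varies, which calls for
  \<open>sum_moebius_upper\<close>.\<close>

lemma sum_chi:
  assumes "F \<in> flats M" "G \<in> flats M" "F \<subseteq> G"
  shows "(\<Sum>H\<in>iv F G. chi H G) = monom 1 (r G - r F)"
proof -
  have "(\<Sum>H\<in>iv F G. chi H G) =
      (\<Sum>K\<in>iv F G. \<Sum>H\<in>iv F K. monom (moebius (flats M) H K) (r G - r K))"
    unfolding chi_def using assms finite_flat by (intro sum_interval_swap) auto
  also have "\<dots> = (\<Sum>K\<in>iv F G. monom (\<Sum>H\<in>iv F K. moebius (flats M) H K) (r G - r K))"
    by (simp add: monom_sum)
  also have "\<dots> = (\<Sum>K\<in>iv F G. if F = K then monom 1 (r G - r K) else 0)"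
    using assms finite_flat
    by (intro sum.cong refl) (auto simp: interval_def[of _ F G] sum_moebius_upper)
  also have "\<dots> = monom 1 (r G - r F)"
    using assms finite_iv by (simp add: sum.delta' interval_def)
  finally show ?thesis .
qed

text \<open>Reversal leaves Moebius values with exponents \<open>r H - r F\<close>. After exchanging
  the sums, \<open>sum_chi\<close> supplies the complementary power, so every term carries the same
  power of t and the Moebius values sum to a delta.\<close>

lemma chi_kernel:
  assumes "F \<in> flats M" "G \<in> flats M" "F \<subseteq> G"
  shows "(\<Sum>H\<in>iv F G. flip_poly (r H - r F) (chi F H) * chi H G) = (if F = G then 1 else 0)"
proof -
  let ?mu = "moebius (flats M)"
  have "(\<Sum>H\<in>iv F G. flip_poly (r H - r F) (chi F H) * chi H G) =
      (\<Sum>H\<in>iv F G. \<Sum>K\<in>iv F H. monom (?mu F K) (r K - r F) * chi H G)"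
    by (simp add: flip_chi sum_distrib_right)
  also have "\<dots> = (\<Sum>K\<in>iv F G. \<Sum>H\<in>iv K G. monom (?mu F K) (r K - r F) * chi H G)"
    using assms finite_flat by (intro sum_interval_swap[symmetric]) auto
  also have "\<dots> = (\<Sum>K\<in>iv F G. monom (?mu F K) (r K - r F) * monom 1 (r G - r K))"
    using assms by (intro sum.cong refl) (simp add: sum_chi interval_def[of _ F G] flip: sum_distrib_left)
  also have "\<dots> = (\<Sum>K\<in>iv F G. monom (?mu F K) (r G - r F))"
    using iv_rank by (intro sum.cong refl) (fastforce simp: mult_monom)
  also have "\<dots> = monom (\<Sum>K\<in>iv F G. ?mu F K) (r G - r F)"
    by (simp add: monom_sum)
  also have "\<dots> = (if F = G then 1 else 0)"
    using assms finite_flat by (simp add: sum_moebius_lower monom_0)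
  finally show ?thesis .
qed

lemma flat_contraction:
  "F \<in> flats M \<Longrightarrow> G \<in> flats M \<Longrightarrow> F \<subseteq> G \<Longrightarrow> G - F \<in> flats (contraction M F)"
  by (auto simp: flats_contraction)

lemma char_poly_minor:
  assumes "F \<in> flats M" "G \<in> flats M" "F \<subseteq> G"
  shows "char_poly (localization (contraction M F) (G - F)) = chi F G"
proof -
  let ?N = "contraction M F"
  interpret N: matroid ?N using assms contraction_matroid flat_subset by auto
  let ?L = "(\<lambda>H. H - F) ` iv F G"
  have flat: "G - F \<in> flats ?N" by (rule flat_contraction[OF assms])
  have L: "flats (localization ?N (G - F)) = ?L"
  proof -
    have "H - F \<subseteq> G - F \<longleftrightarrow> H \<subseteq> G" if "F \<subseteq> H" for H
      using assms(3) that by blast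
    then show ?thesis
      unfolding N.flats_localization[OF flat] flats_contraction[OF assms(1)] interval_def
      by blast
  qed
  have rank: "rank_of (localization ?N (G - F)) (H - F) = r H - r F" if "H \<in> iv F G" for H
  proof -
    have "H - F \<subseteq> G - F" "H - F \<subseteq> E - F" "H - F \<union> F = H"
      using that flat_subset by (auto simp: interval_def)
    then show ?thesis using assms flat_subset by (simp add: N.rank_localization rank_contraction)
  qed
  have inj: "inj_on (\<lambda>H. H - F) (iv F G)" by (rule inj_onI) (auto simp: interval_def)
  have "G \<in> iv F G" using assms by (auto simp: interval_def)
  then have rk: "rk (localization ?N (G - F)) = r G - r F" using rank[of G] by (simp add: rk_def)
  have "char_poly (localization ?N (G - F)) =
     (\<Sum>H\<in>iv F G. monom (moebius ?L {} (H - F)) (r G - r F - (r H - r F)))"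
    unfolding char_poly_def L rk sum.reindex[OF inj] by (simp add: rank)
  also have "\<dots> = chi F G"
    unfolding chi_def
  proof (intro sum.cong refl)
    fix H assume H: "H \<in> iv F G"
    then have "moebius ?L {} (H - F) = moebius (flats M) F H"
      using finite_flat iv_flat by (intro moebius_shift) auto
    moreover have "r G - r F - (r H - r F) = r G - r H" using iv_rank[OF H] by auto
    ultimately show "monom (moebius ?L {} (H - F)) (r G - r F - (r H - r F)) =
      monom (moebius (flats M) F H) (r G - r H)" by simp
  qed
  finally show ?thesis .
qed

lemma sum_flats_contraction:
  assumes "F \<in> flats M"
  shows "(\<Sum>A\<in>flats (contraction M F). char_poly (localization (contraction M F) A) *
      P (contraction (contraction M F) A)) = (\<Sum>G\<in>iv F E. chi F G * P (contraction M G))"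
proof -
  have eq: "{G \<in> flats M. F \<subseteq> G} = iv F E" using flat_subset by (auto simp: interval_def)
  have inj: "inj_on (\<lambda>H. H - F) (iv F E)" by (rule inj_onI) (auto simp: interval_def)
  show ?thesis
    unfolding flats_contraction[OF assms] eq sum.reindex[OF inj] o_def
  proof (intro sum.cong refl)
    fix G assume "G \<in> iv F E"
    then show "char_poly (localization (contraction M F) (G - F)) *
        P (contraction (contraction M F) (G - F)) = chi F G * P (contraction M G)"
      using assms by (simp add: char_poly_minor contraction_contraction interval_def)
  qed
qed

end

section \<open>Existence and characterization of Kazhdan--Lusztig polynomials\<close>

lemma card_contraction_less:
  assumes "is_matroid M" "F \<in> flats M" "F \<noteq> {}"
  shows "card (ground (contraction M F)) < card (ground M)"
proof -
  interpret matroid M using assms by unfold_locales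
  have "E - F \<subset> E" using assms flat_subset by fastforce
  then show ?thesis using finite_ground by (auto intro: psubset_card_mono)
qed

text \<open>The existence witness. The term of the defining equation at the flat \<open>{}\<close>
  is the unknown p itself, so the equation reads flip p - p = Q, with Q the sum over the nonempty
  flats; the degree bound forces p to be the negated lower half of Q.\<close>

function KL_rec :: "'a set_system \<Rightarrow> int poly" where
  "KL_rec M =
     (if is_matroid M \<and> loopless M then
        if rk M = 0 then 1
        else - lower_half (rk M)
          (\<Sum>F \<in> flats M - {{}}. char_poly (localization M F) * KL_rec (contraction M F))
      else 0)"
  by auto
termination
  by (relation "measure (\<lambda>M. card (ground M))") (auto intro: card_contraction_less)

declare KL_rec.simps [simp del]

context loopless_matroid
begin

lemma rank_0_ground:
  assumes "r E = 0"
  shows "E = {}"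
proof (rule ccontr)
  assume "E \<noteq> {}"
  then have "{} \<subset> E" by auto
  then show False using rank_flat_less[OF empty_flat, of E] assms by simp
qed

lemma flats_eq_iv: "flats M = iv {} E"
  using flat_subset by (auto simp: interval_def)

lemma sum_flats:
  "(\<Sum>F\<in>flats M. char_poly (localization M F) * P (contraction M F)) =
     (\<Sum>F\<in>iv {} E. chi {} F * P (contraction M F))"
  using sum_flats_contraction[OF empty_flat, of P] by (simp add: contraction_empty)

end

lemma KL_rec_spec:
  assumes "loopless_matroid M"
  shows "(rk M = 0 \<longrightarrow> KL_rec M = 1) \<and> (rk M > 0 \<longrightarrow> 2 * degree (KL_rec M) < rk M) \<and>
   flip_poly (rk M) (KL_rec M) =
     (\<Sum>F\<in>flats M. char_poly (localization M F) * KL_rec (contraction M F))"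
  using assms
proof (induction "card (ground M)" arbitrary: M rule: less_induct)
  case less
  interpret loopless_matroid M by (rule less.prems)
  have LM: "is_matroid M \<and> loopless M" using is_matroid loopless by simp
  define p where "p F = KL_rec (contraction M F)" for F
  have p_empty: "p {} = KL_rec M" by (simp add: p_def contraction_empty)
  have rk: "rk M = r E" by (simp add: rk_def)
  have sum: "(\<Sum>F\<in>flats M. char_poly (localization M F) * KL_rec (contraction M F)) =
      (\<Sum>F\<in>iv {} E. chi {} F * p F)"
    unfolding p_def by (rule sum_flats)
  show ?case
  proof (cases "rk M = 0")
    case True
    then have "E = {}" using rank_0_ground by (simp add: rk)
    then have "iv {} E = {{}}" using empty_flat by (auto simp: interval_def)
    moreover have "KL_rec M = 1" using LM True by (simp add: KL_rec.simps)
    ultimately show ?thesis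
      unfolding sum using True p_empty
      by (simp add: chi_self empty_flat flip_poly_def)
  next
    case False
    have eq: "flip_poly (r E - r F) (p F) = (\<Sum>G\<in>iv F E. chi F G * p G)"
      and deg: "degree (p F) \<le> r E - r F"
      if F: "F \<in> flats M" "F \<noteq> {}" for F
    proof -
      have spec: "(rk (contraction M F) = 0 \<longrightarrow> p F = 1) \<and>
          (rk (contraction M F) > 0 \<longrightarrow> 2 * degree (p F) < rk (contraction M F)) \<and>
          flip_poly (rk (contraction M F)) (p F) = (\<Sum>A\<in>flats (contraction M F).
            char_poly (localization (contraction M F) A) * KL_rec (contraction (contraction M F) A))"
        unfolding p_def
        using F is_matroid contraction_loopless_matroid by (intro less.hyps card_contraction_less)
      then show "flip_poly (r E - r F) (p F) = (\<Sum>G\<in>iv F E. chi F G * p G)"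
        using F flat_subset by (simp add: rk_contraction sum_flats_contraction p_def)
      show "degree (p F) \<le> r E - r F"
        using spec F flat_subset by (cases "rk (contraction M F) = 0") (auto simp: rk_contraction)
    qed
    define Q where "Q = (\<Sum>F\<in>iv {} E - {{}}. chi {} F * p F)"
    have deg_term: "degree (chi {} F * p F) \<le> r E" if "F \<in> iv {} E - {{}}" for F
    proof -
      have "degree (chi {} F * p F) \<le> (r F - r {}) + (r E - r F)"
        using that iv_flat[of F "{}" E] degree_chi deg
        by (intro order.trans[OF degree_mult_le] add_mono) auto
      then show ?thesis using iv_rank[of F "{}" E] that by auto
    qed
    have KL: "KL_rec M = - lower_half (r E) Q"
    proof -
      have "Q = (\<Sum>F\<in>flats M - {{}}. char_poly (localization M F) * KL_rec (contraction M F))"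
        unfolding Q_def p_def
      proof (rule sum.cong)
        show "iv {} E - {{}} = flats M - {{}}" using flats_eq_iv by simp
        fix F assume "F \<in> flats M - {{}}"
        then show "chi {} F * KL_rec (contraction M F) =
            char_poly (localization M F) * KL_rec (contraction M F)"
          using char_poly_minor[OF empty_flat, of F] by (simp add: contraction_empty)
      qed
      then show ?thesis using LM False by (simp add: KL_rec.simps[of M] rk)
    qed
    have fin: "finite E" by (rule finite_ground)
    have e: "{} \<in> iv {} E" using empty_flat by (auto simp: interval_def)
    have degQ: "degree Q \<le> r E"
      unfolding Q_def using deg_term finite_iv by (intro degree_sum_le) auto
    have flipQ: "flip_poly (r E) Q = - Q"
    proof -
      \<comment> \<open>Setting \<open>g {} = 0\<close> lets the outer sum run over the full
        interval, where the double sum can be exchanged.\<close>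
      define g where "g F = (if F = {} then 0 else flip_poly (r F - r {}) (chi {} F))" for F
      have "flip_poly (r E) Q = (\<Sum>F\<in>iv {} E - {{}}. flip_poly (r E) (chi {} F * p F))"
        unfolding Q_def using deg_term by (rule flip_poly_sum)
      also have "\<dots> = (\<Sum>F\<in>iv {} E - {{}}. g F * (\<Sum>G\<in>iv F E. chi F G * p G))"
      proof (intro sum.cong refl)
        fix F assume F: "F \<in> iv {} E - {{}}"
        then have "r E = (r F - r {}) + (r E - r F)" using iv_rank[of F "{}" E] r_empty by auto
        then show "flip_poly (r E) (chi {} F * p F) = g F * (\<Sum>G\<in>iv F E. chi F G * p G)"
          using F flip_poly_mult[OF degree_chi[of "{}" F] deg[of F]] eq[of F] iv_flat
          by (auto simp: g_def)
      qed
      also have "\<dots> = (\<Sum>F\<in>iv {} E. g F * (\<Sum>G\<in>iv F E. chi F G * p G))"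
        using e finite_iv by (simp add: sum.remove g_def)
      also have "\<dots> = (\<Sum>F\<in>iv {} E. \<Sum>G\<in>iv F E. g F * chi F G * p G)"
        by (simp add: sum_distrib_left mult.assoc)
      also have "\<dots> = (\<Sum>G\<in>iv {} E. (\<Sum>F\<in>iv {} G. g F * chi F G) * p G)"
        by (simp add: sum_interval_swap[OF fin] sum_distrib_right)
      also have "\<dots> = (\<Sum>G\<in>iv {} E. (if G = {} then 0 else - chi {} G) * p G)"
      proof (intro sum.cong refl arg_cong2[of _ _ _ _ "(*)"])
        fix G assume G: "G \<in> iv {} E"
        have e': "{} \<in> iv {} G" using empty_flat by (auto simp: interval_def)
        \<comment> \<open>The kernel identity, with its term at \<open>{}\<close> split off and
          moved to the other side.\<close>
        have "(if {} = G then 1 else 0) =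
            (\<Sum>F\<in>iv {} G. flip_poly (r F - r {}) (chi {} F) * chi F G)"
          using G empty_flat iv_flat by (intro chi_kernel[symmetric]) auto
        also have "\<dots> = chi {} G + (\<Sum>F\<in>iv {} G - {{}}. flip_poly (r F - r {}) (chi {} F) * chi F G)"
          using e' finite_iv chi_self[OF empty_flat]
          by (subst sum.remove[of _ "{}"]) (auto simp: flip_poly_def)
        also have "(\<Sum>F\<in>iv {} G - {{}}. flip_poly (r F - r {}) (chi {} F) * chi F G) =
            (\<Sum>F\<in>iv {} G - {{}}. g F * chi F G)"
          by (intro sum.cong) (auto simp: g_def)
        also have "\<dots> = (\<Sum>F\<in>iv {} G. g F * chi F G)"
          using e' finite_iv by (simp add: sum.remove g_def)
        finally show "(\<Sum>F\<in>iv {} G. g F * chi F G) = (if G = {} then 0 else - chi {} G)"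
          using chi_self[OF empty_flat] by (auto simp: algebra_simps split: if_splits)
      qed
      also have "\<dots> = - Q"
        using e finite_iv
        by (subst sum.remove[of _ "{}"]) (auto simp: Q_def sum_negf[symmetric] intro!: sum.cong)
      finally show ?thesis .
    qed
    have pos: "r E > 0" using False by (simp add: rk)
    have "flip_poly (r E) (KL_rec M) = Q + KL_rec M"
      unfolding KL using flip_lower_half[OF degQ flipQ pos] by simp
    also have "\<dots> = (\<Sum>F\<in>iv {} E. chi {} F * p F)"
      using e finite_iv by (simp add: sum.remove[of _ "{}"] Q_def chi_self[OF empty_flat] p_empty)
    finally show ?thesis
      unfolding sum rk using degree_lower_half[OF pos, of Q] pos by (simp add: KL)
  qed
qed

lemma KL_assignment_KL_rec: "KL_assignment KL_rec"
  unfolding KL_assignment_def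
  using KL_rec_spec by (auto simp: loopless_matroid_def matroid_def
    loopless_matroid_axioms_def)

lemma (in loopless_matroid) KL_assignment_eq:
  assumes "KL_assignment P" "F \<in> flats M"
  shows "flip_poly (r E - r F) (P (contraction M F)) =
      (\<Sum>G\<in>iv F E. chi F G * P (contraction M G))"
    and "degree (P (contraction M F)) \<le> r E - r F"
    and "F \<noteq> E \<Longrightarrow> 2 * degree (P (contraction M F)) < r E - r F"
    and "F = E \<Longrightarrow> P (contraction M F) = 1"
proof -
  interpret N: loopless_matroid "contraction M F"
    using assms contraction_loopless_matroid by auto
  have spec: "(rk (contraction M F) = 0 \<longrightarrow> P (contraction M F) = 1) \<and>
      (rk (contraction M F) > 0 \<longrightarrow> 2 * degree (P (contraction M F)) < rk (contraction M F)) \<and>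
      flip_poly (rk (contraction M F)) (P (contraction M F)) = (\<Sum>A\<in>flats (contraction M F).
        char_poly (localization (contraction M F) A) * P (contraction (contraction M F) A))"
    using assms(1) N.is_matroid N.loopless unfolding KL_assignment_def by blast
  have rk: "rk (contraction M F) = r E - r F"
    using assms flat_subset by (simp add: rk_contraction)
  show "flip_poly (r E - r F) (P (contraction M F)) =
      (\<Sum>G\<in>iv F E. chi F G * P (contraction M G))"
    using spec assms by (simp add: rk sum_flats_contraction)
  show "degree (P (contraction M F)) \<le> r E - r F"
    using spec rk by (cases "rk (contraction M F) = 0") auto
  show "F = E \<Longrightarrow> P (contraction M F) = 1" using spec rk by simp
  assume "F \<noteq> E"
  then have "r F < r E" using assms flat_subset by (intro rank_flat_less) auto
  then show "2 * degree (P (contraction M F)) < r E - r F" using spec rk by simp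
qed

text \<open>Reversal strips the power of t from each term and reverses the polynomial, which the
  defining equation expands in terms of \<open>chi\<close>; after exchanging the sums,
  \<open>sum_chi\<close> restores the powers of t.\<close>

lemma (in loopless_matroid) KL_assignment_palindromic:
  assumes P: "KL_assignment P" and F: "F \<in> flats M"
  shows "palindromic (r E - r F) (\<Sum>G\<in>iv F E. monom 1 (r G - r F) * P (contraction M G))"
proof -
  let ?p = "\<lambda>G. P (contraction M G)"
  have deg: "degree (monom 1 (r G - r F) * ?p G) \<le> r E - r F" if "G \<in> iv F E" for G
  proof -
    have "degree (monom 1 (r G - r F) * ?p G) \<le> (r G - r F) + (r E - r G)"
      using KL_assignment_eq(2)[OF P] iv_flat[OF that]
      by (intro order.trans[OF degree_mult_le] add_mono degree_monom_le) auto
    then show ?thesis using iv_rank[OF that] by simp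
  qed
  have "flip_poly (r E - r F) (\<Sum>G\<in>iv F E. monom 1 (r G - r F) * ?p G) =
      (\<Sum>G\<in>iv F E. flip_poly (r E - r F) (monom 1 (r G - r F) * ?p G))"
    using deg by (rule flip_poly_sum)
  also have "\<dots> = (\<Sum>G\<in>iv F E. \<Sum>H\<in>iv G E. chi G H * ?p H)"
  proof (intro sum.cong refl)
    fix G assume G: "G \<in> iv F E"
    have "r E - r F = (r G - r F) + (r E - r G)" using iv_rank[OF G] by simp
    then have "flip_poly (r E - r F) (monom 1 (r G - r F) * ?p G) =
        flip_poly (r G - r F) (monom 1 (r G - r F)) * flip_poly (r E - r G) (?p G)"
      using KL_assignment_eq(2)[OF P iv_flat[OF G]] by (simp add: flip_poly_mult degree_monom_le)
    then show "flip_poly (r E - r F) (monom 1 (r G - r F) * ?p G) = (\<Sum>H\<in>iv G E. chi G H * ?p H)"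
      using KL_assignment_eq(1)[OF P iv_flat[OF G]] by (simp add: flip_poly_monom monom_0)
  qed
  also have "\<dots> = (\<Sum>H\<in>iv F E. (\<Sum>G\<in>iv F H. chi G H) * ?p H)"
    by (simp add: sum_interval_swap[OF finite_ground] sum_distrib_right)
  also have "\<dots> = (\<Sum>H\<in>iv F E. monom 1 (r H - r F) * ?p H)"
    using F by (intro sum.cong refl) (simp add: sum_chi interval_def[of _ F E])
  finally show ?thesis
    unfolding palindromic_def using deg finite_iv by (auto intro: degree_sum_le)
qed

text \<open>The candidate \<open>q\<close> is a mere function on the flats of \<open>M\<close>. Its
  hypotheses mention only ranks and intervals, so nothing has to be known about the contractions as
  matroids.\<close>

lemma (in loopless_matroid) KL_assignment_unique:
  assumes P: "KL_assignment P"
    and top: "q E = 1"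
    and deg: "\<And>F. F \<in> flats M \<Longrightarrow> F \<noteq> E \<Longrightarrow> 2 * degree (q F) < r E - r F"
    and pal: "\<And>F. F \<in> flats M \<Longrightarrow> palindromic (r E - r F) (\<Sum>G\<in>iv F E. monom 1 (r G - r F) * q G)"
    and F: "F \<in> flats M"
  shows "P (contraction M F) = q F"
  using F
proof (induction "card E - card F" arbitrary: F rule: less_induct)
  case less
  show ?case
  proof (cases "F = E")
    case True
    then show ?thesis using KL_assignment_eq(4)[OF P less.prems] top by simp
  next
    case False
    let ?p = "\<lambda>G. P (contraction M G)"
    have F: "F \<in> iv F E" using less.prems flat_subset by (auto simp: interval_def)
    have eq: "?p G = q G" if G: "G \<in> iv F E - {F}" for G
    proof (rule less.hyps)
      have "F \<subset> G" "G \<subseteq> E" using G by (auto simp: interval_def)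
      then have "card F < card G" "card G \<le> card E"
        using finite_ground by (auto intro: psubset_card_mono card_mono finite_subset)
      then show "card E - card G < card E - card F" by simp
      show "G \<in> flats M" using G iv_flat by auto
    qed
    have split: "(\<Sum>G\<in>iv F E. monom 1 (r G - r F) * f G) =
        f F + (\<Sum>G\<in>iv F E - {F}. monom 1 (r G - r F) * f G)"
      for f :: "'a set \<Rightarrow> int poly"
      using F finite_iv by (simp add: sum.remove[of _ F] monom_0)
    have "?p F - q F = (\<Sum>G\<in>iv F E. monom 1 (r G - r F) * ?p G) - (\<Sum>G\<in>iv F E. monom 1 (r G - r F) * q G)"
      unfolding split using eq by simp
    then have "palindromic (r E - r F) (?p F - q F)"
      using KL_assignment_palindromic[OF P less.prems] pal[OF less.prems]
      by (simp add: palindromic_diff)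
    moreover have "2 * degree (?p F - q F) < r E - r F"
      using KL_assignment_eq(3)[OF P less.prems False] deg[OF less.prems False]
        degree_diff_le_max[of "?p F" "q F"] by linarith
    ultimately have "?p F - q F = 0" by (rule palindromic_eq_0)
    then show ?thesis by simp
  qed
qed

text \<open>Uniqueness is applied at the flat \<open>{}\<close> with \<open>q\<close> read off from
  \<open>KL_rec\<close>, so the description in \<open>KL_poly\<close> denotes an actual
  assignment.\<close>

lemma KL_assignment_KL_poly: "KL_assignment KL_poly"
proof -
  let ?P = "\<lambda>P :: 'a set_system \<Rightarrow> int poly.
    KL_assignment P \<and> (\<forall>M. \<not> (is_matroid M \<and> loopless M) \<longrightarrow> P M = 0)"
  have "?P KL_rec" using KL_assignment_KL_rec by (auto simp: KL_rec.simps)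
  moreover have "P = KL_rec" if P: "?P P" for P
  proof
    fix M :: "'a set_system"
    show "P M = KL_rec M"
    proof (cases "is_matroid M \<and> loopless M")
      case True
      then interpret loopless_matroid M by unfold_locales auto
      have "P (contraction M {}) = KL_rec (contraction M {})"
        by (rule KL_assignment_unique[where q = "\<lambda>F. KL_rec (contraction M F)"])
          (simp_all add: P[THEN conjunct1] empty_flat ground_flat KL_assignment_eq(3,4)
            KL_assignment_palindromic KL_assignment_KL_rec)
      then show ?thesis by (simp add: contraction_empty)
    next
      case False
      then show ?thesis using P KL_rec.simps[of M] by auto
    qed
  qed
  ultimately have "?P (THE P. ?P P)" by (rule theI)
  then show ?thesis by (simp add: KL_poly_def)
qed

lemma (in loopless_matroid) Z_poly_eq:
  assumes "q E = 1"
    and "\<And>F. F \<in> flats M \<Longrightarrow> F \<noteq> E \<Longrightarrow> 2 * degree (q F) < r E - r F"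
    and "\<And>F. F \<in> flats M \<Longrightarrow> palindromic (r E - r F) (\<Sum>G\<in>iv F E. monom 1 (r G - r F) * q G)"
  shows "Z_poly M = (\<Sum>F\<in>flats M. monom 1 (r F) * q F)"
  unfolding Z_poly_def
  using KL_assignment_unique[OF KL_assignment_KL_poly, of q] assms
  by (intro sum.cong refl) (simp add: rk_localization)

section \<open>Graphic matroids\<close>

definition adj :: "'v set set \<Rightarrow> ('v \<times> 'v) set" where
  "adj A = {(a, b). {a, b} \<in> A}"

abbreviation connected_by :: "'v set set \<Rightarrow> ('v \<times> 'v) set" where
  "connected_by A \<equiv> (adj A)\<^sup>*"

definition component :: "'v set set \<Rightarrow> 'v \<Rightarrow> 'v set" where
  "component A v = {w. (v, w) \<in> connected_by A}"

lemma connected_by_sym: "(a, b) \<in> connected_by A \<Longrightarrow> (b, a) \<in> connected_by A"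
  by (rule symD[OF sym_rtrancl]) (auto simp: sym_def adj_def insert_commute)

lemma connected_by_mono: "A \<subseteq> B \<Longrightarrow> (a, b) \<in> connected_by A \<Longrightarrow> (a, b) \<in> connected_by B"
  by (rule subsetD[OF rtrancl_mono]) (auto simp: adj_def)

lemma connected_by_edge: "{a, b} \<in> A \<Longrightarrow> (a, b) \<in> connected_by A"
  by (auto simp: adj_def)

lemma adj_insert: "adj (insert {a, b} A) = insert (a, b) (insert (b, a) (adj A))"
  by (auto simp: adj_def doubleton_eq_iff)

lemma component_eq_iff: "component A v = component A w \<longleftrightarrow> (v, w) \<in> connected_by A"
  unfolding component_def using connected_by_sym[of _ _ A] by (blast intro: rtrancl_trans)

text \<open>Inserting both orientations of the edge produces many cases. Writing connectivity as
  equality of components lets equational reasoning sort them out.\<close>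

lemma connected_by_insert:
  "(v, w) \<in> connected_by (insert {a, b} A) \<longleftrightarrow> (v, w) \<in> connected_by A \<or>
     (v, a) \<in> connected_by A \<and> (b, w) \<in> connected_by A \<or>
     (v, b) \<in> connected_by A \<and> (a, w) \<in> connected_by A"
  unfolding adj_insert rtrancl_insert Un_iff mem_Collect_eq case_prod_conv
    component_eq_iff[of A, symmetric]
  by metis

lemma component_insert:
  "component (insert {a, b} A) v = component A v \<union>
     (if component A v = component A a then component A b else {}) \<union>
     (if component A v = component A b then component A a else {})"
  unfolding component_eq_iff by (auto simp: component_def connected_by_insert)

lemma mem_component_iff: "w \<in> component A v \<longleftrightarrow> component A v = component A w"
  unfolding component_eq_iff by (simp add: component_def)

text \<open>If the next vertex already lies on the path, the path is cut back to it instead of being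
  extended.\<close>

lemma distinct_path:
  assumes "(a, b) \<in> connected_by A"
  shows "\<exists>vs. vs \<noteq> [] \<and> hd vs = a \<and> last vs = b \<and> distinct vs \<and>
    (\<forall>i. Suc i < length vs \<longrightarrow> {vs ! i, vs ! Suc i} \<in> A)"
  using assms
proof (induction rule: rtrancl_induct)
  case base
  show ?case by (rule exI[of _ "[a]"]) auto
next
  case (step b c)
  then obtain vs where vs: "vs \<noteq> []" "hd vs = a" "last vs = b" "distinct vs"
    "\<And>i. Suc i < length vs \<Longrightarrow> {vs ! i, vs ! Suc i} \<in> A" by blast
  have bc: "{b, c} \<in> A" using step by (simp add: adj_def)
  show ?case
  proof (cases "c \<in> set vs")
    case True
    then obtain j where j: "j < length vs" "vs ! j = c" by (auto simp: in_set_conv_nth)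
    have "hd (take (Suc j) vs) = a" using vs by (simp add: hd_conv_nth)
    moreover have "last (take (Suc j) vs) = c" using j by (simp add: take_Suc_conv_app_nth)
    ultimately show ?thesis using vs j by (intro exI[of _ "take (Suc j) vs"]) auto
  next
    case False
    have "{(vs @ [c]) ! i, (vs @ [c]) ! Suc i} \<in> A" if i: "Suc i < length (vs @ [c])" for i
    proof (cases "Suc i < length vs")
      case True
      then show ?thesis using vs(5)[of i] by (simp add: nth_append)
    next
      case False
      then have "i = length vs - 1" using i by simp
      then show ?thesis using vs bc by (auto simp: nth_append last_conv_nth)
    qed
    then show ?thesis using vs False by (intro exI[of _ "vs @ [c]"]) auto
  qed
qed

lemma forest_subset: "forest A \<Longrightarrow> B \<subseteq> A \<Longrightarrow> forest B"
  unfolding forest_def by blast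

text \<open>A simple path from \<open>a\<close> to \<open>b\<close> closes up to a cycle. It has at
  least three vertices, as \<open>forest\<close> requires of a cycle, because
  \<open>a \<noteq> b\<close> and the edge is not in \<open>A\<close>.\<close>

lemma forest_insert_not_connected:
  assumes "forest (insert {a, b} A)" "{a, b} \<notin> A" "a \<noteq> b"
  shows "(a, b) \<notin> connected_by A"
proof
  assume "(a, b) \<in> connected_by A"
  then obtain vs where vs: "vs \<noteq> []" "hd vs = a" "last vs = b" "distinct vs"
    "\<And>i. Suc i < length vs \<Longrightarrow> {vs ! i, vs ! Suc i} \<in> A"
    using distinct_path[OF \<open>(a, b) \<in> connected_by A\<close>] by blast
  have ends: "vs ! 0 = a" "vs ! (length vs - 1) = b"
    using vs by (auto simp: hd_conv_nth last_conv_nth)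
  have "length vs \<noteq> 1" using ends assms(3) by auto
  moreover have "length vs \<noteq> 2"
  proof
    assume l: "length vs = 2"
    then show False using vs(5)[of 0] ends assms(2) by simp
  qed
  moreover have "length vs \<noteq> 0" using vs by simp
  ultimately have len: "length vs \<ge> 3" by linarith
  have "cycle_edges vs \<subseteq> insert {a, b} A"
  proof
    fix e assume "e \<in> cycle_edges vs"
    then obtain i where i: "i < length vs" "e = {vs ! i, vs ! (Suc i mod length vs)}"
      by (auto simp: cycle_edges_def)
    show "e \<in> insert {a, b} A"
    proof (cases "Suc i < length vs")
      case True
      then show ?thesis using i vs(5)[of i] by simp
    next
      case False
      then have "Suc i = length vs" using i by simp
      then have "Suc i mod length vs = 0" "i = length vs - 1" by auto
      then show ?thesis using i ends by (auto simp: insert_commute)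
    qed
  qed
  then show False using assms(1) vs(4) len unfolding forest_def by blast
qed

text \<open>Going round the cycle the long way avoids the closing edge; distinctness of at least
  three vertices keeps the other edges different from it.\<close>

lemma cycle_connected:
  assumes "length vs \<ge> 3" "distinct vs" "cycle_edges vs \<subseteq> A"
  shows "(vs ! 0, vs ! (length vs - 1)) \<in> connected_by (A - {{vs ! 0, vs ! (length vs - 1)}})"
proof -
  let ?x = "{vs ! 0, vs ! (length vs - 1)}"
  have "(vs ! 0, vs ! i) \<in> connected_by (A - {?x})" if "i < length vs" for i
    using that
  proof (induction i)
    case (Suc i)
    have "Suc i mod length vs = Suc i" using Suc by simp
    then have "{vs ! i, vs ! Suc i} \<in> A"
      using Suc.prems by (intro subsetD[OF assms(3)]) (auto simp: cycle_edges_def intro!: exI[of _ i])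
    moreover have "{vs ! i, vs ! Suc i} \<noteq> ?x"
    proof
      assume eq: "{vs ! i, vs ! Suc i} = ?x"
      have inj: "j < length vs \<Longrightarrow> k < length vs \<Longrightarrow> vs ! j = vs ! k \<Longrightarrow> j = k" for j k
        using assms(2) nth_eq_iff_index_eq by blast
      have "0 < length vs" "length vs - 1 < length vs" "i < length vs" using Suc by auto
      then have "vs ! i = vs ! 0 \<longrightarrow> i = 0" "vs ! Suc i = vs ! (length vs - 1) \<longrightarrow> Suc i = length vs - 1"
        "vs ! Suc i \<noteq> vs ! 0"
        using inj Suc.prems by blast+
      then show False using eq assms(1) unfolding doubleton_eq_iff by linarith
    qed
    ultimately have "(vs ! i, vs ! Suc i) \<in> connected_by (A - {?x})"
      by (intro connected_by_edge) auto
    then show ?case using Suc by (auto intro: rtrancl_trans)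
  qed simp
  then show ?thesis using assms(1) by simp
qed

section \<open>Rank and flats of a graphic matroid\<close>

locale finite_graph =
  fixes V :: "'v set" and Ed :: "'v set set"
  assumes finite_V: "finite V"
    and edge: "e \<in> Ed \<Longrightarrow> \<exists>a\<in>V. \<exists>b\<in>V. a \<noteq> b \<and> e = {a, b}"
begin

definition n_components :: "'v set set \<Rightarrow> nat" where
  "n_components A = card (component A ` V)"

definition graph_rank :: "'v set set \<Rightarrow> nat" where
  "graph_rank A = card V - n_components A"

lemma finite_Ed: "finite Ed"
  by (rule finite_subset[of _ "Pow V"]) (use edge finite_V in auto)

lemma n_components_le: "n_components A \<le> card V"
  unfolding n_components_def using finite_V by (rule card_image_le)

lemma n_components_insert:
  assumes ab: "a \<in> V" "b \<in> V"
  shows "(a, b) \<in> connected_by A \<Longrightarrow> n_components (insert {a, b} A) = n_components A"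
    and "(a, b) \<notin> connected_by A \<Longrightarrow> Suc (n_components (insert {a, b} A)) = n_components A"
proof -
  let ?A = "insert {a, b} A"
  assume conn: "(a, b) \<in> connected_by A"
  have "component A a = component A b" using conn by (simp add: component_eq_iff)
  then have "component ?A = component A" by (intro ext) (auto simp: component_insert)
  then show "n_components ?A = n_components A" by (simp add: n_components_def)
next
  let ?A = "insert {a, b} A"
  assume nconn: "(a, b) \<notin> connected_by A"
  let ?a = "component A a" and ?b = "component A b"
  let ?C = "component A ` V"
  have refl: "v \<in> component A v" for v by (simp add: component_def)
  have mem: "v \<in> ?a \<longleftrightarrow> component A v = ?a" "v \<in> ?b \<longleftrightarrow> component A v = ?b" for v
    using mem_component_iff[of v A] by auto
  have comp: "component ?A v =
      (if v \<in> ?a \<union> ?b then ?a \<union> ?b else component A v)" for v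
    unfolding component_insert Un_iff mem by auto
  have "component ?A ` V = insert (?a \<union> ?b) (?C - {?a, ?b})"
  proof (intro equalityI subsetI)
    fix X assume "X \<in> component ?A ` V"
    then show "X \<in> insert (?a \<union> ?b) (?C - {?a, ?b})" using mem by (auto simp: comp)
  next
    fix X assume "X \<in> insert (?a \<union> ?b) (?C - {?a, ?b})"
    then consider "X = ?a \<union> ?b" | v where "v \<in> V" "X = component A v" "X \<noteq> ?a" "X \<noteq> ?b"
      by blast
    then show "X \<in> component ?A ` V"
    proof cases
      case 1
      then show ?thesis using ab(1) refl comp[of a] by auto
    next
      case 2
      then have "component ?A v = X" using mem[of v] comp[of v] by auto
      then show ?thesis using 2 by blast
    qed
  qed
  moreover have "?a \<union> ?b \<notin> ?C - {?a, ?b}"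
  proof
    assume "?a \<union> ?b \<in> ?C - {?a, ?b}"
    then obtain v where v: "?a \<union> ?b = component A v" "component A v \<noteq> ?a" by auto
    then have "a \<in> component A v" using refl by blast
    then show False using v mem_component_iff by metis
  qed
  moreover have fin: "finite ?C" using finite_V by simp
  moreover have "?a \<noteq> ?b" using nconn component_eq_iff by metis
  moreover have "{?a, ?b} \<subseteq> ?C" using ab by auto
  moreover from calculation have "card (?C - {?a, ?b}) = card ?C - 2" "card ?C \<ge> 2"
    using card_Diff_subset[of "{?a, ?b}" ?C] card_mono[of ?C "{?a, ?b}"] by auto
  ultimately show "Suc (n_components ?A) = n_components A"
    unfolding n_components_def by simp
qed

lemma graph_rank_insert:
  assumes "a \<in> V" "b \<in> V"
  shows "graph_rank (insert {a, b} A) =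
    (if (a, b) \<in> connected_by A then graph_rank A else Suc (graph_rank A))"
  using n_components_insert[OF assms, of A] n_components_le[of A] n_components_le[of "insert {a, b} A"]
  by (auto simp: graph_rank_def)

lemma graph_rank_empty: "graph_rank {} = 0"
proof -
  have "component {} = (\<lambda>v :: 'v. {v})" by (auto simp: component_def adj_def)
  moreover have "card ((\<lambda>v. {v}) ` V) = card V" by (rule card_image) auto
  ultimately show ?thesis by (simp add: graph_rank_def n_components_def)
qed

sublocale rank_function Ed graph_rank
proof
  show "finite Ed" by (rule finite_Ed)
  show "graph_rank {} = 0" by (rule graph_rank_empty)
next
  fix A x assume "x \<in> Ed"
  then obtain a b where x: "a \<in> V" "b \<in> V" "x = {a, b}" using edge by blast
  show "graph_rank A \<le> graph_rank (insert x A)" "graph_rank (insert x A) \<le> graph_rank A + 1"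
    unfolding x graph_rank_insert[OF x(1,2)] by auto
next
  fix A x y assume xy: "x \<in> Ed" "y \<in> Ed"
    and eq: "graph_rank (insert x A) = graph_rank A" "graph_rank (insert y A) = graph_rank A"
  obtain a b where x: "a \<in> V" "b \<in> V" "x = {a, b}" using edge xy by blast
  obtain c d where y: "c \<in> V" "d \<in> V" "y = {c, d}" using edge xy by blast
  have "(a, b) \<in> connected_by A"
    using eq(1) unfolding x graph_rank_insert[OF x(1,2)] by (auto split: if_splits)
  then have "(a, b) \<in> connected_by (insert y A)" by (rule connected_by_mono[rotated]) auto
  then show "graph_rank (insert x (insert y A)) = graph_rank A"
    unfolding x graph_rank_insert[OF x(1,2)] using eq(2) by simp
qed

text \<open>Each edge added to a forest joins two components. Conversely, an edge on a cycle can be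
  removed without changing the rank, which is then at most the number of the remaining
  edges.\<close>

lemma forest_iff_rank:
  assumes "A \<subseteq> Ed"
  shows "forest A \<longleftrightarrow> graph_rank A = card A"
proof
  assume "forest A"
  have "finite A" using assms finite_Ed finite_subset by blast
  then show "graph_rank A = card A" using assms \<open>forest A\<close>
  proof (induction A rule: finite_induct)
    case (insert x A)
    obtain a b where x: "a \<in> V" "b \<in> V" "a \<noteq> b" "x = {a, b}" using edge insert.prems(1) by blast
    have "(a, b) \<notin> connected_by A"
      using insert.prems(2) insert.hyps(2) x(3) unfolding x(4) by (rule forest_insert_not_connected)
    moreover have "graph_rank A = card A"
      using insert forest_subset[OF insert.prems(2)] by auto
    ultimately show ?case using insert.hyps x by (simp add: graph_rank_insert)
  qed (simp add: graph_rank_empty)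
next
  assume rank: "graph_rank A = card A"
  show "forest A"
    unfolding forest_def
  proof
    assume "\<exists>vs. 3 \<le> length vs \<and> distinct vs \<and> cycle_edges vs \<subseteq> A"
    then obtain vs where vs: "3 \<le> length vs" "distinct vs" "cycle_edges vs \<subseteq> A" by blast
    let ?a = "vs ! 0" and ?b = "vs ! (length vs - 1)"
    let ?A = "A - {{?a, ?b}}"
    have "Suc (length vs - 1) mod length vs = 0" using vs(1) by (cases vs) auto
    then have "{?b, ?a} \<in> cycle_edges vs"
      unfolding cycle_edges_def using vs(1)
      by (intro CollectI exI[of _ "length vs - 1"]) auto
    then have x: "{?a, ?b} \<in> A" using vs(3) by (auto simp: insert_commute)
    then obtain c d where cd: "c \<in> V" "d \<in> V" "{?a, ?b} = {c, d}" using edge assms by blast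
    then have V: "?a \<in> V" "?b \<in> V" by (auto simp: doubleton_eq_iff)
    have "graph_rank (insert {?a, ?b} ?A) = graph_rank ?A"
      unfolding graph_rank_insert[OF V] using cycle_connected[OF vs] by (rule if_P)
    moreover have "insert {?a, ?b} ?A = A" using x by auto
    moreover have "graph_rank ?A \<le> card ?A" using assms by (intro r_le_card) auto
    moreover have "card ?A < card A"
      using x finite_subset[OF assms finite_Ed] by (intro psubset_card_mono) auto
    ultimately show False using rank by simp
  qed
qed

lemma graphic_matroid_eq:
  "graphic_matroid (V, Ed) = \<lparr>ground = Ed, indeps = {I. I \<subseteq> Ed \<and> graph_rank I = card I}\<rparr>"
  using forest_iff_rank by (auto simp: graphic_matroid_def)

lemma rank_graphic: "A \<subseteq> Ed \<Longrightarrow> rank_of (graphic_matroid (V, Ed)) A = graph_rank A"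
  unfolding graphic_matroid_eq by (rule rank_of_rank)

lemma ground_graphic: "ground (graphic_matroid (V, Ed)) = Ed"
  by (simp add: graphic_matroid_def)

lemma graphic_loopless_matroid: "loopless_matroid (graphic_matroid (V, Ed))"
proof
  show "is_matroid (graphic_matroid (V, Ed))"
    unfolding graphic_matroid_eq by (rule is_matroid_of_rank)
  show "loopless (graphic_matroid (V, Ed))"
    unfolding loopless_def graphic_matroid_eq
  proof (clarsimp)
    fix e assume "e \<in> Ed"
    then obtain a b where e: "a \<in> V" "b \<in> V" "a \<noteq> b" "e = {a, b}" using edge by blast
    have "(a, b) \<notin> connected_by {}" using e(3) by (simp add: adj_def)
    then show "graph_rank {e} = Suc 0"
      using graph_rank_insert[OF e(1,2), of "{}"] by (simp add: e(4) graph_rank_empty)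
  qed
qed

lemma flats_graphic:
  "F \<in> flats (graphic_matroid (V, Ed)) \<longleftrightarrow>
     F \<subseteq> Ed \<and> (\<forall>a b. {a, b} \<in> Ed \<longrightarrow> (a, b) \<in> connected_by F \<longrightarrow> {a, b} \<in> F)"
proof (cases "F \<subseteq> Ed")
  case True
  have ends: "a \<in> V \<and> b \<in> V" if "{a, b} \<in> Ed" for a b
    using edge[OF that] by (auto simp: doubleton_eq_iff)
  have rank: "rank_of (graphic_matroid (V, Ed)) F < rank_of (graphic_matroid (V, Ed)) (insert {a, b} F)
      \<longleftrightarrow> (a, b) \<notin> connected_by F" if "{a, b} \<in> Ed" for a b
    using that ends[OF that] True by (simp add: rank_graphic graph_rank_insert)
  show ?thesis
  proof
    assume flat: "F \<in> flats (graphic_matroid (V, Ed))"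
    show "F \<subseteq> Ed \<and> (\<forall>a b. {a, b} \<in> Ed \<longrightarrow> (a, b) \<in> connected_by F \<longrightarrow> {a, b} \<in> F)"
    proof (intro conjI True allI impI, rule ccontr)
      fix a b assume "{a, b} \<in> Ed" "(a, b) \<in> connected_by F" "{a, b} \<notin> F"
      then show False using rank[of a b] flat by (auto simp: flats_def ground_graphic)
    qed
  next
    assume closed: "F \<subseteq> Ed \<and> (\<forall>a b. {a, b} \<in> Ed \<longrightarrow> (a, b) \<in> connected_by F \<longrightarrow> {a, b} \<in> F)"
    show "F \<in> flats (graphic_matroid (V, Ed))"
      unfolding flats_def ground_graphic
    proof (intro CollectI conjI ballI True)
      fix x assume x: "x \<in> Ed - F"
      then obtain a b where "x = {a, b}" using edge by blast
      then show "rank_of (graphic_matroid (V, Ed)) F < rank_of (graphic_matroid (V, Ed)) (insert x F)"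
        using rank[of a b] closed x by auto
    qed
  qed
qed (auto simp: flats_def ground_graphic)

text \<open>Any complete invariant of connectivity counts the components; for the wheel this will be
  \<open>root\<close>.\<close>

lemma graph_rank_labelling:
  assumes "\<And>v w. v \<in> V \<Longrightarrow> w \<in> V \<Longrightarrow> (v, w) \<in> connected_by A \<longleftrightarrow> f v = f w"
  shows "graph_rank A = card V - card (f ` V)"
proof -
  have iff: "component A v = component A w \<longleftrightarrow> f v = f w" if "v \<in> V" "w \<in> V" for v w
    using assms[OF that] component_eq_iff by metis
  define g where "g = (\<lambda>X. f (SOME v. v \<in> V \<and> component A v = X))"
  have "g (component A v) = f v" if "v \<in> V" for v
    unfolding g_def using someI[of "\<lambda>w. w \<in> V \<and> component A w = component A v" v] that iff by blast
  then have "inj_on g (component A ` V)" "g ` component A ` V = f ` V"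
    using iff by (auto intro!: inj_onI simp: image_image) metis+
  then have "bij_betw g (component A ` V) (f ` V)" by (simp add: bij_betw_def)
  then show ?thesis
    by (simp add: graph_rank_def n_components_def bij_betw_same_card)
qed

end

section \<open>Flats of wheels as cyclic words\<close>

text \<open>A flat of the wheel is a partition of the vertices. A rim vertex gets the letter \<open>Hub\<close> if it
  lies in the block of the hub, and otherwise \<open>Cont\<close> or \<open>Start\<close> according to whether it lies in the
  block of its predecessor on the rim.\<close>

datatype letter = Hub | Start | Cont

text \<open>\<open>lab y p v\<close> is a label for the block of \<open>v\<close> when the rim is cut before vertex \<open>1\<close> and the
  vertex in front of the cut has label \<open>p\<close>; \<open>root\<close> below closes the rim again.\<close>

primrec lab :: "(nat \<Rightarrow> letter) \<Rightarrow> nat \<Rightarrow> nat \<Rightarrow> nat" where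
  "lab y p 0 = p"
| "lab y p (Suc v) = (case y (Suc v) of Hub \<Rightarrow> 0 | Start \<Rightarrow> Suc v | Cont \<Rightarrow> lab y p v)"

lemma lab_all_Cont: "\<forall>u\<in>{1..v}. y u = Cont \<Longrightarrow> lab y p v = p"
  by (induction v) auto

lemma lab_indep: "\<not> (\<forall>u\<in>{1..v}. y u = Cont) \<Longrightarrow> lab y p v = lab y q v"
proof (induction v)
  case (Suc v)
  show ?case
  proof (cases "y (Suc v) = Cont")
    case True
    then have "\<not> (\<forall>u\<in>{1..v}. y u = Cont)" using Suc.prems by (auto simp: le_Suc_eq)
    then show ?thesis using Suc.IH True by simp
  qed (auto split: letter.split)
qed simp

lemma lab_cases:
  "lab y p v = p \<or> lab y p v = 0 \<and> (\<exists>u\<in>{1..v}. y u = Hub) \<or>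
     lab y p v \<in> {1..v} \<and> y (lab y p v) = Start"
proof (induction v)
  case (Suc v)
  then show ?case by (cases "y (Suc v)") auto
qed simp

lemma lab_eq_pos:
  assumes "lab y p u = w" "w \<ge> 1"
  shows "w \<le> u \<and> (\<forall>x\<in>{w<..u}. y x = Cont) \<or> p = w \<and> (\<forall>x\<in>{1..u}. y x = Cont)"
  using assms
proof (induction u)
  case (Suc u)
  then show ?case
    by (cases "y (Suc u)") (force simp: le_Suc_eq)+
qed simp

text \<open>Label 0 stems from a hub letter or from the initial label, and spreads only along
  \<open>Cont\<close>. The last assumption, a part of \<open>valid\<close>, keeps it from spreading
  behind a hub letter.\<close>

lemma lab_eq_0:
  assumes "lab y p v = 0" "v \<ge> 1"
    and "\<And>u. u \<in> {2..v} \<Longrightarrow> y u = Cont \<Longrightarrow> y (u - 1) \<noteq> Hub"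
  shows "y v = Hub \<or> p = 0 \<and> (\<forall>u\<in>{1..v}. y u = Cont)"
  using assms
proof (induction v)
  case (Suc v)
  show ?case
  proof (cases "y (Suc v)")
    case Cont
    show ?thesis
    proof (cases "v = 0")
      case False
      then have "y v = Hub \<or> p = 0 \<and> (\<forall>u\<in>{1..v}. y u = Cont)"
        using Suc Cont by simp
      moreover have "y v \<noteq> Hub" using Suc.prems(3)[of "Suc v"] Cont False by simp
      ultimately show ?thesis using Cont by (auto simp: le_Suc_eq)
    qed (use Suc Cont in auto)
  qed (use Suc in auto)
qed simp

locale wheel_graph =
  fixes n :: nat
  assumes n_ge_2: "n \<ge> 2"
begin

definition prev :: "nat \<Rightarrow> nat" where
  "prev v = (if v = 1 then n else v - 1)"

abbreviation "rim \<equiv> {1..n}"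
abbreviation "Ed \<equiv> snd (wheel n)"

lemma prev_rim: "v \<in> rim \<Longrightarrow> prev v \<in> rim" and prev_neq: "v \<in> rim \<Longrightarrow> prev v \<noteq> v"
  using n_ge_2 by (auto simp: prev_def)

lemma wheel_edges: "Ed = {{0, v} | v. v \<in> rim} \<union> {{prev v, v} | v. v \<in> rim}"
proof -
  have "{{i, Suc i} | i. 1 \<le> i \<and> i < n} \<union> {{n, 1}} = {{prev v, v} | v. v \<in> rim}"
  proof (intro equalityI subsetI)
    fix e assume "e \<in> {{i, Suc i} | i. 1 \<le> i \<and> i < n} \<union> {{n, 1}}"
    then consider i where "e = {i, Suc i}" "1 \<le> i" "i < n" | "e = {n, 1}" by blast
    then show "e \<in> {{prev v, v} | v. v \<in> rim}"
    proof cases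
      case 1
      then show ?thesis by (intro CollectI exI[of _ "Suc i"]) (auto simp: prev_def)
    next
      case 2
      then show ?thesis using n_ge_2 by (intro CollectI exI[of _ 1]) (auto simp: prev_def)
    qed
  next
    fix e assume "e \<in> {{prev v, v} | v. v \<in> rim}"
    then obtain v where v: "e = {prev v, v}" "v \<in> rim" by blast
    show "e \<in> {{i, Suc i} | i. 1 \<le> i \<and> i < n} \<union> {{n, 1}}"
    proof (cases "v = 1")
      case False
      then have "e = {v - 1, Suc (v - 1)}" "1 \<le> v - 1" "v - 1 < n"
        using v by (auto simp: prev_def)
      then show ?thesis by blast
    qed (use v in \<open>simp add: prev_def\<close>)
  qed
  then show ?thesis by (auto simp: wheel_def)
qed

sublocale finite_graph "{0..n}" Ed
proof
  fix e assume "e \<in> Ed"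
  then consider v where "v \<in> rim" "e = {0, v}" | v where "v \<in> rim" "e = {prev v, v}"
    unfolding wheel_edges by blast
  then show "\<exists>a\<in>{0..n}. \<exists>b\<in>{0..n}. a \<noteq> b \<and> e = {a, b}"
  proof cases
    case 1
    then show ?thesis by (intro bexI[of _ 0] bexI[of _ v]) auto
  next
    case 2
    then show ?thesis using prev_rim[of v] prev_neq[of v]
      by (intro bexI[of _ "prev v"] bexI[of _ v]) auto
  qed
qed simp

text \<open>Two neighbouring hub letters contribute their rim edge as well, since its ends are
  connected through the hub.\<close>

definition edges_of :: "(nat \<Rightarrow> letter) \<Rightarrow> nat set set" where
  "edges_of y = {{0, v} | v. v \<in> rim \<and> y v = Hub} \<union>
     {{prev v, v} | v. v \<in> rim \<and> (y v = Cont \<or> y v = Hub \<and> y (prev v) = Hub)}"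

text \<open>A rim vertex in the block of a preceding hub letter is itself in the hub block, so
  \<open>Cont\<close> must not follow \<open>Hub\<close>. Without hub letters, a single
  \<open>Start\<close> would make the rim one block, whose normal form is the word of
  \<open>Cont\<close> only.\<close>

definition valid :: "(nat \<Rightarrow> letter) \<Rightarrow> bool" where
  "valid y \<longleftrightarrow> (\<forall>v\<in>rim. y v = Cont \<longrightarrow> y (prev v) \<noteq> Hub) \<and>
     ((\<forall>v\<in>rim. y v \<noteq> Hub) \<longrightarrow> card {v \<in> rim. y v = Start} \<noteq> 1)"

text \<open>The inner \<open>lab\<close> goes once round the rim to find the label of vertex
  \<open>n\<close>, which precedes vertex 1. Its initial value 1 matters only if all letters are
  \<open>Cont\<close>, and then names the block of the rim.\<close>

definition root :: "(nat \<Rightarrow> letter) \<Rightarrow> nat \<Rightarrow> nat" where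
  "root y v = (if v = 0 then 0 else lab y (lab y 1 n) v)"

lemma edges_of_subset: "edges_of y \<subseteq> Ed"
  unfolding edges_of_def wheel_edges by blast

lemma spoke_in: "v \<in> rim \<Longrightarrow> y v = Hub \<Longrightarrow> {0, v} \<in> edges_of y"
  and rim_in: "v \<in> rim \<Longrightarrow> y v = Cont \<or> y v = Hub \<and> y (prev v) = Hub \<Longrightarrow> {prev v, v} \<in> edges_of y"
  unfolding edges_of_def by blast+

lemma edges_of_cases [consumes 1, case_names spoke cont hub]:
  assumes "e \<in> edges_of y"
  obtains v where "v \<in> rim" "e = {0, v}" "y v = Hub"
    | v where "v \<in> rim" "e = {prev v, v}" "y v = Cont"
    | v where "v \<in> rim" "e = {prev v, v}" "y v = Hub" "y (prev v) = Hub"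
  using assms unfolding edges_of_def by blast

lemma wheel_edge_cases [consumes 1, case_names spoke rim]:
  assumes "e \<in> Ed"
  obtains v where "v \<in> rim" "e = {0, v}" | v where "v \<in> rim" "e = {prev v, v}"
  using assms unfolding wheel_edges by blast

lemma root_Hub: "v \<in> rim \<Longrightarrow> y v = Hub \<Longrightarrow> root y v = 0"
  and root_Start: "v \<in> rim \<Longrightarrow> y v = Start \<Longrightarrow> root y v = v"
  by (cases v; simp add: root_def)+

lemma root_Cont:
  assumes v: "v \<in> rim" and "y v = Cont"
  shows "root y v = root y (prev v)"
proof (cases "v = 1")
  case True
  \<comment> \<open>A second turn round the rim reproduces the label of \<open>n\<close>: it either
    ignores its initial value or returns it.\<close>
  have "lab y (lab y 1 n) n = lab y 1 n"
    using lab_all_Cont[of n y] lab_indep[of n y] by metis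
  then show ?thesis using True assms n_ge_2 by (simp add: root_def prev_def)
next
  case False
  then obtain u where "v = Suc u" "u \<noteq> 0" using v by (cases v) auto
  then show ?thesis using assms by (simp add: root_def prev_def)
qed

lemma root_cases:
  assumes "v \<in> rim"
  shows "root y v = 0 \<and> (\<exists>u\<in>rim. y u = Hub) \<or> root y v \<in> rim \<and> y (root y v) = Start \<or>
    root y v = 1 \<and> (\<forall>u\<in>rim. y u = Cont)"
proof -
  \<comment> \<open>In \<open>lab_cases\<close> the outcome that the label equals the initial one is
    ambiguous. Comparing the initial labels 1 and \<open>Suc n\<close> excludes it unless all
    letters are \<open>Cont\<close>.\<close>
  have "lab y 1 n = 1 \<and> (\<forall>u\<in>rim. y u = Cont) \<or> lab y 1 n = lab y 0 n \<and> (\<exists>u\<in>rim. y u = Hub) \<or>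
     lab y 1 n \<in> rim \<and> y (lab y 1 n) = Start"
    using lab_cases[of y 1 n] lab_all_Cont[of n y 1] lab_indep[of n y 1 0]
      lab_cases[of y "Suc n" n] lab_indep[of n y 1 "Suc n"] by fastforce
  then have base: "lab y 1 n = 0 \<and> (\<exists>u\<in>rim. y u = Hub) \<or> lab y 1 n \<in> rim \<and> y (lab y 1 n) = Start \<or>
     lab y 1 n = 1 \<and> (\<forall>u\<in>rim. y u = Cont)"
    using lab_cases[of y 0 n] by auto
  have "{1..v} \<subseteq> rim" using assms by auto
  then show ?thesis
    using lab_cases[of y "lab y 1 n" v] base assms by (auto simp: root_def)
qed

lemma connected_root:
  assumes "v \<in> rim"
  shows "(v, root y v) \<in> connected_by (edges_of y)"
proof -
  let ?c = "connected_by (edges_of y)"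
  \<comment> \<open>The second alternative is a run of \<open>Cont\<close> back to vertex 1, whose
    block continues across the cut.\<close>
  have lin: "(v, lab y p v) \<in> ?c \<or> lab y p v = p \<and> (v, 1) \<in> ?c \<and> y 1 = Cont"
    if "v \<le> n" "v \<ge> 1" for p v
    using that
  proof (induction v)
    case (Suc u)
    have v: "Suc u \<in> rim" using Suc by auto
    show ?case
    proof (cases "y (Suc u)")
      case Hub
      then have "{Suc u, 0} \<in> edges_of y" using spoke_in[OF v] by (simp add: insert_commute)
      then show ?thesis using Hub connected_by_edge[of "Suc u" 0] by simp
    next
      case Cont
      show ?thesis
      proof (cases "u = 0")
        case False
        then have "{Suc u, u} \<in> edges_of y"
          using rim_in[OF v, of y] Cont by (simp add: prev_def insert_commute)
        then have "(Suc u, u) \<in> ?c" by (rule connected_by_edge)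
        then show ?thesis using Suc False Cont by (auto intro: rtrancl_trans)
      qed (use Cont in simp)
    qed simp
  qed simp
  have n: "(n, lab y 1 n) \<in> ?c" using lin[of n 1] n_ge_2 by auto
  have "(1, n) \<in> ?c" if "y 1 = Cont"
    using rim_in[of 1 y] that n_ge_2
    by (intro connected_by_edge) (simp add: prev_def insert_commute)
  then show ?thesis
    using lin[of v "lab y 1 n"] n assms by (auto simp: root_def intro: rtrancl_trans)
qed

lemma root_edge:
  assumes "{a, b} \<in> edges_of y"
  shows "root y a = root y b"
proof -
  obtain v w where "{a, b} = {w, v}" "root y v = root y w"
    using assms
  proof (cases rule: edges_of_cases)
    case (spoke v)
    then show ?thesis using that[of 0 v] root_Hub[of v y] by (simp add: root_def)
  next
    case (cont v)
    then show ?thesis using that root_Cont by metis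
  next
    case (hub v)
    then show ?thesis using that[of "prev v" v] root_Hub prev_rim by simp
  qed
  then show ?thesis by (auto simp: doubleton_eq_iff)
qed

lemma root_connected: "(a, b) \<in> connected_by (edges_of y) \<Longrightarrow> root y a = root y b"
  by (induction rule: rtrancl_induct) (auto simp: adj_def dest: root_edge)

lemma connected_iff_root:
  assumes "a \<in> {0..n}" "b \<in> {0..n}"
  shows "(a, b) \<in> connected_by (edges_of y) \<longleftrightarrow> root y a = root y b"
proof
  assume eq: "root y a = root y b"
  have "(v, root y v) \<in> connected_by (edges_of y)" if "v \<in> {0..n}" for v
    using connected_root[of v y] that by (cases "v = 0") (auto simp: root_def[of y 0])
  then show "(a, b) \<in> connected_by (edges_of y)"
    using assms eq connected_by_sym rtrancl_trans by metis
qed (rule root_connected)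

lemma root_eq_0:
  assumes "valid y" "v \<in> rim" "root y v = 0"
  shows "y v = Hub"
proof (rule ccontr)
  have lin: "y (u - 1) \<noteq> Hub" if "u \<in> {2..n}" "y u = Cont" for u
    using assms(1) that unfolding valid_def prev_def by force
  assume "y v \<noteq> Hub"
  then have *: "lab y 1 n = 0" "\<forall>u\<in>{1..v}. y u = Cont"
    using lab_eq_0[of y "lab y 1 n" v] assms lin by (auto simp: root_def)
  then have "y n = Hub" using lab_eq_0[of y 1 n] lin n_ge_2 by auto
  moreover have "y 1 = Cont" using * assms by simp
  ultimately show False using assms(1) n_ge_2 unfolding valid_def prev_def by force
qed

lemma root_prev_iff:
  assumes "valid y" "v \<in> rim"
  shows "root y (prev v) = root y v \<longleftrightarrow> y v = Cont \<or> y v = Hub \<and> y (prev v) = Hub"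
proof
  assume eq: "root y (prev v) = root y v"
  show "y v = Cont \<or> y v = Hub \<and> y (prev v) = Hub"
  proof (cases "y v")
    case Hub
    then show ?thesis using eq assms root_Hub root_eq_0 prev_rim by metis
  next
    case Start
    then have eq: "lab y (lab y 1 n) (prev v) = v"
      using eq assms prev_rim[of v] root_Start[of v y] by (auto simp: root_def)
    have v: "1 \<le> v" "v \<le> n" using assms by auto
    \<comment> \<open>The label of \<open>v\<close> has travelled all the way round to its
      predecessor, which leaves only \<open>Cont\<close> in between: the word with exactly one
      \<open>Start\<close> that \<open>valid\<close> excludes.\<close>
    have "\<forall>x\<in>rim. x \<noteq> v \<longrightarrow> y x = Cont"
    proof (cases "v = 1")
      case True
      then have "prev v = n" by (simp add: prev_def)
      then have "\<forall>x\<in>{1<..n}. y x = Cont" using lab_eq_pos[OF eq] True by auto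
      then show ?thesis using True by auto
    next
      case False
      then have "prev v = v - 1" by (simp add: prev_def)
      then have *: "lab y 1 n = v" "\<forall>x\<in>{1..v - 1}. y x = Cont"
        using lab_eq_pos[OF eq v(1)] v by auto
      then have "\<forall>x\<in>{v<..n}. y x = Cont" using lab_eq_pos[OF *(1) v(1)] False by auto
      moreover have "x \<in> {1..v - 1} \<or> x \<in> {v<..n}" if "x \<in> rim" "x \<noteq> v" for x
        using that by auto
      ultimately show ?thesis using *(2) by blast
    qed
    then have all: "y x = (if x = v then Start else Cont)" if "x \<in> rim" for x
      using Start that by simp
    have "y x \<noteq> Hub" if "x \<in> rim" for x using all[OF that] by simp
    moreover have "{x \<in> rim. y x = Start} = {v}"
      using all assms(2) by (auto split: if_splits)
    ultimately show ?thesis using assms(1) by (simp add: valid_def)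
  qed simp
next
  assume "y v = Cont \<or> y v = Hub \<and> y (prev v) = Hub"
  then show "root y (prev v) = root y v"
    using root_Cont[of v y] root_Hub[of _ y] prev_rim assms(2) by auto
qed

lemma spoke_iff:
  assumes "valid y" "v \<in> rim"
  shows "{0, v} \<in> edges_of y \<longleftrightarrow> y v = Hub"
  using root_edge[of 0 v y] root_eq_0[OF assms] spoke_in[OF assms(2), of y]
  by (auto simp: root_def[of y 0])

lemma rim_iff:
  assumes "valid y" "v \<in> rim"
  shows "{prev v, v} \<in> edges_of y \<longleftrightarrow> y v = Cont \<or> y v = Hub \<and> y (prev v) = Hub"
  using root_edge[of "prev v" v y] root_prev_iff[OF assms] rim_in[OF assms(2), of y] by argo

lemma edges_of_flat:
  assumes "valid y"
  shows "edges_of y \<in> flats (graphic_matroid ({0..n}, Ed))"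
  unfolding flats_graphic
proof (intro conjI allI impI edges_of_subset)
  fix a b assume e: "{a, b} \<in> Ed" and conn: "(a, b) \<in> connected_by (edges_of y)"
  have eq: "root y a = root y b" using conn by (rule root_connected)
  from e show "{a, b} \<in> edges_of y"
  proof (cases rule: wheel_edge_cases)
    case (spoke v)
    then have "root y v = 0" using eq by (auto simp: doubleton_eq_iff root_def[of y 0])
    then show ?thesis using spoke root_eq_0[OF assms] spoke_in by simp
  next
    case (rim v)
    then have "root y (prev v) = root y v" using eq by (auto simp: doubleton_eq_iff)
    then show ?thesis using rim root_prev_iff[OF assms] rim_in by simp
  qed
qed

text \<open>Closedness in the triangle of the hub, \<open>prev v\<close> and \<open>v\<close> makes
  the letters consistent and forbids \<open>Cont\<close> after \<open>Hub\<close>. If just one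
  \<open>Start\<close> and no hub letter remained, the other rim edges would connect the ends of the
  missing one, so that edge would lie in \<open>F\<close> too.\<close>

lemma flat_edges_of:
  assumes F: "F \<in> flats (graphic_matroid ({0..n}, Ed))"
  defines "y \<equiv> \<lambda>v. if {0, v} \<in> F then Hub else if {prev v, v} \<in> F then Cont else Start"
  shows "valid y" "edges_of y = F"
proof -
  have FE: "F \<subseteq> Ed" and closed: "\<And>a b. {a, b} \<in> Ed \<Longrightarrow> (a, b) \<in> connected_by F \<Longrightarrow> {a, b} \<in> F"
    using F unfolding flats_graphic by blast+
  have Hub: "y v = Hub \<longleftrightarrow> {0, v} \<in> F" for v by (simp add: y_def)
  have Ed: "{0, v} \<in> Ed" "{prev v, v} \<in> Ed" if "v \<in> rim" for v
    using that unfolding wheel_edges by blast+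
  have path: "{a, c} \<in> F" if "{a, b} \<in> F" "{b, c} \<in> F" "{a, c} \<in> Ed" for a b c
    using rtrancl_trans[OF connected_by_edge[OF that(1)] connected_by_edge[OF that(2)]] that(3)
    by (intro closed)
  have Hub_rim: "{prev v, v} \<in> F \<and> y v \<noteq> Cont \<longleftrightarrow> y v = Hub \<and> y (prev v) = Hub" if v: "v \<in> rim" for v
    using path[of 0 v "prev v"] path[of "prev v" 0 v] Ed[OF v] Ed[OF prev_rim[OF v]]
    by (auto simp: y_def insert_commute)
  have "F \<subseteq> edges_of y"
  proof
    fix e assume e: "e \<in> F"
    from e FE have "e \<in> Ed" by blast
    then show "e \<in> edges_of y"
    proof (cases rule: wheel_edge_cases)
      case (spoke v)
      then show ?thesis using e Hub spoke_in by auto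
    next
      case (rim v)
      then show ?thesis using e Hub_rim[of v] rim_in[of v y] by auto
    qed
  qed
  moreover have sub: "edges_of y \<subseteq> F"
  proof
    fix e assume "e \<in> edges_of y"
    then show "e \<in> F"
    proof (cases rule: edges_of_cases)
      case (spoke v)
      then show ?thesis using Hub by simp
    next
      case (cont v)
      then show ?thesis by (auto simp: y_def split: if_splits)
    next
      case (hub v)
      then show ?thesis using Hub_rim[of v] by blast
    qed
  qed
  ultimately show "edges_of y = F" by blast
  show "valid y"
    unfolding valid_def
  proof (intro conjI ballI impI)
    fix v assume v: "v \<in> rim" "y v = Cont"
    then have "{prev v, v} \<in> F" "{0, v} \<notin> F" by (auto simp: y_def split: if_splits)
    then show "y (prev v) \<noteq> Hub" using path[of 0 "prev v" v] Ed[OF v(1)] Hub by metis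
  next
    assume noHub: "\<forall>v\<in>rim. y v \<noteq> Hub"
    show "card {v \<in> rim. y v = Start} \<noteq> 1"
    proof
      assume "card {v \<in> rim. y v = Start} = 1"
      then obtain b where b: "{v \<in> rim. y v = Start} = {b}" by (rule card_1_singletonE)
      then have bS: "b \<in> rim" "y b = Start" by auto
      have "\<not> (\<exists>u\<in>rim. y u = Hub)" "\<not> (\<forall>u\<in>rim. y u = Cont)"
        using noHub bS by (auto intro: bexI[of _ b])
      then have "root y (prev b) \<in> {v \<in> rim. y v = Start}"
        using root_cases[OF prev_rim[OF bS(1)], of y] by blast
      then have "root y (prev b) = b" unfolding b by simp
      then have "(prev b, b) \<in> connected_by F"
        using connected_root[OF prev_rim[OF bS(1)], of y] connected_by_mono[OF sub] by simp
      then have "{prev b, b} \<in> F" using closed Ed(2)[OF bS(1)] by blast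
      then show False using bS by (simp add: y_def split: if_splits)
    qed
  qed
qed

text \<open>Inclusion of flats becomes a condition on single letters and their predecessors, which
  is what lets upper intervals be generated letter by letter.\<close>

lemma edges_of_subset_iff:
  assumes "valid y" "valid z"
  shows "edges_of y \<subseteq> edges_of z \<longleftrightarrow> (\<forall>v\<in>rim. (y v = Hub \<longrightarrow> z v = Hub) \<and>
    (y v = Cont \<longrightarrow> z v = Cont \<or> z v = Hub \<and> z (prev v) = Hub))"
proof
  assume sub: "edges_of y \<subseteq> edges_of z"
  show "\<forall>v\<in>rim. (y v = Hub \<longrightarrow> z v = Hub) \<and>
      (y v = Cont \<longrightarrow> z v = Cont \<or> z v = Hub \<and> z (prev v) = Hub)"
  proof (intro ballI conjI impI)
    fix v assume v: "v \<in> rim"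
    show "z v = Hub" if "y v = Hub"
      using spoke_in[OF v, of y] that sub spoke_iff[OF assms(2) v] by auto
    show "z v = Cont \<or> z v = Hub \<and> z (prev v) = Hub" if "y v = Cont"
      using rim_in[OF v, of y] that sub rim_iff[OF assms(2) v] by auto
  qed
next
  assume le: "\<forall>v\<in>rim. (y v = Hub \<longrightarrow> z v = Hub) \<and>
      (y v = Cont \<longrightarrow> z v = Cont \<or> z v = Hub \<and> z (prev v) = Hub)"
  show "edges_of y \<subseteq> edges_of z"
  proof
    fix e assume "e \<in> edges_of y"
    then show "e \<in> edges_of z"
    proof (cases rule: edges_of_cases)
      case (spoke v)
      then show ?thesis using le spoke_in by simp
    next
      case (cont v)
      then show ?thesis using le rim_in by simp
    next
      case (hub v)
      then show ?thesis using le rim_in prev_rim by simp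
    qed
  qed
qed

lemma edges_of_eqD:
  assumes "valid y" "valid z" "edges_of y = edges_of z" "v \<in> rim"
  shows "y v = z v"
  using spoke_iff[OF assms(1,4)] spoke_iff[OF assms(2,4)] rim_iff[OF assms(1,4)] rim_iff[OF assms(2,4)]
    assms(3) by (cases "y v"; cases "z v") auto

text \<open>The values of \<open>root\<close> are 0 for the hub block, the positions of
  \<open>Start\<close>, and 1 if the rim is a single block written without
  \<open>Start\<close>.\<close>

lemma rank_edges_of:
  "graph_rank (edges_of y) =
     n - card {v \<in> rim. y v = Start} - (if \<forall>v\<in>rim. y v = Cont then 1 else 0)"
proof -
  let ?S = "{v \<in> rim. y v = Start}" and ?T = "if \<forall>v\<in>rim. y v = Cont then {1} else {}"
  have "root y ` {0..n} = insert 0 (?S \<union> ?T)"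
  proof (intro equalityI subsetI)
    fix x assume "x \<in> root y ` {0..n}"
    then obtain v where v: "v \<in> {0..n}" "x = root y v" by blast
    show "x \<in> insert 0 (?S \<union> ?T)"
    proof (cases "v = 0")
      case False
      then show ?thesis using v root_cases[of v y] by auto
    qed (use v in \<open>simp add: root_def\<close>)
  next
    fix x assume "x \<in> insert 0 (?S \<union> ?T)"
    then consider "x = 0" | "x \<in> ?S" | "x = 1" "\<forall>v\<in>rim. y v = Cont" by (auto split: if_splits)
    then show "x \<in> root y ` {0..n}"
    proof cases
      case 1
      then show ?thesis by (intro image_eqI[of _ _ 0]) (auto simp: root_def)
    next
      case 2
      then show ?thesis using root_Start[of x y] by (intro image_eqI[of _ _ x]) auto
    next
      case 3
      then show ?thesis using root_cases[of 1 y] n_ge_2 by (intro image_eqI[of _ _ 1]) force+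
    qed
  qed
  moreover have "card (insert 0 (?S \<union> ?T)) = Suc (card ?S + (if \<forall>v\<in>rim. y v = Cont then 1 else 0))"
    by (subst card_insert_disjoint) (auto intro!: card_Un_disjoint)
  ultimately show ?thesis
    using graph_rank_labelling[of "edges_of y" "root y"] connected_iff_root by simp
qed

end

section \<open>Sums over words\<close>

text \<open>\<open>extensions h F\<close> consists of the words above \<open>F\<close> if the letter before the first one is
  (\<open>h\<close>) or is not (\<open>\<not> h\<close>) \<open>Hub\<close>.\<close>

definition step :: "bool \<Rightarrow> letter \<Rightarrow> letter \<Rightarrow> bool" where
  "step h x g \<longleftrightarrow> (x = Hub \<longrightarrow> g = Hub) \<and> (x = Cont \<longrightarrow> g = (if h then Hub else Cont)) \<and>
     (g = Cont \<longrightarrow> \<not> h)"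

fun extensions :: "bool \<Rightarrow> letter list \<Rightarrow> letter list set" where
  "extensions h [] = {[]}"
| "extensions h (x # F) = (\<Union>g\<in>{g. step h x g}. (#) g ` extensions (g = Hub) F)"

abbreviation starts :: "letter list \<Rightarrow> nat" where
  "starts G \<equiv> count_list G Start"

lemma finite_letters: "finite (A :: letter set)"
proof (rule finite_subset[of _ "{Hub, Start, Cont}"])
  show "A \<subseteq> {Hub, Start, Cont}" using letter.exhaust by blast
qed simp

lemma step_simps:
  "{g. step h Hub g} = {Hub}"
  "{g. step h Cont g} = (if h then {Hub} else {Cont})"
  "{g. step h Start g} = (if h then {Hub, Start} else {Hub, Start, Cont})"
proof -
  have "g = Hub \<or> g = Start \<or> g = Cont" for g by (cases g) auto
  then show "{g. step h Hub g} = {Hub}" "{g. step h Cont g} = (if h then {Hub} else {Cont})"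
    "{g. step h Start g} = (if h then {Hub, Start} else {Hub, Start, Cont})"
    by (auto simp: step_def)
qed

lemma finite_extensions: "finite (extensions h F)"
  by (induction F arbitrary: h) (auto simp: finite_letters)

lemma Cons_in_extensions:
  "g # G \<in> extensions h (x # F) \<longleftrightarrow> step h x g \<and> G \<in> extensions (g = Hub) F"
  by auto

lemma length_extensions: "G \<in> extensions h F \<Longrightarrow> length G = length F"
  by (induction F arbitrary: h G) auto

lemma starts_extensions: "G \<in> extensions h F \<Longrightarrow> starts G \<le> starts F"
proof (induction F arbitrary: h G)
  case (Cons x F)
  then obtain g G' where G: "G = g # G'" "step h x g" "G' \<in> extensions (g = Hub) F" by auto
  then have le: "starts G' \<le> starts F" using Cons.IH by blast
  have "x = Start" if "g = Start"
    using G(2) that by (cases x) (simp_all add: step_def split: if_splits)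
  then show ?case using le by (simp add: G(1))
qed simp

lemma append_in_extensions:
  assumes "length G1 = length F1"
  shows "G1 @ G2 \<in> extensions h (F1 @ F2) \<longleftrightarrow>
    G1 \<in> extensions h F1 \<and> G2 \<in> extensions (if G1 = [] then h else last G1 = Hub) F2"
  using assms
  by (induction G1 F1 arbitrary: h rule: list_induct2) (auto simp: Cons_in_extensions simp del: extensions.simps(2))

lemma sum_extensions_Cons:
  "(\<Sum>G\<in>{G \<in> extensions h (x # F). P G}. s G) =
    (\<Sum>g\<in>{g. step h x g}. \<Sum>G\<in>{G \<in> extensions (g = Hub) F. P (g # G)}. s (g # G))"
proof -
  have eq: "{G \<in> extensions h (x # F). P G} =
      (\<Union>g\<in>{g. step h x g}. (#) g ` {G \<in> extensions (g = Hub) F. P (g # G)})"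
    by auto
  show ?thesis unfolding eq
    by (subst sum.UNION_disjoint)
      (auto simp: finite_letters finite_extensions sum.reindex)
qed

lemma extensions_no_starts:
  assumes "G \<in> extensions True F" "starts G = 0"
  shows "G = replicate (length F) Hub"
  using assms
proof (induction F arbitrary: G)
  case (Cons x F)
  then obtain g G' where G: "G = g # G'" "step True x g" "G' \<in> extensions (g = Hub) F" by auto
  then have "g = Hub" using Cons.prems(2) by (cases g) (auto simp: step_def)
  then show ?case using G Cons by simp
qed simp

text \<open>The flag \<open>last G = Hub\<close> makes the last letter the predecessor of the first.
  Carving the set out of two finite sets makes its finiteness evident.\<close>

definition cyclic_extensions :: "letter list \<Rightarrow> letter list set" where
  "cyclic_extensions F = {G \<in> extensions True F \<union> extensions False F. G \<in> extensions (last G = Hub) F}"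

lemma cyclic_extensions_iff: "G \<in> cyclic_extensions F \<longleftrightarrow> G \<in> extensions (last G = Hub) F"
  unfolding cyclic_extensions_def by (cases "last G = Hub") auto

lemma finite_cyclic_extensions: "finite (cyclic_extensions F)"
  unfolding cyclic_extensions_def by (simp add: finite_extensions)

text \<open>Cutting behind a hub letter makes the word linear with flag \<open>True\<close>, and the
  former ends become an ordinary junction of \<open>v\<close> and \<open>u\<close>. Only the
  condition on the hub letter itself looks back to the end of the new word.\<close>

lemma cyclic_extensions_Hub:
  assumes "length u = length Fu" "length v = length Fv"
  shows "u @ Hub # v \<in> cyclic_extensions (Fu @ x # Fv) \<longleftrightarrow>
    step (if u = [] then last (Hub # v) = Hub else last u = Hub) x Hub \<and>
    v @ u \<in> extensions True (Fv @ Fu)"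
  unfolding cyclic_extensions_iff append_in_extensions[OF assms(1)] append_in_extensions[OF assms(2)]
    Cons_in_extensions
  by (cases "v = []"; cases "u = []") auto

lemma cyclic_extensions_rotate:
  assumes "G1 @ G2 \<in> cyclic_extensions (F1 @ F2)" "length G1 = length F1"
  shows "G2 @ G1 \<in> cyclic_extensions (F2 @ F1)"
proof -
  have len: "length G2 = length F2" using assms length_extensions unfolding cyclic_extensions_iff by fastforce
  show ?thesis using assms(1)
    unfolding cyclic_extensions_iff append_in_extensions[OF assms(2)] append_in_extensions[OF len]
    by (cases "G1 = []"; cases "G2 = []") auto
qed

lemma cyclic_extensions_no_Hub:
  assumes "F \<noteq> []"
  shows "{G \<in> cyclic_extensions F. Hub \<notin> set G} = {G \<in> extensions False F. Hub \<notin> set G}"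
proof -
  have "last G \<noteq> Hub" if "G \<in> extensions h F" "Hub \<notin> set G" for h G
  proof -
    have "G \<noteq> []" using length_extensions[OF that(1)] assms by auto
    then show ?thesis using that(2) last_in_set by metis
  qed
  then show ?thesis unfolding cyclic_extensions_iff by (metis (mono_tags, lifting))
qed

text \<open>Only the numbers of \<open>Start\<close> before and after the chosen one matter, so its
  position may be replaced by its ordinal among them.\<close>

lemma sum_over_starts:
  "(\<Sum>i\<in>{i. i < length F \<and> F ! i = Start}. s (starts (take i F)) (starts (drop (Suc i) F))) =
    (\<Sum>a<starts F. s a (starts F - 1 - a))"
proof (induction F arbitrary: s)
  case (Cons x F)
  have eq: "{i. i < length (x # F) \<and> (x # F) ! i = Start} =
      (if x = Start then {0} else {}) \<union> Suc ` {i. i < length F \<and> F ! i = Start}"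
  proof (rule set_eqI)
    fix i
    show "i \<in> {i. i < length (x # F) \<and> (x # F) ! i = Start} \<longleftrightarrow>
        i \<in> (if x = Start then {0} else {}) \<union> Suc ` {i. i < length F \<and> F ! i = Start}"
      by (cases i) auto
  qed
  let ?I = "{i. i < length F \<and> F ! i = Start}"
  have "(\<Sum>i\<in>Suc ` ?I. s (starts (take i (x # F))) (starts (drop (Suc i) (x # F)))) =
      (\<Sum>i\<in>?I. s ((if x = Start then 1 else 0) + starts (take i F)) (starts (drop (Suc i) F)))"
    by (subst sum.reindex) (auto intro!: sum.cong)
  also have "\<dots> = (\<Sum>a<starts F. s ((if x = Start then 1 else 0) + a) (starts F - 1 - a))"
    by (rule Cons.IH)
  finally have tail: "(\<Sum>i\<in>Suc ` ?I. s (starts (take i (x # F))) (starts (drop (Suc i) (x # F)))) =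
      (\<Sum>a<starts F. s ((if x = Start then 1 else 0) + a) (starts F - 1 - a))" .
  show ?case
  proof (cases "x = Start")
    case True
    let ?h = "\<lambda>i. s (starts (take i (x # F))) (starts (drop (Suc i) (x # F)))"
    have "(\<Sum>i\<in>{0} \<union> Suc ` ?I. ?h i) = ?h 0 + (\<Sum>i\<in>Suc ` ?I. ?h i)"
      by (subst sum.union_disjoint) auto
    also have "\<dots> = s 0 (starts F) + (\<Sum>a<starts F. s (Suc a) (starts F - Suc a))"
      unfolding tail using True by simp
    also have "\<dots> = (\<Sum>a<starts (x # F). s a (starts (x # F) - 1 - a))"
      using True by (simp add: sum.lessThan_Suc_shift del: sum.lessThan_Suc)
    finally show ?thesis unfolding eq using True by simp
  next
    case False
    then show ?thesis unfolding eq using tail by simp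
  qed
qed simp

section \<open>Weighted sums over linear words\<close>

definition var :: "int poly" where
  "var = [:0, 1:]"

lemma var_power: "var ^ k = monom 1 k"
  by (simp add: var_def monom_altdef)

lemma palindromic_one_var: "palindromic 1 (1 + var)"
proof -
  have "1 + var = [:1, 1:]" by (simp add: var_def one_pCons)
  then show ?thesis by (simp add: palindromic_def flip_poly_def reflect_poly_def monom_0)
qed

text \<open>\<open>f k\<close> stands for the polynomial of a gap with k blocks and
  \<open>w k\<close> for that of a hub-free rim with k blocks. They stay abstract until the sums
  over words are reduced to recursions. A rim forming one block has no \<open>Start\<close> and is
  treated separately, so the values 0 of \<open>w\<close> at 0 and 1 are placeholders that drop out
  of \<open>rim_sum\<close>.\<close>

locale block_weights =
  fixes f w :: "nat \<Rightarrow> int poly"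
  assumes f_0 [simp]: "f 0 = 1" and w_0 [simp]: "w 0 = 0" and w_1 [simp]: "w (Suc 0) = 0"
begin

fun path_weight :: "nat \<Rightarrow> letter list \<Rightarrow> int poly" where
  "path_weight k [] = f k"
| "path_weight k (Hub # G) = f k * path_weight 0 G"
| "path_weight k (Start # G) = path_weight (Suc k) G"
| "path_weight k (Cont # G) = path_weight k G"

text \<open>The index \<open>k\<close> counts the blocks in the current gap, so \<open>k = 0\<close> directly after a hub letter,
  where \<open>Cont\<close> is not allowed. \<open>gap_sum k a\<close> sums over the continuations by \<open>a\<close> letters without \<open>Hub\<close>,
  \<open>fan_sum a k b\<close> over those by \<open>b\<close> arbitrary letters and then \<open>a\<close> letters without \<open>Hub\<close>.\<close>

fun gap_sum :: "nat \<Rightarrow> nat \<Rightarrow> int poly" where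
  "gap_sum k 0 = f k"
| "gap_sum k (Suc a) = gap_sum (Suc k) a + (if k = 0 then 0 else var * gap_sum k a)"

fun fan_sum :: "nat \<Rightarrow> nat \<Rightarrow> nat \<Rightarrow> int poly" where
  "fan_sum a k 0 = gap_sum k a"
| "fan_sum a k (Suc b) = var * f k * fan_sum a 0 b + fan_sum a (Suc k) b +
     (if k = 0 then 0 else var * fan_sum a k b)"

text \<open>\<open>k\<close> counts the letters \<open>Start\<close> that stayed so far. In contrast
  to \<open>gap_sum\<close>, merging is possible at \<open>k = 0\<close> too, because the first
  block may continue the last one round the rim.\<close>

fun rim_sum :: "nat \<Rightarrow> nat \<Rightarrow> int poly" where
  "rim_sum k 0 = w k"
| "rim_sum k (Suc a) = rim_sum (Suc k) a + var * rim_sum k a"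

text \<open>The summands belong to the words with a hub letter, cut at the first one; to the
  hub-free words with at least two blocks; and to the rim as one block, which has relative rank
  \<open>k - 1\<close> and a contraction of rank one with polynomial 1.\<close>

definition wheel_sum :: "nat \<Rightarrow> int poly" where
  "wheel_sum k = var * (\<Sum>a<k. fan_sum a 0 (k - 1 - a)) + rim_sum 0 k + var ^ (k - 1)"

lemma path_weight_Hub: "path_weight k (x @ Hub # y) = path_weight k x * path_weight 0 y"
  by (induction k x rule: path_weight.induct) (auto simp: mult.assoc)

lemma path_weight_replicate_Hub: "path_weight 0 (replicate m Hub) = 1"
  by (induction m) auto

text \<open>\<open>F2\<close> lies below the letters that precede the first hub letter of a cyclic
  word and were moved to the end by the cut, hence they contain no \<open>Hub\<close>. The condition
  \<open>k = 0\<close> doubles as the flag that the previous letter is \<open>Hub\<close>.\<close>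

definition tail_sum :: "nat \<Rightarrow> letter list \<Rightarrow> letter list \<Rightarrow> int poly" where
  "tail_sum k F1 F2 = (\<Sum>G\<in>{G \<in> extensions (k = 0) (F1 @ F2). Hub \<notin> set (drop (length F1) G)}.
     var ^ (starts (F1 @ F2) - starts G) * path_weight k G)"

lemma tail_sum_Nil: "tail_sum k F [] =
    (\<Sum>G\<in>extensions (k = 0) F. var ^ (starts F - starts G) * path_weight k G)"
proof -
  have "{G \<in> extensions (k = 0) (F @ []). Hub \<notin> set (drop (length F) G)} = extensions (k = 0) F"
    by (auto dest: length_extensions)
  then show ?thesis by (simp add: tail_sum_def)
qed

text \<open>A \<open>Start\<close> turns into \<open>Hub\<close>, stays, or merges, and
  \<open>var\<close> records its loss. Right after a hub letter a lower \<open>Cont\<close> is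
  forced to \<open>Hub\<close>, but its weight is then \<open>f 0 = 1\<close>, so the rule for
  \<open>Cont\<close> is uniform.\<close>

lemma tail_sum_Cons1:
  "tail_sum k (Hub # F1) F2 = f k * tail_sum 0 F1 F2"
  "tail_sum k (Cont # F1) F2 = tail_sum k F1 F2"
  "tail_sum k (Start # F1) F2 = var * f k * tail_sum 0 F1 F2 + tail_sum (Suc k) F1 F2 +
     (if k = 0 then 0 else var * tail_sum k F1 F2)"
proof -
  have le: "starts G \<le> starts F1 + starts F2" if "G \<in> extensions h (F1 @ F2)" for G h
    using starts_extensions[OF that] by simp
  show "tail_sum k (Hub # F1) F2 = f k * tail_sum 0 F1 F2"
    "tail_sum k (Cont # F1) F2 = tail_sum k F1 F2"
    by (auto simp: tail_sum_def sum_extensions_Cons step_simps sum_distrib_left mult_ac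
        simp del: extensions.simps(2))
  let ?N = "starts F1 + starts F2"
    and ?S = "\<lambda>h. {G \<in> extensions h (F1 @ F2). Hub \<notin> set (drop (length F1) G)}"
  have pull: "(\<Sum>G\<in>?S h. var ^ (Suc ?N - starts G) * p G) = var * (\<Sum>G\<in>?S h. var ^ (?N - starts G) * p G)"
    for h p
    by (auto simp: sum_distrib_left Suc_diff_le[OF le] mult_ac intro!: sum.cong)
  have "tail_sum k (Start # F1) F2 =
      (\<Sum>G\<in>?S True. var ^ (Suc ?N - starts G) * (f k * path_weight 0 G)) +
      ((\<Sum>G\<in>?S False. var ^ (?N - starts G) * path_weight (Suc k) G) +
      (if k = 0 then 0 else \<Sum>G\<in>?S False. var ^ (Suc ?N - starts G) * path_weight k G))"
    by (simp add: tail_sum_def sum_extensions_Cons step_simps del: extensions.simps(2))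
  also have "(\<Sum>G\<in>?S True. var ^ (Suc ?N - starts G) * (f k * path_weight 0 G)) =
      var * (f k * tail_sum 0 F1 F2)"
    unfolding pull by (simp add: tail_sum_def sum_distrib_left mult_ac)
  finally show "tail_sum k (Start # F1) F2 = var * f k * tail_sum 0 F1 F2 + tail_sum (Suc k) F1 F2 +
      (if k = 0 then 0 else var * tail_sum k F1 F2)"
    unfolding pull by (simp add: tail_sum_def mult.assoc)
qed

text \<open>A hub letter of the lower word persists in all words above it, so its two sides are
  summed independently.\<close>

lemma tail_sum_Hub:
  "tail_sum k (F1 @ Hub # F2) F3 = tail_sum k F1 [] * tail_sum 0 F2 F3"
proof (induction F1 arbitrary: k)
  case Nil
  have "tail_sum k [] [] = f k" for k by (simp add: tail_sum_Nil[of k "[]"])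
  then show ?case by (simp add: tail_sum_Cons1)
next
  case (Cons x F1)
  then show ?case by (cases x) (simp_all add: tail_sum_Cons1 algebra_simps)
qed

text \<open>Right after a hub letter, a lower \<open>Cont\<close> would force another one and make
  the sum empty; the second assumption excludes this.\<close>

lemma tail_sum_Nil1:
  assumes "Hub \<notin> set F" "k = 0 \<Longrightarrow> F = [] \<or> hd F = Start"
  shows "tail_sum k [] F = gap_sum k (starts F)"
  using assms
proof (induction F arbitrary: k)
  case (Cons x F)
  have le: "starts G \<le> starts F" if "G \<in> extensions h F" for G h
    using starts_extensions[OF that] by simp
  have noHub: "(\<Sum>G\<in>{G \<in> extensions h F. False}. s G) = 0" for h and s :: "letter list \<Rightarrow> int poly"
    by simp
  show ?case
  proof (cases x)
    case Cont
    then have "k > 0" using Cons.prems by auto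
    then show ?thesis using Cons.IH[of k] Cons.prems Cont
      by (simp add: tail_sum_def sum_extensions_Cons step_simps del: extensions.simps(2))
  next
    case Start
    have "tail_sum k [] (Start # F) =
        tail_sum (Suc k) [] F + (if k = 0 then 0 else var * tail_sum k [] F)"
      by (auto simp: tail_sum_def sum_extensions_Cons step_simps sum_distrib_left Suc_diff_le[OF le]
          mult_ac simp del: extensions.simps(2) intro!: sum.cong)
    then show ?thesis using Cons Start by simp
  qed (use Cons in auto)
qed (simp add: tail_sum_def cong: conj_cong)

lemma tail_sum_eq_fan_sum:
  assumes "Hub \<notin> set F1" "Hub \<notin> set F2" "F2 = [] \<or> hd F2 = Start"
  shows "tail_sum k F1 F2 = fan_sum (starts F2) k (starts F1)"
  using assms
proof (induction F1 arbitrary: k)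
  case Nil
  then show ?case by (simp add: tail_sum_Nil1)
next
  case (Cons x F1)
  then show ?case by (cases x) (simp_all add: tail_sum_Cons1)
qed

lemma sum_no_Hub:
  assumes "Hub \<notin> set F"
  shows "(\<Sum>G\<in>{G \<in> extensions False F. Hub \<notin> set G}. var ^ (starts F - starts G) * w (k + starts G)) =
    rim_sum k (starts F)"
  using assms
proof (induction F arbitrary: k)
  case (Cons x F)
  have le: "starts G \<le> starts F" if "G \<in> extensions h F" for G h
    using starts_extensions[OF that] by simp
  show ?case
  proof (cases x)
    case Cont
    then show ?thesis using Cons
      by (simp add: sum_extensions_Cons step_simps del: extensions.simps(2))
  next
    case Start
    let ?S = "{G \<in> extensions False F. Hub \<notin> set G}"
    have "(\<Sum>G\<in>{G \<in> extensions False (Start # F). Hub \<notin> set G}.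
          var ^ (starts (Start # F) - starts G) * w (k + starts G)) =
        (\<Sum>G\<in>?S. var ^ (starts F - starts G) * w (Suc k + starts G)) +
        (\<Sum>G\<in>?S. var ^ (Suc (starts F) - starts G) * w (k + starts G))"
      by (simp add: sum_extensions_Cons step_simps del: extensions.simps(2))
    also have "(\<Sum>G\<in>?S. var ^ (Suc (starts F) - starts G) * w (k + starts G)) =
        var * (\<Sum>G\<in>?S. var ^ (starts F - starts G) * w (k + starts G))"
      by (auto simp: sum_distrib_left Suc_diff_le[OF le] mult_ac intro!: sum.cong)
    also have "(\<Sum>G\<in>?S. var ^ (starts F - starts G) * w (k + starts G)) = rim_sum k (starts F)"
      using Cons.prems by (intro Cons.IH) auto
    also have "(\<Sum>G\<in>?S. var ^ (starts F - starts G) * w (Suc k + starts G)) = rim_sum (Suc k) (starts F)"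
      using Cons.prems by (intro Cons.IH) auto
    finally show ?thesis using Start by simp
  qed (use Cons in auto)
qed (simp cong: conj_cong)

end

section \<open>Sums over cyclic words\<close>

text \<open>The last term accounts for the rim as a single block, which has no \<open>Start\<close>
  to be counted by.\<close>

definition word_rank :: "letter list \<Rightarrow> nat" where
  "word_rank G = length G - starts G - (if Hub \<notin> set G \<and> starts G = 0 then 1 else 0)"

definition upward :: "letter list \<Rightarrow> letter list set" where
  "upward F = {G \<in> cyclic_extensions F. Hub \<notin> set G \<longrightarrow> starts G \<noteq> 1}"

lemma length_cyclic_extensions: "G \<in> cyclic_extensions F \<Longrightarrow> length G = length F"
  unfolding cyclic_extensions_iff by (rule length_extensions)

lemma Hub_split:
  assumes "Hub \<in> set G"
  shows "G = takeWhile (\<lambda>g. g \<noteq> Hub) G @ Hub # tl (dropWhile (\<lambda>g. g \<noteq> Hub) G)"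
    and "Hub \<notin> set (takeWhile (\<lambda>g. g \<noteq> Hub) G)"
proof -
  have ne: "dropWhile (\<lambda>g. g \<noteq> Hub) G \<noteq> []" using assms by (auto simp: dropWhile_eq_Nil_conv)
  then have "hd (dropWhile (\<lambda>g. g \<noteq> Hub) G) = Hub" using hd_dropWhile by blast
  then have "dropWhile (\<lambda>g. g \<noteq> Hub) G = Hub # tl (dropWhile (\<lambda>g. g \<noteq> Hub) G)"
    using ne by (metis list.collapse)
  then show "G = takeWhile (\<lambda>g. g \<noteq> Hub) G @ Hub # tl (dropWhile (\<lambda>g. g \<noteq> Hub) G)"
    by (metis takeWhile_dropWhile_id)
  show "Hub \<notin> set (takeWhile (\<lambda>g. g \<noteq> Hub) G)" using set_takeWhileD by fastforce
qed

lemma takeWhile_Hub: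
  assumes "Hub \<notin> set u"
  shows "takeWhile (\<lambda>g. g \<noteq> Hub) (u @ Hub # v) = u" "dropWhile (\<lambda>g. g \<noteq> Hub) (u @ Hub # v) = Hub # v"
proof -
  have "\<forall>x\<in>set u. x \<noteq> Hub" using assms by auto
  then show "takeWhile (\<lambda>g. g \<noteq> Hub) (u @ Hub # v) = u" "dropWhile (\<lambda>g. g \<noteq> Hub) (u @ Hub # v) = Hub # v"
    by (simp_all add: takeWhile_append2 dropWhile_append2)
qed

context block_weights
begin

text \<open>The first hub letter is an arbitrary choice of cut; by \<open>block_poly_Hub\<close> any
  other gives the same value.\<close>

definition block_poly :: "letter list \<Rightarrow> int poly" where
  "block_poly G = (if Hub \<notin> set G then (if starts G = 0 then 1 else w (starts G))
     else path_weight 0 (tl (dropWhile (\<lambda>g. g \<noteq> Hub) G) @ takeWhile (\<lambda>g. g \<noteq> Hub) G))"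

definition word_sum :: "letter list \<Rightarrow> int poly" where
  "word_sum F = (\<Sum>G\<in>upward F. var ^ (word_rank G - word_rank F) * block_poly G)"

definition hub_sum :: "letter list \<Rightarrow> int poly" where
  "hub_sum F = (\<Sum>G\<in>{G \<in> cyclic_extensions F. Hub \<in> set G}. var ^ (starts F - starts G) * block_poly G)"

text \<open>\<open>path_weight\<close> is a product over gaps, and cutting at another hub letter
  only permutes the gaps.\<close>

lemma block_poly_Hub: "block_poly (u @ Hub # v) = path_weight 0 (v @ u)"
proof (cases "Hub \<in> set u")
  case False
  then show ?thesis by (simp add: block_poly_def takeWhile_Hub)
next
  case True
  then obtain u0 u1 where u: "u = u0 @ Hub # u1" "Hub \<notin> set u0" by (meson split_list_first)
  then have "block_poly (u @ Hub # v) = path_weight 0 ((u1 @ Hub # v) @ u0)"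
    by (simp add: block_poly_def takeWhile_Hub)
  also have "\<dots> = path_weight 0 (v @ u)"
    using path_weight_Hub[of 0 u1 "v @ u0"] path_weight_Hub[of 0 "v @ u0" u1] by (simp add: u)
  finally show ?thesis .
qed

lemma block_poly_rotate:
  assumes "Hub \<in> set (G1 @ G2)"
  shows "block_poly (G1 @ G2) = block_poly (G2 @ G1)"
proof -
  have *: "block_poly (G1 @ G2) = block_poly (G2 @ G1)" if Hub: "Hub \<in> set G1" for G1 G2
  proof -
    obtain a b where "G1 = a @ Hub # b" using Hub by (meson split_list)
    then show ?thesis using block_poly_Hub[of a "b @ G2"] block_poly_Hub[of "G2 @ a" b] by simp
  qed
  show ?thesis using assms *[of G1 G2] *[of G2 G1] by auto
qed

text \<open>Allows the lower word to be turned until it begins with \<open>Start\<close>.\<close>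

lemma hub_sum_rotate: "hub_sum (F1 @ F2) = hub_sum (F2 @ F1)"
proof -
  let ?rot = "\<lambda>m G. drop m G @ take m G"
  have mem: "?rot (length F1) G \<in> {G \<in> cyclic_extensions (F2 @ F1). Hub \<in> set G}"
    "?rot (length F2) (?rot (length F1) G) = G"
    if "G \<in> {G \<in> cyclic_extensions (F1 @ F2). Hub \<in> set G}" for G F1 F2
  proof -
    have len: "length G = length F1 + length F2" using that length_cyclic_extensions by fastforce
    then show "?rot (length F2) (?rot (length F1) G) = G" by simp
    have "set (?rot (length F1) G) = set G" by (metis append_take_drop_id set_append sup_commute)
    then show "?rot (length F1) G \<in> {G \<in> cyclic_extensions (F2 @ F1). Hub \<in> set G}"
      using that cyclic_extensions_rotate[of "take (length F1) G" "drop (length F1) G" F1 F2] len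
      by simp
  qed
  show ?thesis
    unfolding hub_sum_def
  proof (rule sum.reindex_bij_witness[where i = "?rot (length F2)" and j = "?rot (length F1)"])
    fix G assume G: "G \<in> {G \<in> cyclic_extensions (F1 @ F2). Hub \<in> set G}"
    show "?rot (length F2) (?rot (length F1) G) = G"
      "?rot (length F1) G \<in> {G \<in> cyclic_extensions (F2 @ F1). Hub \<in> set G}"
      using mem[OF G] by auto
    have "block_poly (?rot (length F1) G) = block_poly G"
      using block_poly_rotate[of "take (length F1) G" "drop (length F1) G"] G by simp
    moreover have "starts (?rot (length F1) G) = starts G"
      by (metis add.commute append_take_drop_id count_list_append)
    ultimately show "var ^ (starts (F2 @ F1) - starts (?rot (length F1) G)) * block_poly (?rot (length F1) G) =
        var ^ (starts (F1 @ F2) - starts G) * block_poly G"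
      by (simp add: add.commute)
  next
    fix G assume G: "G \<in> {G \<in> cyclic_extensions (F2 @ F1). Hub \<in> set G}"
    show "?rot (length F1) (?rot (length F2) G) = G"
      "?rot (length F2) G \<in> {G \<in> cyclic_extensions (F1 @ F2). Hub \<in> set G}"
      using mem[OF G] by auto
  qed
qed

text \<open>The words with a hub letter are cut at the first one; since \<open>F\<close> begins with \<open>Start\<close>, that letter
  replaces a \<open>Start\<close>.\<close>

lemma hub_sum_tail_sum:
  assumes noHub: "Hub \<notin> set F" and hd: "F = Start # F'"
  shows "hub_sum F = (\<Sum>i\<in>{i. i < length F \<and> F ! i = Start}. var * tail_sum 0 (drop (Suc i) F) (take i F))"
proof -
  let ?I = "{i. i < length F \<and> F ! i = Start}"
  let ?tl = "\<lambda>i. drop (Suc i) F @ take i F"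
  let ?m = "\<lambda>i. length F - Suc i"
  let ?X = "\<lambda>i. {x \<in> extensions True (?tl i). Hub \<notin> set (drop (?m i) x)}"
  let ?S = "{G \<in> cyclic_extensions F. Hub \<in> set G}"
  let ?glue = "\<lambda>(i, x). drop (?m i) x @ Hub # take (?m i) x"
  let ?cut = "\<lambda>G. (length (takeWhile (\<lambda>g. g \<noteq> Hub) G),
    tl (dropWhile (\<lambda>g. g \<noteq> Hub) G) @ takeWhile (\<lambda>g. g \<noteq> Hub) G)"
  let ?s = "\<lambda>G. var ^ (starts F - starts G) * block_poly G"
  let ?s' = "\<lambda>(i, x). var * (var ^ (starts (?tl i) - starts x) * path_weight 0 x)"
  have splitF: "F = take i F @ F ! i # drop (Suc i) F" if "i < length F" for i
    using that by (rule id_take_nth_drop)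
  have "hub_sum F = sum ?s' (Sigma ?I ?X)"
    unfolding hub_sum_def
  proof (rule sum.reindex_bij_witness[where i = ?glue and j = ?cut])
    fix G assume G: "G \<in> ?S"
    define u v where "u = takeWhile (\<lambda>g. g \<noteq> Hub) G" and "v = tl (dropWhile (\<lambda>g. g \<noteq> Hub) G)"
    define i where "i = length u"
    have Guv: "G = u @ Hub # v" "Hub \<notin> set u"
      using Hub_split[of G] G by (auto simp: u_def v_def)
    have lenG: "length G = length F" using G length_cyclic_extensions by auto
    then have i: "i < length F" and lens: "length u = length (take i F)" "length v = length (drop (Suc i) F)"
      using Guv by (auto simp: i_def)
    have cut: "?cut G = (i, v @ u)" by (simp add: u_def v_def i_def)
    have m: "?m i = length v" using lens by simp
    show "?glue (?cut G) = G" unfolding cut using Guv m by simp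
    have "u @ Hub # v \<in> cyclic_extensions (take i F @ F ! i # drop (Suc i) F)"
      using G Guv(1) splitF[OF i] by simp
    then have st: "step (if u = [] then last (Hub # v) = Hub else last u = Hub) (F ! i) Hub"
      and ext: "v @ u \<in> extensions True (?tl i)"
      unfolding cyclic_extensions_Hub[OF lens] by auto
    \<comment> \<open>The letter below the first hub letter must be \<open>Start\<close>, because
      \<open>Cont\<close> rises to \<open>Hub\<close> only behind a hub letter. At
      \<open>i = 0\<close> the predecessor is the last letter, possibly \<open>Hub\<close>; there
      the assumption that \<open>F\<close> begins with \<open>Start\<close> decides.\<close>
    have "F ! i \<noteq> Hub" using noHub i nth_mem by metis
    moreover have "F ! i = Start" if "u = []" using that hd by (simp add: i_def)
    moreover have "F ! i \<noteq> Cont" if "u \<noteq> []"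
    proof -
      have "last u \<noteq> Hub" using that Guv(2) last_in_set by metis
      then show ?thesis using st that by (auto simp: step_def)
    qed
    ultimately have Fi: "F ! i = Start" by (metis letter.exhaust)
    show "?cut G \<in> Sigma ?I ?X" unfolding cut using i Fi ext Guv(2) m by simp
    have "starts F = Suc (starts (?tl i))"
      by (subst splitF[OF i]) (simp add: Fi)
    moreover have "starts (v @ u) \<le> starts (?tl i)" using ext by (rule starts_extensions)
    moreover have "starts G = starts (v @ u)" using Guv by simp
    ultimately have "starts F - starts G = Suc (starts (?tl i) - starts (v @ u))" by simp
    then show "?s' (?cut G) = ?s G" unfolding cut by (simp add: Guv(1) block_poly_Hub mult.assoc)
  next
    fix p assume "p \<in> Sigma ?I ?X"
    then obtain i x where p: "p = (i, x)" and i: "i < length F" "F ! i = Start"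
      and x: "x \<in> extensions True (?tl i)" "Hub \<notin> set (drop (?m i) x)" by auto
    define u v where "u = drop (?m i) x" and "v = take (?m i) x"
    have "length x = length F - 1" using length_extensions[OF x(1)] i by simp
    then have lens: "length u = length (take i F)" "length v = length (drop (Suc i) F)"
      using i by (auto simp: u_def v_def)
    have glue: "?glue p = u @ Hub # v" by (simp add: p u_def v_def)
    have Hu: "Hub \<notin> set u" using x(2) by (simp add: u_def)
    have vu: "v @ u = x" by (simp add: u_def v_def)
    show "?cut (?glue p) = p"
      unfolding glue using lens i vu by (simp add: takeWhile_Hub[OF Hu] p)
    have "u @ Hub # v \<in> cyclic_extensions (take i F @ Start # drop (Suc i) F)"
      unfolding cyclic_extensions_Hub[OF lens] vu using x(1) by (simp add: step_def)
    then show "?glue p \<in> ?S" unfolding glue using splitF[OF i(1)] i(2) by simp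
  qed
  also have "\<dots> = (\<Sum>i\<in>?I. \<Sum>x\<in>?X i. ?s' (i, x))"
    by (subst sum.Sigma) (auto simp: finite_extensions)
  also have "\<dots> = (\<Sum>i\<in>?I. var * tail_sum 0 (drop (Suc i) F) (take i F))"
    by (intro sum.cong refl) (simp add: tail_sum_def sum_distrib_left)
  finally show ?thesis .
qed

lemma hub_sum_eq:
  assumes "Hub \<notin> set F" "starts F > 0"
  shows "hub_sum F = var * (\<Sum>a<starts F. fan_sum a 0 (starts F - 1 - a))"
proof -
  have "Start \<in> set F" using assms(2) by (metis count_list_0_iff less_irrefl)
  then obtain F1 F2 where F: "F = F1 @ Start # F2" by (meson split_list)
  let ?F = "Start # F2 @ F1"
  have noHub: "Hub \<notin> set ?F" using assms F by auto
  have "hub_sum F = hub_sum ?F" using hub_sum_rotate[of F1 "Start # F2"] F by simp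
  also have "\<dots> = (\<Sum>i\<in>{i. i < length ?F \<and> ?F ! i = Start}. var * tail_sum 0 (drop (Suc i) ?F) (take i ?F))"
    using noHub by (rule hub_sum_tail_sum) simp
  also have "\<dots> = (\<Sum>i\<in>{i. i < length ?F \<and> ?F ! i = Start}.
      var * fan_sum (starts (take i ?F)) 0 (starts (drop (Suc i) ?F)))"
  proof (intro sum.cong refl arg_cong2[of _ _ _ _ "(*)"] tail_sum_eq_fan_sum)
    fix i
    show "Hub \<notin> set (drop (Suc i) ?F)" "Hub \<notin> set (take i ?F)"
      using noHub set_drop_subset set_take_subset by fast+
    show "take i ?F = [] \<or> hd (take i ?F) = Start" by (cases i) auto
  qed
  also have "\<dots> = (\<Sum>a<starts ?F. var * fan_sum a 0 (starts ?F - 1 - a))"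
    by (rule sum_over_starts)
  also have "starts ?F = starts F" by (simp add: F)
  finally show ?thesis by (simp add: sum_distrib_left)
qed

text \<open>Only the number k of blocks enters: contracting a hub-free flat gives, up to parallel
  edges, the wheel with k spokes, or the triangle for k = 2.\<close>

lemma word_sum_wheel:
  assumes noHub: "Hub \<notin> set F" and two: "starts F \<ge> 2"
  shows "word_sum F = wheel_sum (starts F)"
proof -
  let ?k = "starts F" and ?s = "\<lambda>G. var ^ (word_rank G - word_rank F) * block_poly G"
  let ?N = "{G \<in> extensions False F. Hub \<notin> set G}"
  have ne: "F \<noteq> []" using two by auto
  have k_le: "?k \<le> length F" by (rule count_le_length)
  have rankF: "word_rank F = length F - ?k" using two by (simp add: word_rank_def)
  have split: "upward F = {G \<in> cyclic_extensions F. Hub \<in> set G} \<union> {G \<in> ?N. starts G \<noteq> 1}"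
    unfolding cyclic_extensions_no_Hub[OF ne, symmetric] by (auto simp: upward_def)
  have fin: "finite ?N" by (simp add: finite_extensions)
  have "word_sum F = sum ?s {G \<in> cyclic_extensions F. Hub \<in> set G} + sum ?s {G \<in> ?N. starts G \<noteq> 1}"
    unfolding word_sum_def split
    by (rule sum.union_disjoint) (auto simp: finite_cyclic_extensions finite_extensions)
  also have "sum ?s {G \<in> cyclic_extensions F. Hub \<in> set G} = hub_sum F"
    unfolding hub_sum_def
  proof (intro sum.cong refl arg_cong2[of _ _ _ _ "(*)"] arg_cong2[of _ _ _ _ "(^)"])
    fix G assume G: "G \<in> {G \<in> cyclic_extensions F. Hub \<in> set G}"
    then have "starts G \<le> ?k" "length G = length F"
      using starts_extensions length_extensions unfolding cyclic_extensions_iff by blast+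
    moreover from this have "word_rank G = length F - starts G"
      using G by (simp add: word_rank_def)
    ultimately show "word_rank G - word_rank F = ?k - starts G"
      using k_le by (simp add: rankF)
  qed
  also have "sum ?s {G \<in> ?N. starts G \<noteq> 1} = rim_sum 0 ?k + var ^ (?k - 1)"
  proof -
    let ?C = "replicate (length F) Cont"
    have C: "?C \<in> ?N" using noHub
    proof (induction F)
      case (Cons x F)
      then show ?case
        by (cases x) (auto simp: Cons_in_extensions step_def simp del: extensions.simps(2))
    qed simp
    have uniq: "G = ?C" if "G \<in> ?N" "starts G = 0" for G
    proof -
      have "Start \<notin> set G" using that(2) by (simp add: count_list_0_iff)
      then have "x = Cont" if "x \<in> set G" for x
        using that \<open>G \<in> ?N\<close> by (cases x) auto
      then have "G = replicate (length G) Cont" by (metis replicate_length_same)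
      then show ?thesis using that(1) length_extensions by auto
    qed
    \<comment> \<open>The value of the word \<open>?C\<close> is added as an extra summand, since
      its regular one vanishes by \<open>w 0 = 0\<close>.\<close>
    have "sum ?s {G \<in> ?N. starts G \<noteq> 1} =
        (\<Sum>G\<in>{G \<in> ?N. starts G \<noteq> 1}. var ^ (?k - starts G) * w (starts G) +
          (if G = ?C then var ^ (?k - 1) else 0))"
    proof (intro sum.cong refl)
      fix G assume G: "G \<in> {G \<in> ?N. starts G \<noteq> 1}"
      then have le: "starts G \<le> ?k" and len: "length G = length F"
        using starts_extensions length_extensions by blast+
      show "?s G = var ^ (?k - starts G) * w (starts G) + (if G = ?C then var ^ (?k - 1) else 0)"
      proof (cases "starts G = 0")
        case True
        then have "G = ?C" using uniq G by blast
        moreover have "word_rank G - word_rank F = ?k - 1"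
          using True G len k_le two by (simp add: word_rank_def rankF)
        ultimately show ?thesis using True G by (simp add: block_poly_def)
      next
        case False
        moreover from False have "G \<noteq> ?C" by auto
        moreover have "word_rank G - word_rank F = ?k - starts G"
          using False G len k_le le by (simp add: word_rank_def rankF)
        ultimately show ?thesis using G by (simp add: block_poly_def)
      qed
    qed
    also have "\<dots> = (\<Sum>G\<in>{G \<in> ?N. starts G \<noteq> 1}. var ^ (?k - starts G) * w (starts G)) + var ^ (?k - 1)"
    proof -
      have "?C \<in> {G \<in> ?N. starts G \<noteq> 1}" using C by simp
      moreover have "finite {G \<in> ?N. starts G \<noteq> 1}" by (simp add: finite_extensions)
      ultimately show ?thesis unfolding sum.distrib by (simp only: sum.delta if_True)
    qed
    also have "(\<Sum>G\<in>{G \<in> ?N. starts G \<noteq> 1}. var ^ (?k - starts G) * w (starts G)) =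
        (\<Sum>G\<in>?N. var ^ (?k - starts G) * w (starts G))"
      using fin by (intro sum.mono_neutral_left) auto
    also have "\<dots> = rim_sum 0 ?k" using sum_no_Hub[OF noHub, of 0] by simp
    finally show ?thesis .
  qed
  finally show ?thesis
    using hub_sum_eq[OF noHub] two by (simp add: wheel_sum_def add.assoc)
qed

text \<open>Above the full rim there is only the whole ground set, one rank higher.\<close>

lemma word_sum_rim:
  assumes "Hub \<notin> set F" "starts F = 0" "F \<noteq> []"
  shows "word_sum F = 1 + var"
proof -
  let ?n = "length F"
  have "Start \<notin> set F" using assms(2) by (simp add: count_list_0_iff)
  then have "x = Cont" if "x \<in> set F" for x
    using that assms(1) by (cases x) auto
  then have F: "F = replicate ?n Cont" by (metis replicate_length_same)
  have ext: "extensions h (replicate m Cont) = {replicate m (if h then Hub else Cont)}" for h m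
    by (induction m arbitrary: h) (auto simp: step_simps)
  have "upward F = {F, replicate ?n Hub}"
  proof -
    have ne: "replicate ?n x \<noteq> []" for x :: letter using assms by simp
    have "cyclic_extensions (replicate ?n Cont) = {replicate ?n Cont, replicate ?n Hub}"
      using ne by (auto simp: cyclic_extensions_iff ext last_replicate split: if_splits)
    then show ?thesis using F[symmetric] assms by (auto simp: upward_def)
  qed
  moreover have "F \<noteq> replicate ?n Hub" using assms F by (metis in_set_replicate length_0_conv)
  moreover have "block_poly (replicate ?n Hub) = 1"
  proof -
    have "replicate ?n Hub = [] @ Hub # replicate (?n - 1) Hub" using assms by (cases F) auto
    then show ?thesis using block_poly_Hub[of "[]"] path_weight_replicate_Hub by simp
  qed
  moreover have "block_poly F = 1" using assms by (simp add: block_poly_def)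
  moreover have "word_rank F = ?n - 1" "word_rank (replicate ?n Hub) = ?n"
    using assms by (auto simp: word_rank_def)
  moreover have "?n - (?n - 1) = 1" using assms by (cases F) auto
  ultimately show ?thesis by (simp add: word_sum_def)
qed

text \<open>The hub letter persists above \<open>F\<close>, so all words of the sum can be cut at
  the same place.\<close>

lemma word_sum_Hub: "word_sum (F1 @ Hub # F2) = tail_sum 0 (F2 @ F1) []"
proof -
  let ?F = "F1 @ Hub # F2"
  let ?glue = "\<lambda>x. drop (length F2) x @ Hub # take (length F2) x"
  have inj: "inj_on ?glue (extensions True (F2 @ F1))"
  proof (rule inj_onI)
    fix x y assume "x \<in> extensions True (F2 @ F1)" "y \<in> extensions True (F2 @ F1)" and eq: "?glue x = ?glue y"
    then have "length x = length y" by (simp add: length_extensions[of _ True "F2 @ F1"])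
    then have "drop (length F2) x = drop (length F2) y" "take (length F2) x = take (length F2) y"
      using eq by (auto simp: append_eq_append_conv)
    then show "x = y" by (metis append_take_drop_id)
  qed
  have mem: "?glue x \<in> cyclic_extensions ?F \<longleftrightarrow> x \<in> extensions True (F2 @ F1)"
    if "length x = length F1 + length F2" for x
  proof -
    have "length (drop (length F2) x) = length F1" "length (take (length F2) x) = length F2"
      using that by auto
    from cyclic_extensions_Hub[OF this] show ?thesis by (simp add: step_def)
  qed
  have upward: "upward ?F = ?glue ` extensions True (F2 @ F1)"
  proof (intro equalityI subsetI)
    fix G assume "G \<in> upward ?F"
    then have G: "G \<in> cyclic_extensions ?F" by (simp add: upward_def)
    define u v where "u = take (length F1) G" and "v = drop (Suc (length F1)) G"
    have len: "length G = length F1 + Suc (length F2)" using length_cyclic_extensions[OF G] by simp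
    then have split: "G = u @ G ! length F1 # v" unfolding u_def v_def
      by (intro id_take_nth_drop) simp
    have lens: "length u = length F1" "length v = length F2" using len by (auto simp: u_def v_def)
    have "step (if u = [] then last G = Hub else last u = Hub) Hub (G ! length F1)"
      using G split append_in_extensions[OF lens(1), of "G ! length F1 # v" "last G = Hub" "Hub # F2"]
      unfolding cyclic_extensions_iff Cons_in_extensions by metis
    then have "G ! length F1 = Hub" by (simp add: step_def)
    then have glue: "G = ?glue (v @ u)" using split lens by simp
    then have "v @ u \<in> extensions True (F2 @ F1)" using mem[of "v @ u"] G lens by simp
    then show "G \<in> ?glue ` extensions True (F2 @ F1)" using glue by blast
  next
    fix G assume "G \<in> ?glue ` extensions True (F2 @ F1)"
    then obtain x where x: "x \<in> extensions True (F2 @ F1)" "G = ?glue x" by blast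
    then have "G \<in> cyclic_extensions ?F" using mem[of x] length_extensions[OF x(1)] by simp
    then show "G \<in> upward ?F" using x(2) by (simp add: upward_def)
  qed
  have "word_sum ?F = (\<Sum>x\<in>extensions True (F2 @ F1).
      var ^ (word_rank (?glue x) - word_rank ?F) * block_poly (?glue x))"
    unfolding word_sum_def upward by (simp add: sum.reindex[OF inj])
  also have "\<dots> = (\<Sum>x\<in>extensions True (F2 @ F1). var ^ (starts (F2 @ F1) - starts x) * path_weight 0 x)"
  proof (intro sum.cong refl)
    fix x assume x: "x \<in> extensions True (F2 @ F1)"
    have len: "length x = length F1 + length F2" using length_extensions[OF x] by simp
    have "starts x = starts (take (length F2) x) + starts (drop (length F2) x)"
      by (metis append_take_drop_id count_list_append)
    then have "word_rank (?glue x) = Suc (length F1 + length F2) - starts x"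
      using len by (simp add: word_rank_def add.commute)
    moreover have "word_rank ?F = Suc (length F1 + length F2) - starts (F2 @ F1)"
      by (simp add: word_rank_def add.commute)
    moreover have "starts x \<le> starts (F2 @ F1)" "starts (F2 @ F1) \<le> length (F2 @ F1)"
      using starts_extensions[OF x] count_le_length[of "F2 @ F1" Start] by auto
    ultimately have "word_rank (?glue x) - word_rank ?F = starts (F2 @ F1) - starts x" by simp
    then show "var ^ (word_rank (?glue x) - word_rank ?F) * block_poly (?glue x) =
        var ^ (starts (F2 @ F1) - starts x) * path_weight 0 x"
      by (simp add: block_poly_Hub)
  qed
  finally show ?thesis by (simp add: tail_sum_Nil)
qed

end

section \<open>Palindromicity and degree bounds for word sums\<close>

locale palindromic_weights = block_weights +
  assumes degree_f: "k > 0 \<Longrightarrow> 2 * degree (f k) < k"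
    and degree_w: "k \<ge> 2 \<Longrightarrow> 2 * degree (w k) < k"
    and fan_palindromic: "palindromic m (fan_sum 0 0 m)"
    and wheel_palindromic: "k \<ge> 2 \<Longrightarrow> palindromic k (wheel_sum k)"
begin

text \<open>Hub letters of \<open>F\<close> split the sum into a product; a piece without them is a
  fan.\<close>

lemma tail_sum_palindromic: "palindromic (starts F) (tail_sum 0 F [])"
proof (induction "length F" arbitrary: F rule: less_induct)
  case less
  show ?case
  proof (cases "Hub \<in> set F")
    case True
    then obtain F1 F2 where F: "F = F1 @ Hub # F2" by (meson split_list)
    have "palindromic (starts F1) (tail_sum 0 F1 [])" "palindromic (starts F2) (tail_sum 0 F2 [])"
      by (rule less; simp add: F)+
    then show ?thesis using palindromic_mult by (simp add: F tail_sum_Hub)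
  next
    case False
    then show ?thesis using fan_palindromic by (simp add: tail_sum_eq_fan_sum)
  qed
qed

lemma word_sum_palindromic:
  assumes "F \<noteq> []" "Hub \<notin> set F \<Longrightarrow> starts F \<noteq> 1"
  shows "palindromic (length F - word_rank F) (word_sum F)"
proof -
  have le: "starts F \<le> length F" by (rule count_le_length)
  consider "Hub \<in> set F" | "Hub \<notin> set F" "starts F = 0" | "Hub \<notin> set F" "starts F \<ge> 2"
    using assms(2) by fastforce
  then show ?thesis
  proof cases
    case 1
    then obtain F1 F2 where F: "F = F1 @ Hub # F2" by (meson split_list)
    have "length F - word_rank F = starts (F2 @ F1)"
      using le by (simp add: F word_rank_def)
    then show ?thesis using tail_sum_palindromic[of "F2 @ F1"] by (simp add: F word_sum_Hub)
  next
    case 2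
    then have "length F - word_rank F = 1" using assms(1) by (cases F) (auto simp: word_rank_def)
    then show ?thesis using 2 assms(1) palindromic_one_var by (simp add: word_sum_rim)
  next
    case 3
    then have "length F - word_rank F = starts F" using le by (simp add: word_rank_def)
    then show ?thesis using 3 wheel_palindromic by (simp add: word_sum_wheel)
  qed
qed

text \<open>The weak bound covers the empty gaps, whose factor is 1; a strict bound in one nonempty
  gap then suffices for the product.\<close>

lemma degree_path_weight:
  "2 * degree (path_weight k G) \<le> k + starts G \<and>
    (k + starts G > 0 \<longrightarrow> 2 * degree (path_weight k G) < k + starts G)"
proof (induction k G rule: path_weight.induct)
  case (1 k)
  then show ?case using degree_f[of k] by (cases "k = 0") auto
next
  case (2 k G)
  have "degree (f k * path_weight 0 G) \<le> degree (f k) + degree (path_weight 0 G)"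
    by (rule degree_mult_le)
  then show ?case using 2 degree_f[of k] by (cases "k = 0") auto
qed auto

lemma degree_block_poly:
  assumes G: "G \<in> cyclic_extensions F" and ne: "G \<noteq> []" and valid: "Hub \<notin> set G \<Longrightarrow> starts G \<noteq> 1"
    and top: "G \<noteq> replicate (length G) Hub"
  shows "2 * degree (block_poly G) < length G - word_rank G"
proof (cases "Hub \<in> set G")
  case True
  then obtain u v where Guv: "G = u @ Hub # v" by (meson split_list)
  have le: "starts G \<le> length G" by (rule count_le_length)
  have "length F = length u + Suc (length v)" using length_cyclic_extensions[OF G] Guv by simp
  then have F: "F = take (length u) F @ F ! length u # drop (Suc (length u)) F"
    and lens: "length u = length (take (length u) F)" "length v = length (drop (Suc (length u)) F)"
    by (auto intro: id_take_nth_drop)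
  have ext: "v @ u \<in> extensions True (drop (Suc (length u)) F @ take (length u) F)"
    using cyclic_extensions_Hub[OF lens, of "F ! length u"] G F Guv by simp
  \<comment> \<open>Behind a hub letter \<open>Cont\<close> is impossible, so without any
    \<open>Start\<close> all letters would be \<open>Hub\<close>, which is the excluded top
    word.\<close>
  have "starts (v @ u) > 0"
  proof (rule ccontr)
    assume "\<not> ?thesis"
    then have "v @ u = replicate (length u + length v) Hub"
      using extensions_no_starts[OF ext] lens by simp
    then have "set (v @ u) \<subseteq> {Hub}" by (metis set_replicate_conv_if empty_subsetI order_refl)
    then have "\<forall>g\<in>set G. g = Hub" by (auto simp: Guv)
    then show False using top by (metis replicate_length_same)
  qed
  then have "2 * degree (path_weight 0 (v @ u)) < starts (v @ u)" using degree_path_weight[of 0 "v @ u"] by simp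
  moreover have "length G - word_rank G = starts (v @ u)" using le by (simp add: Guv word_rank_def)
  ultimately show ?thesis by (simp add: Guv block_poly_Hub)
next
  case False
  have le: "starts G \<le> length G" by (rule count_le_length)
  show ?thesis
  proof (cases "starts G = 0")
    case True
    then show ?thesis using False ne by (cases G) (auto simp: block_poly_def word_rank_def)
  next
    case nz: False
    then have "starts G \<ge> 2" using valid False by fastforce
    then show ?thesis using False nz le degree_w[of "starts G"] by (simp add: block_poly_def word_rank_def)
  qed
qed

end

section \<open>Generating functions\<close>

unbundle fps_syntax

abbreviation T :: "int poly fps" where
  "T \<equiv> fps_const var"

abbreviation X :: "int poly fps" where
  "X \<equiv> fps_X"

lemma eq_mult_inverse:
  fixes a b x y :: "'a :: comm_ring_1"
  assumes "x * b = y" "a * b = 1"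
  shows "x = y * a"
proof -
  have "y * a = x * (a * b)" unfolding assms(1)[symmetric] by (simp only: mult_ac)
  then show ?thesis using assms(2) by simp
qed

text \<open>The series 1 / (1 - A) for \<open>A\<close> without constant term: the constant term 1
  is a unit, so the inverse exists over \<open>int poly\<close>.\<close>

definition geometric :: "'a::comm_ring_1 fps \<Rightarrow> 'a fps" where
  "geometric A = fps_right_inverse (1 - A) 1"

lemma geometric:
  assumes "A $ 0 = 0"
  shows "geometric A * (1 - A) = 1"
  using fps_right_inverse[of "1 - A" 1] assms by (simp add: geometric_def mult.commute)

lemma geometric_rec:
  assumes "A $ 0 = 0"
  shows "geometric A = 1 + A * geometric A"
  using geometric[OF assms] by (simp add: algebra_simps)

lemma geometric_nth_0:
  assumes "A $ 0 = 0"
  shows "geometric A $ 0 = 1"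
  using assms by (subst geometric_rec) auto

text \<open>The weak bound is closed under products, and strict bounds are recovered from an
  additional factor \<open>X\<close>.\<close>

definition half_bounded :: "int poly fps \<Rightarrow> bool" where
  "half_bounded A \<longleftrightarrow> (\<forall>n. 2 * degree (A $ n) \<le> n)"

definition palindromic_fps :: "int poly fps \<Rightarrow> bool" where
  "palindromic_fps A \<longleftrightarrow> (\<forall>n. palindromic n (A $ n))"

lemma half_bounded_add: "half_bounded A \<Longrightarrow> half_bounded B \<Longrightarrow> half_bounded (A + B)"
  and half_bounded_diff: "half_bounded A \<Longrightarrow> half_bounded B \<Longrightarrow> half_bounded (A - B)"
proof -
  assume *: "half_bounded A" "half_bounded B"
  have "2 * degree (A $ n + B $ n) \<le> n" "2 * degree (A $ n - B $ n) \<le> n" for n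
    using * degree_add_le_max[of "A $ n" "B $ n"] degree_diff_le_max[of "A $ n" "B $ n"]
    unfolding half_bounded_def by (metis le_max_iff_disj mult_le_mono2 order.trans)+
  then show "half_bounded (A + B)" "half_bounded (A - B)" by (simp_all add: half_bounded_def)
qed

text \<open>The alternative \<open>A $ i = 0\<close> serves recursions such as B = 1 + A B with
  \<open>A $ 0 = 0\<close>, where the bound on B is known only below n.\<close>

lemma degree_sum_mult_le:
  assumes "\<And>i. i \<le> n \<Longrightarrow> 2 * degree (A $ i) \<le> i" "\<And>i. i \<le> n \<Longrightarrow> A $ i = 0 \<or> 2 * degree (B $ (n - i)) \<le> n - i"
  shows "2 * degree ((A * B) $ n) \<le> n"
proof -
  have "degree ((A * B) $ n) \<le> n div 2"
    unfolding fps_mult_nth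
  proof (rule degree_sum_le)
    fix i assume i: "i \<in> {0..n}"
    show "degree (A $ i * B $ (n - i)) \<le> n div 2"
    proof (cases "A $ i = 0")
      case False
      have "degree (A $ i * B $ (n - i)) \<le> degree (A $ i) + degree (B $ (n - i))" by (rule degree_mult_le)
      moreover have "2 * degree (A $ i) \<le> i" "2 * degree (B $ (n - i)) \<le> n - i"
        using assms i False by auto
      ultimately show ?thesis using i by auto
    qed simp
  qed simp
  then show ?thesis by simp
qed

lemma half_bounded_mult: "half_bounded A \<Longrightarrow> half_bounded B \<Longrightarrow> half_bounded (A * B)"
  unfolding half_bounded_def using degree_sum_mult_le[of _ A B] by blast

lemma half_bounded_X: "half_bounded X"
  by (simp add: half_bounded_def fps_X_nth)

lemma half_bounded_1: "half_bounded 1"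
  by (simp add: half_bounded_def)

lemma degree_var_mult_le: "degree (var * p) \<le> Suc (degree p)"
  using degree_mult_le[of var p] by (simp add: var_def)

lemma half_bounded_TXX: "half_bounded (T * X ^ 2)"
  by (simp add: half_bounded_def fps_X_power_iff var_def)

lemma half_bounded_geometric:
  assumes "half_bounded A" "A $ 0 = 0"
  shows "half_bounded (geometric A)"
  unfolding half_bounded_def
proof
  fix n
  show "2 * degree (geometric A $ n) \<le> n"
  proof (induction n rule: less_induct)
    case (less n)
    show ?case
    proof (cases "n = 0")
      case False
      have "geometric A $ n = (A * geometric A) $ n"
        using False by (subst geometric_rec[OF assms(2)]) simp
      moreover have "2 * degree ((A * geometric A) $ n) \<le> n"
      proof (rule degree_sum_mult_le)
        fix i assume "i \<le> n"
        show "2 * degree (A $ i) \<le> i" using assms(1) by (simp add: half_bounded_def)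
        show "A $ i = 0 \<or> 2 * degree (geometric A $ (n - i)) \<le> n - i"
          using less[of "n - i"] False assms(2) by (cases "i = 0") auto
      qed
      ultimately show ?thesis by simp
    qed (simp add: geometric_nth_0[OF assms(2)])
  qed
qed

lemma palindromic_mult_nth:
  assumes "\<And>i. i \<le> n \<Longrightarrow> palindromic i (A $ i)" "\<And>i. i \<le> n \<Longrightarrow> A $ i = 0 \<or> palindromic (n - i) (B $ (n - i))"
  shows "palindromic n ((A * B) $ n)"
  unfolding fps_mult_nth
proof (rule palindromic_sum)
  fix i assume i: "i \<in> {0..n}"
  show "palindromic n (A $ i * B $ (n - i))"
  proof (cases "A $ i = 0")
    case False
    then have "palindromic (i + (n - i)) (A $ i * B $ (n - i))"
      using assms i by (intro palindromic_mult) auto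
    then show ?thesis using i by simp
  qed simp
qed

lemma palindromic_fps_mult: "palindromic_fps A \<Longrightarrow> palindromic_fps B \<Longrightarrow> palindromic_fps (A * B)"
  unfolding palindromic_fps_def using palindromic_mult_nth[of _ A B] by blast

lemma palindromic_fps_add: "palindromic_fps A \<Longrightarrow> palindromic_fps B \<Longrightarrow> palindromic_fps (A + B)"
  and palindromic_fps_diff: "palindromic_fps A \<Longrightarrow> palindromic_fps B \<Longrightarrow> palindromic_fps (A - B)"
  by (simp_all add: palindromic_fps_def palindromic_add palindromic_diff)

lemma palindromic_var: "palindromic 2 var"
  by (simp add: palindromic_def flip_poly_def reflect_poly_def var_def monom_altdef)

lemma palindromic_1: "palindromic 0 1"
  by (simp add: palindromic_def flip_poly_def)

lemma palindromic_fps_q: "palindromic_fps ((1 + T) * X)"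
proof -
  have "palindromic n (((1 + T) * X) $ n)" for n
    using palindromic_one_var by (cases "n = 1") (auto simp: fps_X_nth distrib_right)
  then show ?thesis by (simp add: palindromic_fps_def)
qed

lemma palindromic_fps_p: "palindromic_fps (T * X ^ 2)"
  using palindromic_var by (simp add: palindromic_fps_def fps_X_power_iff)

lemma palindromic_fps_1: "palindromic_fps 1"
  using palindromic_1 by (simp add: palindromic_fps_def)

lemma palindromic_fps_geometric:
  assumes "palindromic_fps A" "A $ 0 = 0"
  shows "palindromic_fps (geometric A)"
  unfolding palindromic_fps_def
proof
  fix n
  show "palindromic n (geometric A $ n)"
  proof (induction n rule: less_induct)
    case (less n)
    show ?case
    proof (cases "n = 0")
      case False
      have "geometric A $ n = (A * geometric A) $ n"
        using False by (subst geometric_rec[OF assms(2)]) simp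
      moreover have "palindromic n ((A * geometric A) $ n)"
      proof (rule palindromic_mult_nth)
        fix i assume "i \<le> n"
        show "palindromic i (A $ i)" using assms(1) by (simp add: palindromic_fps_def)
        show "A $ i = 0 \<or> palindromic (n - i) (geometric A $ (n - i))"
          using less[of "n - i"] False assms(2) by (cases "i = 0") auto
      qed
      ultimately show ?thesis by simp
    qed (simp add: geometric_nth_0[OF assms(2)] palindromic_1)
  qed
qed

text \<open>Kazhdan--Lusztig polynomials of fans, found by inverting the expected formula for their
  \<open>Z\<close>-polynomials (Narayana polynomials). The fan with no rim vertex has
  polynomial \<open>1\<close>, but gets the value \<open>0\<close> here.\<close>

function fan_poly :: "nat \<Rightarrow> int poly" where
  "fan_poly 0 = 0"
| "fan_poly (Suc n) = (if n = 0 then 1 else 0) + fan_poly n +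
     var * (\<Sum>i\<in>{0..n}. fan_poly i * fan_poly (n - i))"
  by pat_completeness auto
termination by (relation "measure id") auto

definition fan_fps :: "int poly fps" where
  "fan_fps = Abs_fps fan_poly"

lemma fan_fps_0 [simp]: "fan_fps $ 0 = 0"
  by (simp add: fan_fps_def)

lemma fan_fps_eq: "fan_fps = X + X * fan_fps + T * X * fan_fps\<^sup>2"
proof (rule fps_ext)
  fix n
  have nth: "fan_fps $ m = fan_poly m" for m by (simp add: fan_fps_def)
  have "(fan_fps\<^sup>2) $ m = (\<Sum>i\<in>{0..m}. fan_poly i * fan_poly (m - i))" for m
    by (simp add: power2_eq_square fps_mult_nth nth)
  then show "fan_fps $ n = (X + X * fan_fps + T * X * fan_fps\<^sup>2) $ n"
    by (cases n) (simp_all add: nth mult.assoc fps_X_nth)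
qed

text \<open>Both factors of a product satisfy the bound strictly, which saves two in twice the
  degree; the factor \<open>var\<close> spends exactly these two.\<close>

lemma degree_fan_poly: "n > 0 \<Longrightarrow> 2 * degree (fan_poly n) < n"
proof (induction n rule: less_induct)
  case (less n)
  then obtain m where m: "n = Suc m" by (cases n) auto
  have d0: "2 * degree (fan_poly m) \<le> m" using less.IH[of m] m by (cases "m = 0") auto
  have "degree (\<Sum>i\<in>{0..m}. fan_poly i * fan_poly (m - i)) \<le> (m - 2) div 2"
  proof (rule degree_sum_le)
    fix i assume i: "i \<in> {0..m}"
    show "degree (fan_poly i * fan_poly (m - i)) \<le> (m - 2) div 2"
    proof (cases "i = 0 \<or> i = m")
      case False
      then have "2 * degree (fan_poly i) < i" "2 * degree (fan_poly (m - i)) < m - i"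
        using i m by (auto intro!: less.IH)
      then show ?thesis using degree_mult_le[of "fan_poly i" "fan_poly (m - i)"] i by linarith
    qed auto
  qed simp
  \<comment> \<open>For \<open>m < 2\<close> the subtraction in \<open>m - 2\<close> is truncated;
    there every product contains \<open>fan_poly 0 = 0\<close>.\<close>
  moreover have "(\<Sum>i\<in>{0..m}. fan_poly i * fan_poly (m - i)) = 0" if "m < 2"
  proof (rule sum.neutral)
    show "\<forall>i\<in>{0..m}. fan_poly i * fan_poly (m - i) = 0" using that by (auto simp: less_2_cases_iff le_Suc_eq)
  qed
  ultimately have "2 * degree (var * (\<Sum>i\<in>{0..m}. fan_poly i * fan_poly (m - i))) \<le> m"
    using degree_var_mult_le[of "\<Sum>i\<in>{0..m}. fan_poly i * fan_poly (m - i)"]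
    by (cases "m < 2") auto
  moreover have "2 * degree ((if m = 0 then 1 else 0) + fan_poly m) \<le> m" using d0 by (cases "m = 0") auto
  ultimately have "degree (fan_poly n) \<le> m div 2"
    unfolding m fan_poly.simps by (intro degree_add_le[of _ _ "var * _"]) linarith+
  then show ?case using m by linarith
qed

text \<open>Here \<open>X\<close> plays the part of v. The expression is the one forced by
  \<open>wheel_Z_eq\<close>, solved for the wheel series.\<close>

definition wheel_fps :: "int poly fps" where
  "wheel_fps = X * (geometric (T * X * fan_fps) *
     (geometric (X + 2 * T * X * fan_fps) - 1 - T * fan_fps\<^sup>2))"

text \<open>With \<open>fan_fps = X * M\<close> the series t v H and t H^2 become t v^2 M and t v^2
  M^2, so everything inside the outer factor \<open>X\<close> is half-bounded, and that factor makes
  the bound strict.\<close>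

lemma degree_wheel_fps:
  assumes "n > 0"
  shows "2 * degree (wheel_fps $ n) < n"
proof -
  define M where "M = Abs_fps (\<lambda>n. fan_poly (Suc n))"
  have fan: "fan_fps = X * M"
  proof (rule fps_ext)
    fix n
    show "fan_fps $ n = (X * M) $ n"
      by (cases n) (simp_all add: fan_fps_def M_def del: fan_poly.simps(2))
  qed
  have "half_bounded M"
    using degree_fan_poly[of "Suc _"] unfolding half_bounded_def M_def less_Suc_eq_le by simp
  then have bd: "half_bounded (T * X ^ 2 * M)" "half_bounded (T * X ^ 2 * M ^ 2)"
    using half_bounded_mult half_bounded_TXX by (auto simp: power2_eq_square)
  have eq: "T * X * fan_fps = T * X ^ 2 * M" "T * fan_fps\<^sup>2 = T * X ^ 2 * M ^ 2"
    by (simp_all add: fan power2_eq_square mult_ac)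
  have "X + 2 * T * X * fan_fps = X + (T * X * fan_fps + T * X * fan_fps)"
    by (simp add: algebra_simps)
  then have "half_bounded (X + 2 * T * X * fan_fps)"
    by (simp only: eq(1)) (intro half_bounded_add half_bounded_X bd)
  then have "half_bounded (geometric (T * X * fan_fps) *
      (geometric (X + 2 * T * X * fan_fps) - 1 - T * fan_fps\<^sup>2))"
    unfolding eq using bd half_bounded_1
    by (intro half_bounded_mult[OF half_bounded_geometric half_bounded_diff[OF half_bounded_diff]]
        half_bounded_geometric) (simp_all add: mult.assoc)
  then have "2 * degree (wheel_fps $ n) \<le> n - 1"
    using assms unfolding half_bounded_def wheel_fps_def by (simp add: fps_X_mult_nth)
  then show ?thesis using assms by linarith
qed

lemma wheel_fps_0_1: "wheel_fps $ 0 = 0" "wheel_fps $ Suc 0 = 0"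
  by (simp_all add: wheel_fps_def geometric_nth_0 power2_eq_square)

text \<open>The empty gap gets the polynomial 1, so the series of gap weights is
  \<open>1 + fan_fps\<close>.\<close>

interpretation weights: block_weights "\<lambda>k. if k = 0 then 1 else fan_poly k" "\<lambda>k. wheel_fps $ k"
  by unfold_locales (simp_all add: wheel_fps_0_1)

section \<open>The substitution v = u / (1 - t u)\<close>

definition V :: "int poly fps" where
  "V = Abs_fps (\<lambda>n. if n = 0 then 0 else var ^ (n - 1))"

lemma V_0 [simp]: "V $ 0 = 0"
  by (simp add: V_def)

lemma V_eq: "V = X + T * X * V"
proof (rule fps_ext)
  fix n
  show "V $ n = (X + T * X * V) $ n"
    by (cases n; cases "n - 1") (simp_all add: V_def mult.assoc fps_X_nth)
qed

lemma X_mult_V: "X * (1 + T * V) = V"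
  using V_eq by (simp add: algebra_simps)

lemma fps_shift_decompose:
  fixes g :: "nat \<Rightarrow> int poly"
  shows "Abs_fps (\<lambda>j. g (k + j)) = fps_const (g k) + X * Abs_fps (\<lambda>j. g (Suc k + j))"
  by (rule fps_ext) (simp add: fps_X_mult_nth split: nat.split)

lemma compose_shift:
  fixes g :: "nat \<Rightarrow> int poly"
  shows "Abs_fps (\<lambda>j. g (k + j)) oo V = fps_const (g k) + V * (Abs_fps (\<lambda>j. g (Suc k + j)) oo V)"
  by (subst fps_shift_decompose) (simp add: fps_compose_add_distrib fps_compose_mult_distrib)

text \<open>The factor \<open>1 + T * V\<close>, which is 1 / (1 - t u), accounts for the merged
  letters before the next \<open>Start\<close> that stays, and \<open>V\<close> for each later
  block. The result obeys the recursion of \<open>rim_sum\<close>, the shift by k representing the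
  blocks already counted.\<close>

lemma compose_shift_nth:
  fixes g :: "nat \<Rightarrow> int poly"
  defines "\<Phi> \<equiv> \<lambda>k. (1 + T * V) * (Abs_fps (\<lambda>j. g (k + j)) oo V)"
  shows "\<Phi> k $ 0 = g k" "\<Phi> k $ Suc a = \<Phi> (Suc k) $ a + var * \<Phi> k $ a"
proof -
  let ?F = "\<lambda>k. Abs_fps (\<lambda>j. g (k + j)) oo V"
  have inv: "(1 - T * X) * (1 + T * V) = 1"
    using V_eq by algebra
  have "(1 - T * X) * \<Phi> k = ?F k"
    using inv unfolding \<Phi>_def by (simp flip: mult.assoc)
  also have "\<dots> = fps_const (g k) + X * \<Phi> (Suc k)"
    unfolding \<Phi>_def by (subst compose_shift) (simp add: X_mult_V flip: mult.assoc)
  finally have "\<Phi> k = fps_const (g k) + X * (\<Phi> (Suc k) + T * \<Phi> k)"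
    by (simp add: algebra_simps)
  then have "\<Phi> k $ n = (fps_const (g k) + X * (\<Phi> (Suc k) + T * \<Phi> k)) $ n" for n
    by (rule arg_cong)
  from this[of 0] this[of "Suc a"]
  show "\<Phi> k $ 0 = g k" "\<Phi> k $ Suc a = \<Phi> (Suc k) $ a + var * \<Phi> k $ a" by simp_all
qed

lemma rim_sum_eq: "weights.rim_sum 0 n = ((1 + T * V) * (wheel_fps oo V)) $ n"
proof -
  have "weights.rim_sum k a = ((1 + T * V) * (Abs_fps (\<lambda>j. wheel_fps $ (k + j)) oo V)) $ a" for k a
    by (induction a arbitrary: k) (simp_all only: weights.rim_sum.simps compose_shift_nth)
  from this[of 0] show ?thesis by (simp add: fps_nth_inverse)
qed

definition H :: "int poly fps" where
  "H = fan_fps oo V"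

text \<open>The inverse of \<open>discr_root\<close>, by \<open>K_mult_discr_root\<close>. The
  prefactor is the one in \<open>rim_sum_eq\<close>.\<close>

definition K :: "int poly fps" where
  "K = (1 + T * V) * (geometric (X + 2 * T * X * fan_fps) oo V)"

lemma H_0 [simp]: "H $ 0 = 0"
  by (simp add: H_def)

text \<open>Behind a hub letter the first letter cannot merge, so the prefactor
  \<open>1 + T * V\<close> appears only after that letter, where \<open>X * (1 + T * V)\<close>
  becomes \<open>V\<close>.\<close>

lemma gap_sum_eq: "weights.gap_sum 0 n = (1 + H) $ n"
proof -
  let ?f = "\<lambda>k. if k = 0 then 1 else fan_poly k"
  let ?F = "\<lambda>k. Abs_fps (\<lambda>j. ?f (k + j)) oo V"
  have pos: "weights.gap_sum (Suc k) a = ((1 + T * V) * ?F (Suc k)) $ a" for k a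
    by (induction a arbitrary: k) (simp_all only: weights.gap_sum.simps nat.distinct if_False
        compose_shift_nth[where g = "\<lambda>k. if k = 0 then 1 else fan_poly k"])
  have "Abs_fps (\<lambda>j. ?f (0 + j)) = 1 + fan_fps"
    by (rule fps_ext) (simp add: fan_fps_def)
  then have "?F 0 = (1 + fan_fps) oo V" by (simp only:)
  then have "1 + H = ?F 0" by (simp only: H_def fps_compose_add_distrib fps_compose_1)
  also have "\<dots> = 1 + X * ((1 + T * V) * ?F 1)"
    by (subst compose_shift) (simp add: X_mult_V flip: mult.assoc)
  finally have "(1 + H) $ n = (1 + X * ((1 + T * V) * ?F 1)) $ n" by (rule arg_cong)
  then show ?thesis using pos[of 0] by (cases n) simp_all
qed

text \<open>Distinguishes the first of the b letters that turns into \<open>Hub\<close>: the j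
  letters before it belong to the current gap, and \<open>b - 1 - j\<close> unrestricted letters
  remain.\<close>

lemma fan_sum_eq:
  "weights.fan_sum a k b = weights.gap_sum k (a + b) +
     var * (\<Sum>j<b. weights.gap_sum k j * weights.fan_sum a 0 (b - 1 - j))"
proof (induction b arbitrary: k)
  case (Suc b)
  let ?g = weights.gap_sum and ?e = "weights.fan_sum a"
  have "(\<Sum>j<Suc b. ?g k j * ?e 0 (Suc b - 1 - j)) =
      ?g k 0 * ?e 0 b + (\<Sum>j<b. ?g k (Suc j) * ?e 0 (b - 1 - j))"
    by (simp add: sum.lessThan_Suc_shift del: sum.lessThan_Suc)
  then show ?case
    by (simp add: Suc.IH algebra_simps sum.distrib sum_distrib_left)
qed simp

section \<open>The series of fans and of cut wheels\<close>

definition Z :: "int poly fps" where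
  "Z = Abs_fps (weights.fan_sum 0 0)"

text \<open>The sum over all cuts in \<open>wheel_sum (Suc n)\<close>.\<close>

definition \<Theta> :: "int poly fps" where
  "\<Theta> = Abs_fps (\<lambda>n. \<Sum>a\<le>n. weights.fan_sum a 0 (n - a))"

lemma Z_eq_G: "Z = (1 + H) + T * X * (1 + H) * Z"
proof (rule fps_ext)
  fix n
  show "Z $ n = ((1 + H) + T * X * (1 + H) * Z) $ n"
  proof (cases n)
    case 0
    then show ?thesis using gap_sum_eq[of 0] by (simp add: Z_def)
  next
    case (Suc b)
    have "(T * X * (1 + H) * Z) $ n = var * ((1 + H) * Z) $ b"
      by (simp add: Suc mult.assoc)
    also have "\<dots> = var * (\<Sum>j<n. weights.gap_sum 0 j * weights.fan_sum 0 0 (n - 1 - j))"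
      unfolding fps_mult_nth gap_sum_eq[symmetric]
      by (simp add: Z_def Suc lessThan_Suc_atMost atMost_atLeast0)
    finally show ?thesis using fan_sum_eq[of 0 0 n] gap_sum_eq[of n] by (simp add: Z_def)
  qed
qed

text \<open>The term without a further hub letter has the same value for all n + 1 cuts, whence the
  derivative of \<open>X * (1 + H)\<close>.\<close>

lemma Theta_eq_G: "\<Theta> = fps_deriv (X * (1 + H)) + T * X * (1 + H) * \<Theta>"
proof (rule fps_ext)
  fix n
  let ?g = "weights.gap_sum 0" and ?e = "\<lambda>a. weights.fan_sum a 0"
  have "\<Theta> $ n = (\<Sum>a\<le>n. ?g n + var * (\<Sum>j<n - a. ?g j * ?e a (n - a - 1 - j)))"
    unfolding \<Theta>_def fps_nth_Abs_fps by (intro sum.cong refl) (subst fan_sum_eq, simp)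
  also have "\<dots> = of_nat (Suc n) * ?g n + var * (\<Sum>a\<le>n. \<Sum>j<n - a. ?g j * ?e a (n - a - 1 - j))"
    by (simp add: sum.distrib sum_distrib_left)
  also have "(\<Sum>a\<le>n. \<Sum>j<n - a. ?g j * ?e a (n - a - 1 - j)) =
      (\<Sum>a\<in>{..n}. \<Sum>j\<in>{j \<in> {..<n}. a + j < n}. ?g j * ?e a (n - a - 1 - j))"
    by (intro sum.cong) auto
  also have "\<dots> = (\<Sum>j\<in>{..<n}. \<Sum>a\<in>{a \<in> {..n}. a + j < n}. ?g j * ?e a (n - a - 1 - j))"
    by (rule sum.swap_restrict) auto
  also have "\<dots> = (\<Sum>j<n. ?g j * \<Theta> $ (n - 1 - j))"
    unfolding \<Theta>_def fps_nth_Abs_fps sum_distrib_left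
    by (intro sum.cong) (auto simp: algebra_simps)
  finally have eq: "\<Theta> $ n = of_nat (Suc n) * (1 + H) $ n + var * (\<Sum>j<n. (1 + H) $ j * \<Theta> $ (n - 1 - j))"
    by (simp only: gap_sum_eq)
  have "(T * X * (1 + H) * \<Theta>) $ n = var * (\<Sum>j<n. (1 + H) $ j * \<Theta> $ (n - 1 - j))"
  proof (cases n)
    case (Suc b)
    have "(T * X * (1 + H) * \<Theta>) $ n = var * ((1 + H) * \<Theta>) $ b" by (simp add: Suc mult.assoc)
    then show ?thesis
      by (simp only: fps_mult_nth Suc lessThan_Suc_atMost atMost_atLeast0 diff_Suc_1)
  qed (simp add: mult.assoc)
  moreover have "fps_deriv (X * (1 + H)) $ n = of_nat (Suc n) * (1 + H) $ n"
    unfolding fps_deriv_nth by simp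
  ultimately show "\<Theta> $ n = (fps_deriv (X * (1 + H)) + T * X * (1 + H) * \<Theta>) $ n"
    using eq by (simp only: fps_add_nth)
qed

lemma H_eq_V: "H = V + V * H + T * V * H\<^sup>2"
proof -
  have "H = (X + X * fan_fps + T * X * fan_fps\<^sup>2) oo V" unfolding H_def using fan_fps_eq by simp
  then show ?thesis
    by (simp add: H_def fps_compose_add_distrib fps_compose_mult_distrib power2_eq_square)
qed

text \<open>Eliminating \<open>V\<close> leaves an equation of Narayana type directly in u.\<close>

lemma H_eq: "H = X * (1 + H) * (1 + T * H)"
  using H_eq_V V_eq by algebra

text \<open>Both sides solve the linear equation \<open>Z_eq_G\<close>, in which the coefficient of
  the unknown has constant term 1.\<close>

lemma Z_eq: "Z = (1 + H) * (1 + T * H)" and H_eq_XZ: "H = X * Z"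
proof -
  let ?Z = "(1 + H) * (1 + T * H)"
  have "?Z = (1 + H) + T * X * (1 + H) * ?Z" using H_eq by algebra
  then have "(Z - ?Z) * (1 - T * X * (1 + H)) = 0" using Z_eq_G by algebra
  moreover have "(1 - T * X * (1 + H)) $ 0 = 1" by simp
  then have "1 - T * X * (1 + H) \<noteq> 0" by (metis fps_zero_nth zero_neq_one)
  ultimately show *: "Z = ?Z" by simp
  show "H = X * Z" unfolding * using H_eq by (simp add: mult.assoc)
qed

lemma Z_quadratic: "Z = 1 + (1 + T) * X * Z + T * X\<^sup>2 * Z\<^sup>2"
  using Z_eq H_eq_XZ by algebra

text \<open>In the quadratic equation both (1 + t) u and t u^2 have no constant term, so each
  coefficient arises from earlier ones by palindromic operations.\<close>

lemma Z_palindromic: "palindromic_fps Z"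
  unfolding palindromic_fps_def
proof
  fix n
  show "palindromic n (Z $ n)"
  proof (induction n rule: less_induct)
    case (less n)
    let ?q = "(1 + T) * X" and ?p = "T * X\<^sup>2"
    have "Z $ n = 1 $ n + (?q * Z) $ n + (?p * Z\<^sup>2) $ n"
      using arg_cong[OF Z_quadratic, of "\<lambda>A. A $ n"] by simp
    moreover have "palindromic n (1 $ n)" using palindromic_1 by simp
    moreover have "palindromic n ((?q * Z) $ n)"
    proof (rule palindromic_mult_nth)
      fix i assume "i \<le> n"
      show "palindromic i (?q $ i)" using palindromic_fps_q by (simp add: palindromic_fps_def)
      show "?q $ i = 0 \<or> palindromic (n - i) (Z $ (n - i))"
        using less[of "n - i"] \<open>i \<le> n\<close> by (cases "i = 0") auto
    qed
    moreover have "palindromic n ((?p * Z\<^sup>2) $ n)"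
    proof (rule palindromic_mult_nth)
      fix i assume "i \<le> n"
      show "palindromic i (?p $ i)" using palindromic_fps_p by (simp add: palindromic_fps_def)
      show "?p $ i = 0 \<or> palindromic (n - i) ((Z\<^sup>2) $ (n - i))"
      proof (cases "i = 0")
        case False
        then have "palindromic (n - i) ((Z * Z) $ (n - i))"
          using \<open>i \<le> n\<close> by (intro palindromic_mult_nth) (auto intro!: less)
        then show ?thesis by (simp add: power2_eq_square)
      qed (simp add: fps_X_power_iff)
    qed
    ultimately show ?case using palindromic_add by simp
  qed
qed

text \<open>Solving the quadratic equation for Z gives 2 t u^2 Z = 1 - (1 + t) u - R. The square
  root is thus available as a series over \<open>int poly\<close> without taking a root.\<close>

definition discr_root :: "int poly fps" where
  "discr_root = 1 - (1 + T) * X - 2 * T * X\<^sup>2 * Z"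

text \<open>By \<open>X * (1 + T * V) = V\<close> and \<open>H = X * Z\<close>, multiplying
  \<open>discr_root\<close> by \<open>1 + T * V\<close> produces exactly the denominator in
  \<open>K\<close>.\<close>

lemma K_mult_discr_root: "K * discr_root = 1"
proof -
  let ?k = "geometric (X + 2 * T * X * fan_fps) oo V"
  have "geometric (X + 2 * T * X * fan_fps) * (1 - (X + 2 * T * X * fan_fps)) oo V = 1"
    by (subst geometric) auto
  then have "?k * (1 - (V + 2 * T * V * H)) = 1"
    by (simp add: H_def fps_compose_add_distrib fps_compose_sub_distrib fps_compose_mult_distrib
        numeral_fps_const)
  moreover have "(1 + T * V) * discr_root = 1 - (V + 2 * T * V * H)"
    unfolding discr_root_def using H_eq_XZ X_mult_V by algebra
  ultimately show ?thesis unfolding K_def by algebra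
qed

lemma K_palindromic: "palindromic_fps K"
proof -
  let ?A = "(1 + T) * X + (T * X\<^sup>2 * Z + T * X\<^sup>2 * Z)"
  have A: "?A $ 0 = 0" by (simp add: fps_mult_nth)
  have discr_root: "discr_root = 1 - ?A" by (simp add: discr_root_def algebra_simps)
  have "K = K * (geometric ?A * discr_root)" using geometric[OF A] by (simp add: discr_root)
  also have "\<dots> = geometric ?A" using K_mult_discr_root by (simp add: mult.left_commute)
  finally have "K = geometric ?A" .
  moreover have "palindromic_fps ?A"
    by (intro palindromic_fps_add palindromic_fps_q
        palindromic_fps_mult[OF palindromic_fps_p Z_palindromic])
  ultimately show ?thesis using palindromic_fps_geometric[OF _ A] by (simp only:)
qed

text \<open>\<open>K\<close> is the term 1 / R of the theorem, and
  \<open>(1 + T) * X + T * X\<^sup>2 * Z\<^sup>2\<close> is the negative of its fraction.\<close>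

definition wheel_Z :: "int poly fps" where
  "wheel_Z = K - 1 - (1 + T) * X - T * X\<^sup>2 * Z\<^sup>2"

lemma wheel_Z_palindromic: "palindromic_fps wheel_Z"
  unfolding wheel_Z_def power2_eq_square[of Z]
  by (intro palindromic_fps_diff K_palindromic palindromic_fps_1 palindromic_fps_q
      palindromic_fps_mult[OF palindromic_fps_p] palindromic_fps_mult[OF Z_palindromic Z_palindromic])

text \<open>Differentiating \<open>H_eq\<close> yields
  \<open>X * fps_deriv H * discr_root = H\<close>, so the derivative in \<open>Theta_eq_G\<close>
  can be expressed by \<open>H * K\<close>.\<close>

lemma Theta_eq: "\<Theta> = (1 + H + H * K) * (1 + T * H)"
proof -
  let ?D = "fps_deriv H"
  have "?D = fps_deriv (X * (1 + H) * (1 + T * H))" using H_eq by simp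
  also have "\<dots> = (1 + H) * (1 + T * H) + X * ?D * (1 + T * H) + X * (1 + H) * (T * ?D)"
    by (simp add: algebra_simps)
  finally have D: "?D = (1 + H) * (1 + T * H) + X * ?D * (1 + T * H) + X * (1 + H) * (T * ?D)" .
  have "X * ?D * discr_root = H"
    unfolding discr_root_def using D H_eq H_eq_XZ by algebra
  then have XD: "X * ?D = H * K" using K_mult_discr_root by (rule eq_mult_inverse)
  have deriv: "fps_deriv (X * (1 + H)) = 1 + H + X * ?D" by (simp add: algebra_simps)
  have inv: "(1 - T * X * (1 + H)) * (1 + T * H) = 1" using H_eq by algebra
  have "\<Theta> * (1 - T * X * (1 + H)) = 1 + H + H * K"
    using Theta_eq_G unfolding deriv XD by (simp add: algebra_simps)
  then show ?thesis using inv by algebra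
qed

text \<open>On the left are the series of the three parts of \<open>wheel_sum\<close>. The term
  \<open>- T * X\<close> cancels the coefficient of \<open>T * X * \<Theta>\<close> at u, below the
  range of wheels, so that the identity holds for the whole series.\<close>

lemma wheel_Z_eq:
  "T * X * \<Theta> - T * X + (1 + T * V) * (wheel_fps oo V) + T * X * V = wheel_Z"
proof -
  let ?s = "geometric (T * X * fan_fps) oo V" and ?k = "geometric (X + 2 * T * X * fan_fps) oo V"
  have "geometric (T * X * fan_fps) * (1 - T * X * fan_fps) oo V = 1"
    by (subst geometric) auto
  then have s: "?s * (1 - T * V * H) = 1"
    by (simp add: H_def fps_compose_sub_distrib fps_compose_mult_distrib)
  have W: "wheel_fps oo V = V * (?s * (?k - 1 - T * H\<^sup>2))"
    unfolding wheel_fps_def power2_eq_square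
    by (simp add: H_def fps_compose_sub_distrib fps_compose_mult_distrib)
  \<comment> \<open>This makes the prefactor absorb the denominator of the wheel series.\<close>
  have "(1 + T * H) * (1 - T * V * H) = 1 + T * V" using H_eq_V by algebra
  then have sV: "(1 + T * V) * ?s = 1 + T * H" using s by algebra
  have Vk: "V * ?k = X * K" unfolding K_def by (simp only: X_mult_V flip: mult.assoc)
  have "(1 + T * V) * (wheel_fps oo V) = (1 + T * H) * (X * K - V - V * T * H\<^sup>2)"
  proof -
    have "(1 + T * V) * (wheel_fps oo V) = ((1 + T * V) * ?s) * (V * ?k - V - V * T * H\<^sup>2)"
      unfolding W by (simp add: algebra_simps)
    then show ?thesis unfolding sV Vk .
  qed
  moreover have XX: "X * (1 - T * H\<^sup>2) = H * discr_root" unfolding discr_root_def using H_eq H_eq_XZ by algebra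
  \<comment> \<open>The final identity contains \<open>K\<close> on the left only through
    \<open>X * K * (1 + T * H)\<^sup>2\<close>; this relation, multiplied by \<open>K\<close>,
    evaluates that term.\<close>
  have "discr_root * (1 + T * H) = 1 - X * (1 + T * H)\<^sup>2"
    using XX unfolding discr_root_def using H_eq_XZ by algebra
  then have "K - X * K * (1 + T * H)\<^sup>2 = 1 + T * H"
    using K_mult_discr_root by algebra
  ultimately show ?thesis
    unfolding wheel_Z_def Theta_eq using H_eq H_eq_V H_eq_XZ V_eq by algebra
qed

lemma wheel_sum_eq:
  assumes "n \<ge> 2"
  shows "weights.wheel_sum n = wheel_Z $ n"
proof -
  obtain m where m: "n = Suc (Suc m)" using assms by (metis Suc_diff_le Suc_eq_plus1 add_2_eq_Suc le_add_diff_inverse)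
  have "wheel_Z $ n = var * \<Theta> $ (n - 1) + ((1 + T * V) * (wheel_fps oo V)) $ n + var ^ (n - 1)"
    by (simp add: wheel_Z_eq[symmetric] m mult.assoc fps_X_nth V_def)
  also have "\<Theta> $ (n - 1) = (\<Sum>a<n. weights.fan_sum a 0 (n - 1 - a))"
    by (simp add: \<Theta>_def m lessThan_Suc_atMost)
  finally show ?thesis by (simp add: weights.wheel_sum_def rim_sum_eq)
qed

interpretation weights: palindromic_weights "\<lambda>k. if k = 0 then 1 else fan_poly k" "\<lambda>k. wheel_fps $ k"
proof
  fix k m :: nat
  show "0 < k \<Longrightarrow> 2 * degree (if k = 0 then 1 else fan_poly k) < k"
    using degree_fan_poly by simp
  show "2 \<le> k \<Longrightarrow> 2 * degree (wheel_fps $ k) < k"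
    using degree_wheel_fps by simp
  show "palindromic m (weights.fan_sum 0 0 m)"
    using Z_palindromic by (simp add: palindromic_fps_def Z_def)
  show "2 \<le> k \<Longrightarrow> palindromic k (weights.wheel_sum k)"
    using wheel_Z_palindromic by (simp add: palindromic_fps_def wheel_sum_eq)
qed

section \<open>The \<open>Z\<close>-polynomials of wheels\<close>

lemma extensions_iff_nth:
  "G \<in> extensions h F \<longleftrightarrow> length G = length F \<and>
     (\<forall>i<length F. step (if i = 0 then h else G ! (i - 1) = Hub) (F ! i) (G ! i))"
proof (induction F arbitrary: h G)
  case (Cons x F)
  show ?case
  proof (cases G)
    case (Cons g G')
    have all: "(\<forall>i<Suc m. P i) \<longleftrightarrow> P 0 \<and> (\<forall>i<m. P (Suc i))" for P :: "nat \<Rightarrow> bool" and m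
      by (metis Suc_less_eq not0_implies_Suc zero_less_Suc)
    have "(if i = 0 then g = Hub else G' ! (i - 1) = Hub) = ((g # G') ! i = Hub)" for i
      by (cases i) auto
    then show ?thesis
      unfolding Cons Cons_in_extensions Cons.IH
      by (simp only: list.size(4) add_Suc_right add_0_right) (auto simp: all)
  qed auto
qed simp

context wheel_graph
begin

definition letter_at :: "letter list \<Rightarrow> nat \<Rightarrow> letter" where
  "letter_at G v = G ! (v - 1)"

definition flat_of :: "letter list \<Rightarrow> nat set set" where
  "flat_of G = edges_of (letter_at G)"

abbreviation "all_Start \<equiv> replicate n Start"
abbreviation "all_Hub \<equiv> replicate n Hub"
text \<open>The word of \<open>Start\<close> only encodes the empty flat, so the words above it
  encode all flats.\<close>

abbreviation "words \<equiv> upward all_Start"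
abbreviation "M \<equiv> graphic_matroid ({0..n}, Ed)"

lemma cyclic_extensions_iff_rim:
  assumes "length F = n"
  shows "G \<in> cyclic_extensions F \<longleftrightarrow> length G = n \<and>
    (\<forall>v\<in>rim. step (letter_at G (prev v) = Hub) (letter_at F v) (letter_at G v))"
proof (cases "length G = n")
  case True
  have G: "last G = G ! (n - 1)" using True n_ge_2 by (subst last_conv_nth) auto
  have "(\<forall>i<n. step (if i = 0 then last G = Hub else G ! (i - 1) = Hub) (F ! i) (G ! i)) \<longleftrightarrow>
      (\<forall>v\<in>rim. step (letter_at G (prev v) = Hub) (letter_at F v) (letter_at G v))" (is "?l \<longleftrightarrow> ?r")
  proof
    assume l: ?l
    show ?r
    proof
      fix v assume "v \<in> rim"
      then have "v - 1 < n" by auto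
      then show "step (letter_at G (prev v) = Hub) (letter_at F v) (letter_at G v)"
        using l[rule_format, of "v - 1"] \<open>v \<in> rim\<close>
        by (auto simp: letter_at_def prev_def G split: if_splits)
    qed
  next
    assume r: ?r
    show ?l
    proof (intro allI impI)
      fix i assume "i < n"
      then have "Suc i \<in> rim" by auto
      then show "step (if i = 0 then last G = Hub else G ! (i - 1) = Hub) (F ! i) (G ! i)"
        using r[rule_format, of "Suc i"] by (auto simp: letter_at_def prev_def G split: if_splits)
    qed
  qed
  then show ?thesis using True assms by (simp add: cyclic_extensions_iff extensions_iff_nth)
qed (use assms in \<open>auto dest: length_cyclic_extensions\<close>)

lemma rim_nth:
  assumes "length G = n"
  shows "(\<exists>v\<in>rim. letter_at G v = x) \<longleftrightarrow> x \<in> set G"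
proof
  assume "\<exists>v\<in>rim. letter_at G v = x"
  then obtain v where "v \<in> rim" "letter_at G v = x" by blast
  then show "x \<in> set G" using assms by (auto simp: letter_at_def in_set_conv_nth intro!: exI[of _ "v - 1"])
next
  assume "x \<in> set G"
  then obtain i where "i < n" "G ! i = x" using assms by (auto simp: in_set_conv_nth)
  then show "\<exists>v\<in>rim. letter_at G v = x" by (intro bexI[of _ "Suc i"]) (auto simp: letter_at_def)
qed

lemma starts_eq_card:
  assumes "length G = n"
  shows "starts G = card {v \<in> rim. letter_at G v = Start}"
proof -
  have "starts G = card {i. i < n \<and> G ! i = Start}"
    using assms by (simp add: count_list_eq_length_filter length_filter_conv_card eq_commute)
  also have "\<dots> = card (Suc ` {i. i < n \<and> G ! i = Start})"
    by (simp add: card_image)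
  also have "Suc ` {i. i < n \<and> G ! i = Start} = {v \<in> rim. letter_at G v = Start}"
  proof (intro equalityI subsetI)
    fix v assume "v \<in> {v \<in> rim. letter_at G v = Start}"
    then show "v \<in> Suc ` {i. i < n \<and> G ! i = Start}"
      by (intro image_eqI[of _ _ "v - 1"]) (auto simp: letter_at_def)
  qed (auto simp: letter_at_def)
  finally show ?thesis .
qed

lemma words_iff: "G \<in> words \<longleftrightarrow> length G = n \<and> valid (letter_at G)"
proof (cases "length G = n")
  case True
  have "letter_at all_Start v = Start" if "v \<in> rim" for v using that by (auto simp: letter_at_def)
  then show ?thesis
    using True rim_nth[OF True, of Hub]
    by (auto simp: upward_def cyclic_extensions_iff_rim valid_def step_def starts_eq_card)
qed (auto simp: upward_def dest: length_cyclic_extensions)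

lemma length_words: "G \<in> words \<Longrightarrow> length G = n"
  by (simp add: words_iff)

text \<open>\<open>step\<close> combines the order on letters in \<open>edges_of_subset_iff\<close>
  with the validity of the upper word, and the latter is \<open>step\<close> above
  \<open>Start\<close>.\<close>

lemma upward_iff:
  assumes "F \<in> words"
  shows "G \<in> upward F \<longleftrightarrow> G \<in> words \<and> flat_of F \<subseteq> flat_of G"
proof -
  have len: "length F = n" using assms by (rule length_words)
  have step_iff: "step h x g \<longleftrightarrow>
      (x = Hub \<longrightarrow> g = Hub) \<and> (x = Cont \<longrightarrow> g = Cont \<or> g = Hub \<and> h) \<and> step h Start g" for h x g
    by (auto simp: step_def)
  have "letter_at all_Start v = Start" if "v \<in> rim" for v using that by (auto simp: letter_at_def)
  then have split: "G \<in> cyclic_extensions F \<longleftrightarrow> G \<in> cyclic_extensions all_Start \<and>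
      (\<forall>v\<in>rim. (letter_at F v = Hub \<longrightarrow> letter_at G v = Hub) \<and>
        (letter_at F v = Cont \<longrightarrow> letter_at G v = Cont \<or> letter_at G v = Hub \<and> letter_at G (prev v) = Hub))"
    unfolding cyclic_extensions_iff_rim[OF len] cyclic_extensions_iff_rim[OF length_replicate]
    by (subst step_iff) auto
  have "G \<in> upward F \<longleftrightarrow> G \<in> words \<and>
      (\<forall>v\<in>rim. (letter_at F v = Hub \<longrightarrow> letter_at G v = Hub) \<and>
        (letter_at F v = Cont \<longrightarrow> letter_at G v = Cont \<or> letter_at G v = Hub \<and> letter_at G (prev v) = Hub))"
    unfolding upward_def mem_Collect_eq split by blast
  then show ?thesis
    unfolding flat_of_def using edges_of_subset_iff assms by (auto simp: words_iff)
qed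

lemma inj_flat_of: "inj_on flat_of words"
proof (rule inj_onI)
  fix F G assume FG: "F \<in> words" "G \<in> words" "flat_of F = flat_of G"
  have "F ! i = G ! i" if "i < n" for i
    using edges_of_eqD[of "letter_at F" "letter_at G" "Suc i"] FG that
    by (simp add: words_iff flat_of_def letter_at_def)
  then show "F = G" using FG length_words by (intro nth_equalityI) auto
qed

lemma edges_of_cong: "(\<And>v. v \<in> rim \<Longrightarrow> y v = z v) \<Longrightarrow> edges_of y = edges_of z"
  unfolding edges_of_def using prev_rim by (intro arg_cong2[of _ _ _ _ "(\<union>)"] Collect_cong) metis+

lemma valid_cong:
  assumes "\<And>v. v \<in> rim \<Longrightarrow> y v = z v"
  shows "valid y \<longleftrightarrow> valid z"
proof -
  have "{v \<in> rim. y v = Start} = {v \<in> rim. z v = Start}" using assms by auto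
  then show ?thesis unfolding valid_def using assms prev_rim by simp
qed

lemma flats_wheel: "flats M = flat_of ` words"
proof (intro equalityI subsetI)
  fix F assume "F \<in> flat_of ` words"
  then show "F \<in> flats M" using edges_of_flat by (auto simp: words_iff flat_of_def)
next
  fix F assume F: "F \<in> flats M"
  define y where "y = (\<lambda>v. if {0, v} \<in> F then Hub else if {prev v, v} \<in> F then Cont else Start)"
  have y: "valid y" "edges_of y = F" using flat_edges_of[OF F] by (simp_all add: y_def)
  define G where "G = map y [1..<Suc n]"
  have eq: "letter_at G v = y v" if "v \<in> rim" for v
    using that by (auto simp: letter_at_def G_def simp del: upt_Suc)
  have "length G = n" by (simp add: G_def)
  then have "G \<in> words" using y valid_cong[of "letter_at G" y] eq by (simp add: words_iff)
  moreover have "flat_of G = F" using y edges_of_cong[of "letter_at G" y] eq by (simp add: flat_of_def)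
  ultimately show "F \<in> flat_of ` words" by blast
qed

lemma rank_flat_of:
  assumes "G \<in> words"
  shows "rank_of M (flat_of G) = word_rank G"
proof -
  have len: "length G = n" using assms by (rule length_words)
  have "x = Cont \<longleftrightarrow> x \<noteq> Hub \<and> x \<noteq> Start" for x by (cases x) auto
  then have "(\<forall>v\<in>rim. letter_at G v = Cont) \<longleftrightarrow> Hub \<notin> set G \<and> Start \<notin> set G"
    unfolding rim_nth[OF len, symmetric] by metis
  then have "(\<forall>v\<in>rim. letter_at G v = Cont) \<longleftrightarrow> Hub \<notin> set G \<and> starts G = 0"
    by (simp add: count_list_0_iff)
  then show ?thesis
    using rank_graphic[OF edges_of_subset] rank_edges_of[of "letter_at G"] len
    by (simp add: flat_of_def word_rank_def starts_eq_card)
qed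

lemma top_word: "all_Hub \<in> words" and flat_of_top: "flat_of all_Hub = Ed"
proof -
  have Hub: "letter_at all_Hub v = Hub" if "v \<in> rim" for v using that by (auto simp: letter_at_def)
  then show "all_Hub \<in> words" using n_ge_2 by (force simp: words_iff valid_def)
  show "flat_of all_Hub = Ed"
    unfolding flat_of_def edges_of_def wheel_edges using Hub prev_rim
    by (intro arg_cong2[of _ _ _ _ "(\<union>)"] Collect_cong) auto
qed

end

text \<open>Since all flats lie above the empty one, the Z-polynomial is itself one of the
  palindromic sums, namely the word sum above \<open>all_Start\<close>.\<close>

lemma Z_graph_wheel:
  assumes "n \<ge> 2"
  shows "Z_graph (wheel n) = wheel_Z $ n"
proof -
  interpret wheel_graph n by unfold_locales (rule assms)
  interpret M: loopless_matroid M by (rule graphic_loopless_matroid)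
  have starts_all: "starts all_Start = n" by (simp add: count_list_eq_length_filter)
  define q where "q A = weights.block_poly (the_inv_into words flat_of A)" for A
  have q: "q (flat_of G) = weights.block_poly G" if "G \<in> words" for G
    using that by (simp add: q_def the_inv_into_f_f[OF inj_flat_of])
  have ground: "ground M = Ed" by (rule ground_graphic)
  have word_rank_top: "word_rank all_Hub = n" using n_ge_2 by (simp add: word_rank_def)
  have rank_top: "rank_of M (ground M) = n"
    using rank_flat_of[OF top_word] flat_of_top ground word_rank_top by simp
  have sum_above: "(\<Sum>A\<in>M.iv (flat_of G) (ground M). monom 1 (rank_of M A - rank_of M (flat_of G)) * q A) =
      weights.word_sum G" if G: "G \<in> words" for G
  proof -
    have iv: "M.iv (flat_of G) (ground M) = flat_of ` upward G"
      using M.flat_subset upward_iff[OF G] by (auto simp: interval_def flats_wheel)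
    have sub: "upward G \<subseteq> words" using upward_iff[OF G] by blast
    have "inj_on flat_of (upward G)" using inj_flat_of sub by (rule inj_on_subset)
    then have "(\<Sum>A\<in>M.iv (flat_of G) (ground M). monom 1 (rank_of M A - rank_of M (flat_of G)) * q A) =
        (\<Sum>G'\<in>upward G. monom 1 (rank_of M (flat_of G') - rank_of M (flat_of G)) * q (flat_of G'))"
      unfolding iv by (simp add: sum.reindex)
    also have "\<dots> = weights.word_sum G"
      unfolding weights.word_sum_def using sub G
      by (intro sum.cong refl) (auto simp: rank_flat_of q var_power)
    finally show ?thesis .
  qed
  have "Z_poly M = (\<Sum>F\<in>flats M. monom 1 (rank_of M F) * q F)"
  proof (rule M.Z_poly_eq)
    have "all_Hub = [] @ Hub # replicate (n - 1) Hub" using n_ge_2 by (cases n) auto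
    then have "weights.block_poly all_Hub = 1"
      using weights.block_poly_Hub[of "[]"] weights.path_weight_replicate_Hub by simp
    then show "q (ground M) = 1" using q[OF top_word] flat_of_top ground by simp
  next
    fix F assume "F \<in> flats M" "F \<noteq> ground M"
    then obtain G where G: "F = flat_of G" "G \<in> words" "G \<noteq> all_Hub"
      unfolding flats_wheel using flat_of_top ground by blast
    have "length G = n" using G length_words by blast
    then have "2 * degree (weights.block_poly G) < length G - word_rank G"
      using G n_ge_2 by (intro weights.degree_block_poly[of G all_Start]) (auto simp: upward_def)
    then show "2 * degree (q F) < rank_of M (ground M) - rank_of M F"
      using G \<open>length G = n\<close> by (simp add: q rank_top rank_flat_of)
  next
    fix F assume "F \<in> flats M"
    then obtain G where G: "F = flat_of G" "G \<in> words" unfolding flats_wheel by blast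
    have "length G = n" using G length_words by blast
    moreover have "palindromic (length G - word_rank G) (weights.word_sum G)"
      using G \<open>length G = n\<close> n_ge_2 by (intro weights.word_sum_palindromic) (auto simp: upward_def)
    ultimately show "palindromic (rank_of M (ground M) - rank_of M F)
        (\<Sum>A\<in>M.iv F (ground M). monom 1 (rank_of M A - rank_of M F) * q A)"
      unfolding G(1) unfolding sum_above[OF G(2)] rank_top by (simp add: rank_flat_of[OF G(2)])
  qed
  also have "\<dots> = (\<Sum>G\<in>words. monom 1 (word_rank G) * weights.block_poly G)"
    unfolding flats_wheel by (simp add: sum.reindex[OF inj_flat_of] rank_flat_of q)
  also have "\<dots> = weights.word_sum all_Start"
    using n_ge_2 by (simp add: weights.word_sum_def var_power word_rank_def[of all_Start] starts_all)
  also have "\<dots> = wheel_Z $ n"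
    using n_ge_2 by (simp add: weights.word_sum_wheel wheel_sum_eq starts_all)
  finally have "Z_poly M = wheel_Z $ n" .
  moreover have "wheel n = ({0..n}, Ed)" by (simp add: wheel_def)
  ultimately show ?thesis unfolding Z_graph_def by simp
qed

text \<open>The sum in the theorem starts at n = 2, so the closed form must have no lower
  terms.\<close>

lemma wheel_Z_0_1: "wheel_Z $ 0 = 0" "wheel_Z $ Suc 0 = 0"
proof -
  have "K = 1 + ((1 + T) * X + 2 * T * X\<^sup>2 * Z) * K"
    using K_mult_discr_root by (simp add: discr_root_def algebra_simps)
  then have K: "K $ n = (1 + ((1 + T) * X + 2 * T * X\<^sup>2 * Z) * K) $ n" for n by (rule arg_cong)
  have "K $ 0 = 1" using K[of 0] by simp
  moreover from this have "K $ Suc 0 = 1 + var"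
    using K[of "Suc 0"] by (simp add: fps_mult_nth fps_X_power_iff numeral_fps_const)
  ultimately show "wheel_Z $ 0 = 0" "wheel_Z $ Suc 0 = 0"
    by (simp_all add: wheel_Z_def fps_mult_nth fps_X_power_iff)
qed

section \<open>Passage to the fraction field\<close>

definition fract_fps :: "'a::idom fps \<Rightarrow> 'a fract fps" where
  "fract_fps A = Abs_fps (\<lambda>n. to_fract (A $ n))"

lemma fract_fps_hom [simp]:
  "fract_fps (A + B) = fract_fps A + fract_fps B"
  "fract_fps (A - B) = fract_fps A - fract_fps B"
  "fract_fps (A * B) = fract_fps A * fract_fps B"
  "fract_fps 1 = 1"
  "fract_fps fps_X = fps_X"
  "fract_fps (fps_const c) = fps_const (to_fract c)"
  by (simp_all add: fract_fps_def fps_eq_iff fps_mult_nth fps_X_nth)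

lemma fract_fps_2 [simp]: "fract_fps 2 = 2"
  using fract_fps_hom(1)[of 1 1] by simp

lemma fract_fps_power [simp]: "fract_fps (A ^ k) = fract_fps A ^ k"
  by (induction k) simp_all

theorem theorem6p6:
  fixes t u R :: "int poly fract fps"
  defines "t \<equiv> fps_const (to_fract [:0, 1:])"
    and "u \<equiv> fps_X"
    and "R \<equiv> fps_sqrt ((1 - (t + 1) * u)\<^sup>2 - 4 * t * u\<^sup>2)"
  shows "Abs_fps (\<lambda>n. if n \<ge> 2 then to_fract (Z_graph (wheel n)) else 0) =
    - (2 * u * (1 - (t + 1) * u) * (t * (u + 1) + 1)) / (1 - (t + 1) * u - 2 * t * u\<^sup>2 + R)
    + 1 / R - 1"
proof -
  define z k where "z = fract_fps Z" and "k = fract_fps K"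
  have tu: "fps_const (to_fract var) = t" "fps_X = u" by (simp_all add: t_def u_def var_def)
  have quad: "z = 1 + (1 + t) * u * z + t * u\<^sup>2 * z\<^sup>2"
    using arg_cong[OF Z_quadratic, of fract_fps] by (simp add: z_def tu)
  \<comment> \<open>The image of \<open>discr_root\<close>: by the quadratic equation its square is
    the discriminant, and its constant term 1 identifies it with \<open>R\<close>.\<close>
  define R' where "R' = 1 - (1 + t) * u - 2 * t * u\<^sup>2 * z"
  have kR: "k * R' = 1"
    using arg_cong[OF K_mult_discr_root, of fract_fps] by (simp add: discr_root_def R'_def z_def k_def tu)
  have u0: "u $ 0 = 0" by (simp add: u_def)
  have "R'\<^sup>2 = (1 - (t + 1) * u)\<^sup>2 - 4 * t * u\<^sup>2"
    using quad unfolding R'_def by algebra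
  moreover have "R' $ 0 = 1" by (simp add: R'_def u0 fps_mult_nth power2_eq_square)
  moreover have "((1 - (t + 1) * u)\<^sup>2 - 4 * t * u\<^sup>2) $ 0 = 1"
    by (simp add: u0 fps_mult_nth power2_eq_square)
  ultimately have R: "R = R'" using fps_sqrt_iff unfolding R_def by metis
  let ?c = "(1 + t) * u + t * u\<^sup>2 * z\<^sup>2" and ?d = "1 - (t + 1) * u - 2 * t * u\<^sup>2 + R"
  \<comment> \<open>By the quadratic equation for \<open>z\<close> the numerator contains the
    denominator as a factor, so the fraction reduces to \<open>- ?c\<close>.\<close>
  have num: "- (2 * u * (1 - (t + 1) * u) * (t * (u + 1) + 1)) = - ?c * ?d"
    using quad unfolding R R'_def by algebra
  have "?d $ 0 = 2"
    using \<open>R' $ 0 = 1\<close> by (simp add: R u0 fps_mult_nth power2_eq_square)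
  then have "?d \<noteq> 0" by (metis fps_zero_nth zero_neq_numeral)
  then have "- (2 * u * (1 - (t + 1) * u) * (t * (u + 1) + 1)) / ?d = - ?c"
    unfolding num by (rule nonzero_mult_div_cancel_right)
  moreover have "R \<noteq> 0" using kR R by auto
  then have "1 / R = k" using nonzero_mult_div_cancel_right[of R k] kR R by simp
  moreover have "Abs_fps (\<lambda>n. if n \<ge> 2 then to_fract (Z_graph (wheel n)) else 0) = fract_fps wheel_Z"
  proof (rule fps_ext)
    fix n
    consider "n = 0" | "n = Suc 0" | "n \<ge> 2" by linarith
    then show "Abs_fps (\<lambda>n. if n \<ge> 2 then to_fract (Z_graph (wheel n)) else 0) $ n = fract_fps wheel_Z $ n"
      by cases (simp_all add: fract_fps_def wheel_Z_0_1 Z_graph_wheel)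
  qed
  ultimately show ?thesis
    by (simp add: wheel_Z_def tu z_def k_def)
qed

end
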